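(* Let $\mathcal{C}$ be a smooth addable class of graphs and $m\in\mathbb{N}$. If $\mathcal{A}$ is an $\equiv_m$-equivalence class of connected graphs, then for each $k\le r_m$ there is $p_k(\mathcal{A})\in\mathbb{R}$ such that the probability that $R_n(\mathcal{C})$ has exactly $k$ connected components belonging to $\mathcal{A}$ tends to $p_k(\mathcal{A})$ as $n\to\infty$.
   Context: Graphs are finite, simple and undirected; classes of graphs are closed under isomorphism. $\mathcal{C}_n$ is the set of graphs in $\mathcal{C}$ with vertex set $[n]$, $R_n(\mathcal{C})$ is drawn uniformly from $\mathcal{C}_n$. $\mathcal{C}$ is addable if (decomposable) $G\in\mathcal{C}$ iff every connected component of $G$ is in $\mathcal{C}$, and (bridge-addable) for every $G\in\mathcal{C}$ and vertices $u,v$ in distinct components, adding edge $\{u,v\}$ gives a graph in $\mathcal{C}$. $\mathcal{C}$ is smooth if $|\mathcal{C}_n|/(n|\mathcal{C}_{n-1}|)$ tends to a finite limit. For graphs $G,H$, $G\equiv_m H$ means $G$ and $H$ satisfy the same MSO sentences (formulas built from $x\in X$, $E(x,y)$, Boolean connectives, first- and second-order quantifiers) of quantifier rank at most $m$, where quantifier rank counts nesting depth of both first- and second-order quantifiers. $r_m$ is a fixed positive integer (depending only on $m$) such that whenever $\{G_i : i\in I\}$ are pairwise $\equiv_m$-equivalent graphs and $P,Q\subseteq I$ satisfy $|P|=|Q|$ or $|P|,|Q|\ge r_m$, the disjoint unions $\bigoplus_{i\in P}G_i$ and $\bigoplus_{j\in Q}G_j$ are $\equiv_m$-equivalent. *)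

theory Defs
  imports
    "HOL-Probability.Probability"
    "Graph_Theory.Graph_Theory"
begin

text \<open>
  Finite simple undirected graphs are the \<^const>\<open>pair_graph\<close>s, i.e. finite symmetric loop-free
  relations on a vertex set. A class of graphs is represented by its members with vertices in
  \<^typ>\<open>nat\<close>, which loses nothing because classes are closed under isomorphism. The graph without
  vertices is a graph; it is not connected and has no components.
  The name \<open>connected\<close> is qualified throughout to tell it from topological connectedness.
\<close>

section \<open>Classes of graphs\<close>

definition graph_class :: "nat pair_pre_digraph set \<Rightarrow> bool" where
  "graph_class C \<longleftrightarrow>
     (\<forall>G\<in>C. pair_graph G) \<and>
     (\<forall>G\<in>C. \<forall>H. digraph_iso (with_proj G) (with_proj H) \<longrightarrow> H \<in> C)"

definition graph_components :: "'a pair_pre_digraph \<Rightarrow> 'a pair_pre_digraph set" where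
  "graph_components G =
     {H. pre_digraph.max_subgraph (with_proj G) Digraph_Component.connected (with_proj H)}"

definition add_edge :: "'a \<Rightarrow> 'a \<Rightarrow> 'a pair_pre_digraph \<Rightarrow> 'a pair_pre_digraph" where
  "add_edge u v G = \<lparr>pverts = pverts G, parcs = parcs G \<union> {(u, v), (v, u)}\<rparr>"

definition decomposable :: "nat pair_pre_digraph set \<Rightarrow> bool" where
  "decomposable C \<longleftrightarrow> (\<forall>G. pair_graph G \<longrightarrow> (G \<in> C \<longleftrightarrow> (\<forall>H\<in>graph_components G. H \<in> C)))"

definition bridge_addable :: "nat pair_pre_digraph set \<Rightarrow> bool" where
  "bridge_addable C \<longleftrightarrow>
     (\<forall>G\<in>C. \<forall>H\<in>graph_components G. \<forall>K\<in>graph_components G. \<forall>u\<in>pverts H. \<forall>v\<in>pverts K.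
        H \<noteq> K \<longrightarrow> add_edge u v G \<in> C)"

definition addable :: "nat pair_pre_digraph set \<Rightarrow> bool" where
  "addable C \<longleftrightarrow> decomposable C \<and> bridge_addable C"

definition graphs_on :: "nat pair_pre_digraph set \<Rightarrow> nat \<Rightarrow> nat pair_pre_digraph set" where
  "graphs_on C n = {G \<in> C. pverts G = {1..n}}"

text \<open>
  The first conjunct expresses that the quotients are defined from some point on. Without it,
  \<open>x / 0 = 0\<close> would make, e.g., a class without graphs of odd order smooth. It also ensures
  that the uniform distribution on \<^term>\<open>graphs_on C n\<close> exists for all large \<open>n\<close>.
\<close>

definition smooth :: "nat pair_pre_digraph set \<Rightarrow> bool" where
  "smooth C \<longleftrightarrow>
     (\<forall>\<^sub>F n in sequentially. graphs_on C n \<noteq> {}) \<and>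
     (\<exists>\<gamma>::real. (\<lambda>n. real (card (graphs_on C n)) / (real n * real (card (graphs_on C (n - 1)))))
        \<longlonglongrightarrow> \<gamma>)"

definition random_graph :: "nat pair_pre_digraph set \<Rightarrow> nat \<Rightarrow> nat pair_pre_digraph pmf" where
  "random_graph C n = pmf_of_set (graphs_on C n)"


section \<open>Monadic second-order logic of graphs\<close>

text \<open>
  First-order and second-order variables are two separate copies of \<^typ>\<open>nat\<close>. The other
  Boolean connectives and the universal quantifiers are the usual abbreviations, which have
  the same quantifier rank as the direct versions.
\<close>

datatype mso =
    Mem nat nat
  | Edge nat nat
  | Neg mso
  | Conj mso mso
  | ExV nat mso
  | ExS nat mso

fun mso_sat :: "'a pair_pre_digraph \<Rightarrow> (nat \<Rightarrow> 'a) \<Rightarrow> (nat \<Rightarrow> 'a set) \<Rightarrow> mso \<Rightarrow> bool" where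
  "mso_sat G e s (Mem x X) \<longleftrightarrow> e x \<in> s X"
| "mso_sat G e s (Edge x y) \<longleftrightarrow> (e x, e y) \<in> parcs G"
| "mso_sat G e s (Neg \<phi>) \<longleftrightarrow> \<not> mso_sat G e s \<phi>"
| "mso_sat G e s (Conj \<phi> \<psi>) \<longleftrightarrow> mso_sat G e s \<phi> \<and> mso_sat G e s \<psi>"
| "mso_sat G e s (ExV x \<phi>) \<longleftrightarrow> (\<exists>v\<in>pverts G. mso_sat G (e(x := v)) s \<phi>)"
| "mso_sat G e s (ExS X \<phi>) \<longleftrightarrow> (\<exists>S. S \<subseteq> pverts G \<and> mso_sat G e (s(X := S)) \<phi>)"

fun quantifier_rank :: "mso \<Rightarrow> nat" where
  "quantifier_rank (Mem x X) = 0"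
| "quantifier_rank (Edge x y) = 0"
| "quantifier_rank (Neg \<phi>) = quantifier_rank \<phi>"
| "quantifier_rank (Conj \<phi> \<psi>) = max (quantifier_rank \<phi>) (quantifier_rank \<psi>)"
| "quantifier_rank (ExV x \<phi>) = Suc (quantifier_rank \<phi>)"
| "quantifier_rank (ExS X \<phi>) = Suc (quantifier_rank \<phi>)"

fun free_vars :: "mso \<Rightarrow> nat set" where
  "free_vars (Mem x X) = {x}"
| "free_vars (Edge x y) = {x, y}"
| "free_vars (Neg \<phi>) = free_vars \<phi>"
| "free_vars (Conj \<phi> \<psi>) = free_vars \<phi> \<union> free_vars \<psi>"
| "free_vars (ExV x \<phi>) = free_vars \<phi> - {x}"
| "free_vars (ExS X \<phi>) = free_vars \<phi>"

fun free_set_vars :: "mso \<Rightarrow> nat set" where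
  "free_set_vars (Mem x X) = {X}"
| "free_set_vars (Edge x y) = {}"
| "free_set_vars (Neg \<phi>) = free_set_vars \<phi>"
| "free_set_vars (Conj \<phi> \<psi>) = free_set_vars \<phi> \<union> free_set_vars \<psi>"
| "free_set_vars (ExV x \<phi>) = free_set_vars \<phi>"
| "free_set_vars (ExS X \<phi>) = free_set_vars \<phi> - {X}"

definition mso_sentence :: "mso \<Rightarrow> bool" where
  "mso_sentence \<phi> \<longleftrightarrow> free_vars \<phi> = {} \<and> free_set_vars \<phi> = {}"

text \<open>The truth value of a sentence does not depend on the assignments.\<close>

definition mso_models :: "'a pair_pre_digraph \<Rightarrow> mso \<Rightarrow> bool" where
  "mso_models G \<phi> \<longleftrightarrow> (\<forall>e s. mso_sat G e s \<phi>)"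

definition mso_equiv :: "nat \<Rightarrow> 'a pair_pre_digraph \<Rightarrow> 'b pair_pre_digraph \<Rightarrow> bool" where
  "mso_equiv m G H \<longleftrightarrow>
     (\<forall>\<phi>. mso_sentence \<phi> \<and> quantifier_rank \<phi> \<le> m \<longrightarrow> (mso_models G \<phi> \<longleftrightarrow> mso_models H \<phi>))"

definition connected_graphs :: "nat pair_pre_digraph set" where
  "connected_graphs = {G. pair_graph G \<and> Digraph_Component.connected (with_proj G)}"

definition connected_mso_equiv :: "nat \<Rightarrow> nat pair_pre_digraph rel" where
  "connected_mso_equiv m = {(G, H) \<in> connected_graphs \<times> connected_graphs. mso_equiv m G H}"


section \<open>Disjoint unions\<close>

definition disjoint_union :: "'i set \<Rightarrow> ('i \<Rightarrow> 'a pair_pre_digraph) \<Rightarrow> ('i \<times> 'a) pair_pre_digraph" where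
  "disjoint_union P G =
     \<lparr>pverts = Sigma P (\<lambda>i. pverts (G i)),
      parcs = {((i, u), (i, v)) | i u v. i \<in> P \<and> (u, v) \<in> parcs (G i)}\<rparr>"

text \<open>
  The defining property of the number \<open>r\<^sub>m\<close>. The index sets \<open>P\<close> and \<open>Q\<close> are finite because
  graphs are finite, hence indices and vertices in \<^typ>\<open>nat\<close> suffice.
\<close>

definition union_threshold :: "nat \<Rightarrow> nat \<Rightarrow> bool" where
  "union_threshold m r \<longleftrightarrow>
     0 < r \<and>
     (\<forall>(I :: nat set) (G :: nat \<Rightarrow> nat pair_pre_digraph) P Q.
        (\<forall>i\<in>I. pair_graph (G i)) \<and> (\<forall>i\<in>I. \<forall>j\<in>I. mso_equiv m (G i) (G j)) \<and>
        P \<subseteq> I \<and> Q \<subseteq> I \<and> finite P \<and> finite Q \<and>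
        (card P = card Q \<or> r \<le> card P \<and> r \<le> card Q) \<longrightarrow>
        mso_equiv m (disjoint_union P G) (disjoint_union Q G))"

end

theory Submission
  imports Defs
begin

text \<open>
  Removing a component and using smoothness shows that the binomial moments of the number of
  components of bounded size in \<open>A\<close> converge, and Bonferroni's inequalities turn this into
  convergence of the distribution. Bridge-addability bounds the expected number of pairs of vertices
  in different components by \<open>2n\<close>; hence, up to small probability, exactly one component is
  large, and it has more than \<open>n/2\<close> vertices. It remains to see that the large component
  asymptotically has a fixed \<open>m\<close>-type.
  Fix a rooted graph \<open>(U, u)\<close> of the class that absorbs, up to rank \<open>m\<close>, every connected graph of the
  class attached to its root: attach to some vertex sufficiently many copies of each rooted type. A
  connected graph of the class with a pendant copy of \<open>U\<close> is then equivalent to \<open>U\<close>, and a switching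
  argument shows that the large component contains such a copy with probability tending to 1.
\<close>

section \<open>A set-move Ehrenfeucht--Fraisse game\<close>

text \<open>An addable class need not be closed under deleting edges or vertices: its graphs can
  only be joined by bridges and split along components. Hence every switching adds edges, graphs of
  different orders are compared through smoothness, and the remainder of a component after cutting
  off a pendant copy may leave the class. Smoothness by itself would allow the limit \<gamma> to be
  0; since a random graph has at most 3 components on average, \<gamma> is positive, and dividing by
  its powers is legitimate. All attachments are analysed with games, whose equivalence may be finer
  than that of formulas of rank \<open>m\<close> because being a singleton is atomic. Games compose
  along gluings and have finitely many types, which is what an absorbing graph requires; formulas
  enter only at the end. Types are rooted, since equivalence without a root would not survive
  attaching at a vertex. The class \<open>A\<close> may have arbitrarily large members, so only
  those with at most \<open>L\<close> vertices are counted directly. The large component adds a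
  constant \<delta>, 0 or 1, determined by the type of \<open>U\<close>. The error is made small by
  letting \<open>n\<close> grow with \<open>L\<close> fixed and by choosing \<open>L\<close> large
  beforehand.\<close>

text \<open>
  The players only choose sets; a vertex move is a move of a singleton, which is why the atomic
  information records which sets are singletons. Only the parameters with index below \<open>p\<close> count,
  and only their intersections with the set of vertices.
\<close>

definition meets :: "'a pair_pre_digraph \<Rightarrow> (nat \<Rightarrow> 'a set) \<Rightarrow> nat \<Rightarrow> nat \<Rightarrow> bool" where
  "meets G s i j \<longleftrightarrow> s i \<inter> s j \<inter> pverts G \<noteq> {}"

definition single :: "'a pair_pre_digraph \<Rightarrow> (nat \<Rightarrow> 'a set) \<Rightarrow> nat \<Rightarrow> bool" where
  "single G s i \<longleftrightarrow> is_singleton (s i \<inter> pverts G)"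

definition linked :: "'a pair_pre_digraph \<Rightarrow> (nat \<Rightarrow> 'a set) \<Rightarrow> nat \<Rightarrow> nat \<Rightarrow> bool" where
  "linked G s i j \<longleftrightarrow> (\<exists>u\<in>s i \<inter> pverts G. \<exists>v\<in>s j \<inter> pverts G. (u, v) \<in> parcs G)"

definition atoms :: "nat \<Rightarrow> 'a pair_pre_digraph \<Rightarrow> (nat \<Rightarrow> 'a set)
    \<Rightarrow> (nat \<times> nat) set \<times> nat set \<times> (nat \<times> nat) set" where
  "atoms p G s = ({(i, j). i < p \<and> j < p \<and> meets G s i j}, {i. i < p \<and> single G s i},
     {(i, j). i < p \<and> j < p \<and> linked G s i j})"

primrec game :: "nat \<Rightarrow> nat \<Rightarrow> 'a pair_pre_digraph \<Rightarrow> (nat \<Rightarrow> 'a set)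
    \<Rightarrow> 'b pair_pre_digraph \<Rightarrow> (nat \<Rightarrow> 'b set) \<Rightarrow> bool" where
  "game 0 p G s H t \<longleftrightarrow> atoms p G s = atoms p H t"
| "game (Suc n) p G s H t \<longleftrightarrow>
     (\<forall>S. \<exists>T. game n (Suc p) G (s(p := S)) H (t(p := T))) \<and>
     (\<forall>T. \<exists>S. game n (Suc p) G (s(p := S)) H (t(p := T)))"

lemma atoms_eq_iff:
  "atoms p G s = atoms p H t \<longleftrightarrow>
     (\<forall>i<p. single G s i = single H t i) \<and>
     (\<forall>i<p. \<forall>j<p. meets G s i j = meets H t i j \<and> linked G s i j = linked H t i j)"
  unfolding atoms_def by (auto simp: set_eq_iff)

lemma game_refl: "game n p G s G s"
  by (induction n arbitrary: p s) auto

lemma game_sym: "game n p G s H t \<Longrightarrow> game n p H t G s"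
proof (induction n arbitrary: p s t)
  case (Suc n)
  then show ?case by (simp) meson
qed auto

lemma game_trans: "game n p G s H t \<Longrightarrow> game n p H t K r \<Longrightarrow> game n p G s K r"
proof (induction n arbitrary: p s t r)
  case (Suc n)
  show ?case
    unfolding game.simps
  proof (intro conjI allI)
    fix S
    obtain T where T: "game n (Suc p) G (s(p := S)) H (t(p := T))" using Suc.prems(1) by auto
    obtain R where "game n (Suc p) H (t(p := T)) K (r(p := R))" using Suc.prems(2) by auto
    then show "\<exists>R. game n (Suc p) G (s(p := S)) K (r(p := R))" using T Suc.IH by blast
  next
    fix R
    obtain T where T: "game n (Suc p) H (t(p := T)) K (r(p := R))" using Suc.prems(2) by auto
    obtain S where "game n (Suc p) G (s(p := S)) H (t(p := T))" using Suc.prems(1) by auto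
    then show "\<exists>S. game n (Suc p) G (s(p := S)) K (r(p := R))" using T Suc.IH by blast
  qed
qed auto

lemma game_restrict:
  assumes "\<And>i. i < p \<Longrightarrow> s i \<inter> pverts G = s' i \<inter> pverts G"
  shows "game n p G s G s'"
  using assms
proof (induction n arbitrary: p s s')
  case 0
  have "s i \<inter> s j \<inter> pverts G = s' i \<inter> s' j \<inter> pverts G" if "i < p" "j < p" for i j
    using 0[OF that(1)] 0[OF that(2)] by blast
  then show ?case using 0 by (simp add: atoms_eq_iff meets_def single_def linked_def)
next
  case (Suc n)
  have "game n (Suc p) G (s(p := S)) G (s'(p := S))" for S
    using Suc.prems by (intro Suc.IH) (auto simp: less_Suc_eq)
  then show ?case by auto
qed

text \<open>Spend each remaining round on the empty set and then forget the new slot; the answer in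
  that slot does not matter.\<close>

lemma game_atoms: "game n p G s H t \<Longrightarrow> atoms p G s = atoms p H t"
proof (induction n arbitrary: p s t)
  case (Suc n)
  then have "\<forall>S. \<exists>T. game n (Suc p) G (s(p := S)) H (t(p := T))" by simp
  then obtain T where "game n (Suc p) G (s(p := {})) H (t(p := T))" by blast
  then have *: "atoms (Suc p) G (s(p := {})) = atoms (Suc p) H (t(p := T))" by (rule Suc.IH)
  have "single G s i = single H t i" if "i < p" for i
    using * that unfolding atoms_eq_iff by (auto simp: single_def dest!: spec[of _ i])
  moreover have "meets G s i j = meets H t i j \<and> linked G s i j = linked H t i j" if "i < p" "j < p" for i j
  proof -
    have "meets G (s(p := {})) i j = meets H (t(p := T)) i j \<and>
        linked G (s(p := {})) i j = linked H (t(p := T)) i j"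
      using * that unfolding atoms_eq_iff by simp
    then show ?thesis using that by (simp add: meets_def linked_def)
  qed
  ultimately show ?case by (simp add: atoms_eq_iff)
qed auto

text \<open>Slots may be renamed, duplicated, dropped or emptied (where \<open>c\<close> holds): a
  move into the new slot \<open>p'\<close> is played as a move into the old slot \<open>p\<close>.
  This mediates between a graph with one root and a gluing whose slots belong to different
  parts.\<close>

lemma game_subst:
  assumes "game n p G s H t" "\<And>i. i < p' \<Longrightarrow> c i \<or> f i < p"
  shows "game n p' G (\<lambda>i. if c i then {} else s (f i)) H (\<lambda>i. if c i then {} else t (f i))"
  using assms
proof (induction n arbitrary: p p' s t c f)
  case 0
  let ?u = "\<lambda>u i. if c i then {} else u (f i)"
  have m: "meets K (?u u) i j \<longleftrightarrow> \<not> c i \<and> \<not> c j \<and> meets K u (f i) (f j)"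
    and si: "single K (?u u) i \<longleftrightarrow> \<not> c i \<and> single K u (f i)"
    and l: "linked K (?u u) i j \<longleftrightarrow> \<not> c i \<and> \<not> c j \<and> linked K u (f i) (f j)"
    for K :: "'c pair_pre_digraph" and u i j
    by (auto simp: meets_def single_def linked_def is_singleton_def)
  have "\<not> c i \<Longrightarrow> f i < p" if "i < p'" for i using 0(2)[OF that] by auto
  with 0(1) show ?case unfolding game.simps atoms_eq_iff m si l by blast
next
  case (Suc n)
  define c' where "c' = c(p' := False)"
  define f' where "f' = f(p' := p)"
  have step: "game n (Suc p') G ((\<lambda>i. if c i then {} else s (f i))(p' := S))
      H ((\<lambda>i. if c i then {} else t (f i))(p' := T))"
    if "game n (Suc p) G (s(p := S)) H (t(p := T))" for S T
  proof -
    have *: "c' i \<or> f' i < Suc p" if "i < Suc p'" for i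
      using Suc.prems(2)[of i] that by (auto simp: c'_def f'_def less_Suc_eq)
    have c: "game n (Suc p') G (\<lambda>i. if c' i then {} else (s(p := S)) (f' i))
       H (\<lambda>i. if c' i then {} else (t(p := T)) (f' i))"
      using Suc.IH[OF that *] .
    have a: "game n (Suc p') G ((\<lambda>i. if c i then {} else s (f i))(p' := S))
        G (\<lambda>i. if c' i then {} else (s(p := S)) (f' i))"
      by (rule game_restrict) (use Suc.prems(2) in \<open>auto simp: c'_def f'_def less_Suc_eq\<close>)
    have b: "game n (Suc p') H (\<lambda>i. if c' i then {} else (t(p := T)) (f' i))
        H ((\<lambda>i. if c i then {} else t (f i))(p' := T))"
      by (rule game_restrict) (use Suc.prems(2) in \<open>auto simp: c'_def f'_def less_Suc_eq\<close>)
    show ?thesis by (rule game_trans[OF game_trans[OF a c] b])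
  qed
  show ?case using Suc.prems(1) step unfolding game.simps by meson
qed

section \<open>Isomorphic images and gluing\<close>

definition image_graph :: "('a \<Rightarrow> 'b) \<Rightarrow> 'a pair_pre_digraph \<Rightarrow> 'b pair_pre_digraph" where
  "image_graph f G = \<lparr>pverts = f ` pverts G, parcs = map_prod f f ` parcs G\<rparr>"

definition wf_graph :: "'a pair_pre_digraph \<Rightarrow> bool" where
  "wf_graph G \<longleftrightarrow> parcs G \<subseteq> pverts G \<times> pverts G"

lemma image_graph_sel [simp]:
  "pverts (image_graph f G) = f ` pverts G" "parcs (image_graph f G) = map_prod f f ` parcs G"
  by (auto simp: image_graph_def)

lemma image_graph_arc_iff:
  assumes "inj_on f (pverts G)" "wf_graph G" "u \<in> pverts G" "v \<in> pverts G"
  shows "(f u, f v) \<in> parcs (image_graph f G) \<longleftrightarrow> (u, v) \<in> parcs G"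
proof
  assume "(f u, f v) \<in> parcs (image_graph f G)"
  then obtain x y where xy: "(x, y) \<in> parcs G" "f u = f x" "f v = f y" by auto
  have "u = x" by (rule inj_onD[OF assms(1) xy(2) assms(3)]) (use assms(2) xy(1) in \<open>auto simp: wf_graph_def\<close>)
  moreover have "v = y" by (rule inj_onD[OF assms(1) xy(3) assms(4)]) (use assms(2) xy(1) in \<open>auto simp: wf_graph_def\<close>)
  ultimately show "(u, v) \<in> parcs G" using xy by simp
qed auto

lemma game_image:
  assumes "inj_on f (pverts G)" "wf_graph G"
    and "\<And>i. i < p \<Longrightarrow> t i \<inter> f ` pverts G = f ` (s i \<inter> pverts G)"
  shows "game n p G s (image_graph f G) t"
  using assms(3)
proof (induction n arbitrary: p s t)
  case 0
  have m: "t i \<inter> t j \<inter> f ` pverts G = f ` (s i \<inter> s j \<inter> pverts G)" if "i < p" "j < p" for i j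
  proof -
    have "t i \<inter> t j \<inter> f ` pverts G = f ` (s i \<inter> pverts G) \<inter> f ` (s j \<inter> pverts G)"
      using 0[OF that(1)] 0[OF that(2)] by blast
    also have "\<dots> = f ` (s i \<inter> pverts G \<inter> (s j \<inter> pverts G))"
      by (rule inj_on_image_Int[OF assms(1), symmetric]) auto
    finally show ?thesis by (simp add: Int_ac)
  qed
  have si: "is_singleton (f ` (s i \<inter> pverts G)) \<longleftrightarrow> is_singleton (s i \<inter> pverts G)" for i
    using assms(1) by (auto simp: is_singleton_altdef card_image inj_on_subset)
  show ?case
    using 0 m si image_graph_arc_iff[OF assms(1,2)]
    by (simp add: atoms_eq_iff meets_def single_def linked_def)
next
  case (Suc n)
  have 1: "game n (Suc p) G (s(p := S)) (image_graph f G) (t(p := f ` (S \<inter> pverts G)))" for S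
    using Suc.prems by (intro Suc.IH) (auto simp: less_Suc_eq)
  have 2: "game n (Suc p) G (s(p := f -` T)) (image_graph f G) (t(p := T))" for T
    using Suc.prems by (intro Suc.IH) (auto simp: less_Suc_eq)
  show ?case using 1 2 by auto
qed

text \<open>One operation covers a disjoint union (\<open>Q = {}\<close>), a bridge (two singleton
  slots) and a star of bridges (a root and a set of roots). The new edges are prescribed by
  parameters of the game, so the game can keep track of them.\<close>

definition glue :: "(nat \<times> nat) set \<Rightarrow> (nat \<Rightarrow> 'a set) \<Rightarrow> 'a pair_pre_digraph
    \<Rightarrow> 'a pair_pre_digraph \<Rightarrow> 'a pair_pre_digraph" where
  "glue Q s A B = \<lparr>pverts = pverts A \<union> pverts B,
     parcs = parcs A \<union> parcs B \<union>
       (\<Union>(i, j)\<in>Q. (s i \<inter> pverts A) \<times> (s j \<inter> pverts B) \<union> (s j \<inter> pverts B) \<times> (s i \<inter> pverts A))\<rparr>"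

lemma glue_sel [simp]:
  "pverts (glue Q s A B) = pverts A \<union> pverts B"
  "parcs (glue Q s A B) = parcs A \<union> parcs B \<union>
     (\<Union>(i, j)\<in>Q. (s i \<inter> pverts A) \<times> (s j \<inter> pverts B) \<union> (s j \<inter> pverts B) \<times> (s i \<inter> pverts A))"
  by (auto simp: glue_def)

context
  fixes A B :: "'a pair_pre_digraph"
  assumes wf: "wf_graph A" "wf_graph B" and disj: "pverts A \<inter> pverts B = {}"
begin

lemma meets_glue: "meets (glue Q s A B) t i j \<longleftrightarrow> meets A t i j \<or> meets B t i j"
  by (auto simp: meets_def)

lemma single_glue:
  "single (glue Q s A B) t i \<longleftrightarrow>
     single A t i \<and> \<not> meets B t i i \<or> single B t i \<and> \<not> meets A t i i"
proof -
  have "t i \<inter> (pverts A \<union> pverts B) = (t i \<inter> pverts A) \<union> (t i \<inter> pverts B)" by blast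
  moreover have "(t i \<inter> pverts A) \<inter> (t i \<inter> pverts B) = {}" using disj by blast
  moreover have "is_singleton (X \<union> Y) \<longleftrightarrow> is_singleton X \<and> Y = {} \<or> is_singleton Y \<and> X = {}"
    if "X \<inter> Y = {}" for X Y :: "'a set"
    using that by (auto simp: is_singleton_def Un_singleton_iff)
  ultimately show ?thesis by (simp add: single_def meets_def)
qed

text \<open>A crossing edge comes from a pair \<open>(q, r)\<close> in \<open>Q\<close>, and such an
  edge joins slots \<open>i\<close> and \<open>j\<close> exactly when \<open>i\<close> meets
  \<open>q\<close> on one side and \<open>j\<close> meets \<open>r\<close> on the other, or the
  reverse. So the atoms of the two parts determine those of the gluing.\<close>

lemma linked_glue:
  "linked (glue Q s A B) s i j \<longleftrightarrow> linked A s i j \<or> linked B s i j \<or>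
     (\<exists>(q, r)\<in>Q. meets A s i q \<and> meets B s r j \<or> meets B s i r \<and> meets A s q j)"
  (is "?L \<longleftrightarrow> ?R")
proof
  assume ?L
  then obtain u v where uv: "u \<in> s i" "v \<in> s j" "(u, v) \<in> parcs (glue Q s A B)"
    by (auto simp: linked_def)
  then consider "(u, v) \<in> parcs A" | "(u, v) \<in> parcs B"
    | q r where "(q, r) \<in> Q" "u \<in> s q \<inter> pverts A" "v \<in> s r \<inter> pverts B"
    | q r where "(q, r) \<in> Q" "u \<in> s r \<inter> pverts B" "v \<in> s q \<inter> pverts A"
    by auto
  then show ?R
  proof cases
    case 1 then show ?thesis using uv wf by (auto simp: linked_def wf_graph_def)
  next
    case 2 then show ?thesis using uv wf by (auto simp: linked_def wf_graph_def)
  next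
    case 3 then show ?thesis using uv by (auto simp: meets_def)
  next
    case 4 then show ?thesis using uv by (auto simp: meets_def)
  qed
next
  assume ?R
  then consider "linked A s i j" | "linked B s i j"
    | q r where "(q, r) \<in> Q" "meets A s i q" "meets B s r j"
    | q r where "(q, r) \<in> Q" "meets B s i r" "meets A s q j"
    by auto
  then show ?L
  proof cases
    case 1 then show ?thesis by (auto simp: linked_def)
  next
    case 2 then show ?thesis by (auto simp: linked_def)
  next
    case 3 then show ?thesis unfolding meets_def linked_def glue_sel by blast
  next
    case 4 then show ?thesis unfolding meets_def linked_def glue_sel by blast
  qed
qed

end

text \<open>Composition in the style of Feferman and Vaught: a move is answered in the two parts
  separately, and disjointness allows the two answers to be merged into one set.\<close>

lemma game_glue:
  assumes A: "game n p A s A' t" and B: "game n p B s B' t"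
    and wf: "wf_graph A" "wf_graph B" "wf_graph A'" "wf_graph B'"
    and disj: "pverts A \<inter> pverts B = {}" "pverts A' \<inter> pverts B' = {}"
    and Q: "Q \<subseteq> {..<p} \<times> {..<p}"
  shows "game n p (glue Q s A B) s (glue Q t A' B') t"
  using A B Q
proof (induction n arbitrary: p s t)
  case 0
  have a: "single A s i = single A' t i" "single B s i = single B' t i" if "i < p" for i
    using 0(1,2) that by (auto simp: atoms_eq_iff)
  have b: "meets A s i j = meets A' t i j" "meets B s i j = meets B' t i j"
    "linked A s i j = linked A' t i j" "linked B s i j = linked B' t i j" if "i < p" "j < p" for i j
    using 0(1,2) that by (auto simp: atoms_eq_iff)
  have c: "(\<exists>(q, r)\<in>Q. meets A s i q \<and> meets B s r j \<or> meets B s i r \<and> meets A s q j) \<longleftrightarrow>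
     (\<exists>(q, r)\<in>Q. meets A' t i q \<and> meets B' t r j \<or> meets B' t i r \<and> meets A' t q j)"
    if "i < p" "j < p" for i j
    using 0(3) b that by (intro bex_cong) auto
  show ?case
    using a b c
    by (simp add: atoms_eq_iff meets_glue linked_glue single_glue wf disj)
next
  case (Suc n)
  \<comment> \<open>Moves fill slot \<open>p\<close>, which \<open>Q\<close> does not mention, so
    the added edges stay the same throughout the game.\<close>
  have g: "glue Q (u(p := X)) C D = glue Q u C D" for u :: "nat \<Rightarrow> 'c set" and X C D
  proof -
    have "(u(p := X)) i = u i \<and> (u(p := X)) j = u j" if "(i, j) \<in> Q" for i j
      using that Suc.prems(3) by auto
    then show ?thesis by (auto simp: glue_def)
  qed
  have Q': "Q \<subseteq> {..<Suc p} \<times> {..<Suc p}" using Suc.prems(3) by fastforce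
  show ?case
    unfolding game.simps
  proof (intro conjI allI)
    fix S
    obtain T1 where T1: "game n (Suc p) A (s(p := S)) A' (t(p := T1))" using Suc.prems(1) by auto
    obtain T2 where T2: "game n (Suc p) B (s(p := S)) B' (t(p := T2))" using Suc.prems(2) by auto
    define T where "T = (T1 \<inter> pverts A') \<union> (T2 \<inter> pverts B')"
    have "game n (Suc p) A (s(p := S)) A' (t(p := T))"
      by (rule game_trans[OF T1]) (rule game_restrict, use disj in \<open>auto simp: T_def\<close>)
    moreover have "game n (Suc p) B (s(p := S)) B' (t(p := T))"
      by (rule game_trans[OF T2]) (rule game_restrict, use disj in \<open>auto simp: T_def\<close>)
    ultimately have "game n (Suc p) (glue Q (s(p := S)) A B) (s(p := S)) (glue Q (t(p := T)) A' B') (t(p := T))"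
      using Q' by (rule Suc.IH)
    then show "\<exists>T. game n (Suc p) (glue Q s A B) (s(p := S)) (glue Q t A' B') (t(p := T))"
      by (auto simp: g)
  next
    fix T
    obtain S1 where S1: "game n (Suc p) A (s(p := S1)) A' (t(p := T))" using Suc.prems(1) by auto
    obtain S2 where S2: "game n (Suc p) B (s(p := S2)) B' (t(p := T))" using Suc.prems(2) by auto
    define S where "S = (S1 \<inter> pverts A) \<union> (S2 \<inter> pverts B)"
    have "game n (Suc p) A (s(p := S)) A' (t(p := T))"
      by (rule game_trans[OF _ S1]) (rule game_restrict, use disj in \<open>auto simp: S_def\<close>)
    moreover have "game n (Suc p) B (s(p := S)) B' (t(p := T))"
      by (rule game_trans[OF _ S2]) (rule game_restrict, use disj in \<open>auto simp: S_def\<close>)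
    ultimately have "game n (Suc p) (glue Q (s(p := S)) A B) (s(p := S)) (glue Q (t(p := T)) A' B') (t(p := T))"
      using Q' by (rule Suc.IH)
    then show "\<exists>S. game n (Suc p) (glue Q s A B) (s(p := S)) (glue Q t A' B') (t(p := T))"
      by (auto simp: g)
  qed
qed

section \<open>Finitely many types, and a threshold for counting them\<close>

text \<open>The type of rank \<open>Suc n\<close> is the set of types of rank \<open>n\<close> that
  one move can reach. There are finitely many such sets, and they are numbered afresh at each
  rank.\<close>

lemma finitely_many_game_types:
  "\<exists>(c :: 'a pair_pre_digraph \<Rightarrow> (nat \<Rightarrow> 'a set) \<Rightarrow> nat) N.
     (\<forall>G s. c G s < N) \<and> (\<forall>G s H t. game n p G s H t \<longleftrightarrow> c G s = c H t)"
proof (induction n arbitrary: p)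
  case 0
  define D where "D = Pow ({..<p} \<times> {..<p}) \<times> Pow {..<p} \<times> Pow ({..<p} \<times> {..<p})"
  have "finite D" by (simp add: D_def)
  then obtain g :: "_ \<Rightarrow> nat" and N where g: "g ` D = {i. i < N}" "inj_on g D"
    using finite_imp_inj_to_nat_seg by metis
  have a: "atoms p G s \<in> D" for G and s :: "nat \<Rightarrow> 'a set"
    by (auto simp: atoms_def D_def)
  have "g (atoms p G s) < N" for G and s :: "nat \<Rightarrow> 'a set" using a[of G s] g(1) by blast
  moreover have "game 0 p G s H t \<longleftrightarrow> g (atoms p G s) = g (atoms p H t)" for G H and s t :: "nat \<Rightarrow> 'a set"
    using inj_on_eq_iff[OF g(2) a a] by simp
  ultimately show ?case
    by (intro exI[of _ "\<lambda>G s. g (atoms p G s)"] exI[of _ N] conjI allI)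
next
  case (Suc n)
  obtain c :: "'a pair_pre_digraph \<Rightarrow> (nat \<Rightarrow> 'a set) \<Rightarrow> nat" and N where
    c: "\<And>G s. c G s < N" "\<And>G s H t. game n (Suc p) G s H t \<longleftrightarrow> c G s = c H t"
    using Suc[of "Suc p"] by blast
  obtain g :: "nat set \<Rightarrow> nat" and M where g: "g ` Pow {..<N} = {i. i < M}" "inj_on g (Pow {..<N})"
    using finite_imp_inj_to_nat_seg[of "Pow {..<N}"] by auto
  define d where "d G s = (\<lambda>S. c G (s(p := S))) ` UNIV" for G s
  have d: "d G s \<in> Pow {..<N}" for G s using c(1) by (auto simp: d_def)
  have *: "game (Suc n) p G s H t \<longleftrightarrow> d G s = d H t" for G s H t
  proof
    assume "game (Suc n) p G s H t"
    then show "d G s = d H t" unfolding d_def game.simps c(2) by (auto simp: image_iff) metis+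
  next
    assume "d G s = d H t"
    then have "\<exists>T. c G (s(p := S)) = c H (t(p := T))" "\<exists>T. c G (s(p := T)) = c H (t(p := S))" for S
      unfolding d_def by (metis (no_types, lifting) UNIV_I imageE imageI)+
    then show "game (Suc n) p G s H t" unfolding game.simps c(2) by blast
  qed
  have "g (d G s) < M" for G s using d[of G s] g(1) by blast
  moreover have "game (Suc n) p G s H t \<longleftrightarrow> g (d G s) = g (d H t)" for G s H t
    unfolding * inj_on_eq_iff[OF g(2) d d] ..
  ultimately show ?case
    by (intro exI[of _ "\<lambda>G s. g (d G s)"] exI[of _ M] conjI allI)
qed

definition union_graph :: "('i \<Rightarrow> 'a pair_pre_digraph) \<Rightarrow> 'i set \<Rightarrow> 'a pair_pre_digraph" where
  "union_graph G I = \<lparr>pverts = (\<Union>i\<in>I. pverts (G i)), parcs = (\<Union>i\<in>I. parcs (G i))\<rparr>"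

lemma union_graph_sel [simp]:
  "pverts (union_graph G I) = (\<Union>i\<in>I. pverts (G i))"
  "parcs (union_graph G I) = (\<Union>i\<in>I. parcs (G i))"
  by (auto simp: union_graph_def)

lemma wf_union_graph: "(\<And>i. i \<in> I \<Longrightarrow> wf_graph (G i)) \<Longrightarrow> wf_graph (union_graph G I)"
  by (fastforce simp: wf_graph_def)

lemma union_graph_insert: "union_graph G (insert a I) = glue {} s (G a) (union_graph G I)"
  by (auto simp: union_graph_def glue_def)

lemma disjoint_union_graph:
  assumes "disjoint_family_on (\<lambda>i. pverts (G i)) (insert a I)" "a \<notin> I"
  shows "pverts (G a) \<inter> pverts (union_graph G I) = {}"
proof -
  have "pverts (G a) \<inter> pverts (G i) = {}" if "i \<in> I" for i
    by (rule disjoint_family_onD[OF assms(1)]) (use that assms(2) in auto)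
  then show ?thesis by auto
qed

lemma pigeonhole_class:
  assumes "finite J" "\<And>i. i \<in> J \<Longrightarrow> c i < (N :: nat)" "N * R < card J"
  obtains b where "b \<in> J" "R < card {i \<in> J. c i = c b}"
proof -
  have "\<exists>k. R < card {i \<in> J. c i = k} \<and> k < N"
  proof (rule ccontr)
    assume *: "\<not> ?thesis"
    have "J = (\<Union>k<N. {i \<in> J. c i = k})" using assms(2) by auto
    then have "card J \<le> (\<Sum>k<N. card {i \<in> J. c i = k})" by (metis card_UN_le finite_lessThan)
    also have "\<dots> \<le> (\<Sum>k<N. R)" using * by (intro sum_mono) (auto simp: not_less)
    finally show False using assms(3) by simp
  qed
  then obtain k where k: "R < card {i \<in> J. c i = k}" by blast
  then have "{i \<in> J. c i = k} \<noteq> {}" by (metis card.empty not_less0)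
  then obtain b where "b \<in> {i \<in> J. c i = k}" by blast
  with k that show thesis by auto
qed

text \<open>A further piece goes unnoticed if its type already occurs often enough. A move may split
  the pieces of one type into several types, but there are boundedly many, so one of them is still
  frequent; the threshold grows by this factor in each round.\<close>

lemma game_union_threshold:
  "\<exists>R. \<forall>(G :: 'i \<Rightarrow> 'a pair_pre_digraph) I a s.
     finite I \<longrightarrow> a \<notin> I \<longrightarrow> (\<forall>i\<in>insert a I. wf_graph (G i)) \<longrightarrow>
     disjoint_family_on (\<lambda>i. pverts (G i)) (insert a I) \<longrightarrow>
     R \<le> card {i \<in> I. game n p (G i) s (G a) s} \<longrightarrow>
     game n p (union_graph G (insert a I)) s (union_graph G I) s"
proof (induction n arbitrary: p)
  case 0
  show ?case
  \<comment> \<open>One piece of the type of \<open>a\<close> reproduces whatever \<open>a\<close>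
    meets or links. Two pieces are needed for singletons: a set that meets \<open>a\<close> then
    already has two elements in the rest, so \<open>a\<close> cannot change whether it is a
    singleton.\<close>
  proof (intro exI[of _ 2] allI impI)
    fix G :: "'i \<Rightarrow> 'a pair_pre_digraph" and I a s
    assume I: "finite I" "a \<notin> I" "\<forall>i\<in>insert a I. wf_graph (G i)"
      "disjoint_family_on (\<lambda>i. pverts (G i)) (insert a I)"
      and R: "2 \<le> card {i \<in> I. game 0 p (G i) s (G a) s}"
    obtain b b' where b: "b \<in> I" "b' \<in> I" "b \<noteq> b'"
      "atoms p (G b) s = atoms p (G a) s" "atoms p (G b') s = atoms p (G a) s"
    proof -
      obtain B where B: "B \<subseteq> {i \<in> I. game 0 p (G i) s (G a) s}" "card B = 2"
        using R by (rule obtain_subset_with_card_n)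
      then obtain b b' where "B = {b, b'}" "b \<noteq> b'" by (auto simp: card_2_iff)
      with B(1) show thesis by (intro that[of b b']) auto
    qed
    have disj: "pverts (G i) \<inter> pverts (G j) = {}" if "i \<in> insert a I" "j \<in> insert a I" "i \<noteq> j" for i j
      by (rule disjoint_family_onD[OF I(4) that])
    let ?U = "union_graph G I"
    have wfU: "wf_graph ?U" and wfa: "wf_graph (G a)" using I(3) by (auto intro: wf_union_graph)
    have dU: "pverts (G a) \<inter> pverts ?U = {}" by (rule disjoint_union_graph[OF I(4,2)])
    have m: "meets ?U s i j" if "meets (G a) s i j" "i < p" "j < p" for i j
    proof -
      have "meets (G b) s i j" using b(4) that by (auto simp: atoms_eq_iff)
      then show ?thesis using b(1) by (auto simp: meets_def)
    qed
    have l: "linked ?U s i j" if "linked (G a) s i j" "i < p" "j < p" for i j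
    proof -
      have "linked (G b) s i j" using b(4) that by (auto simp: atoms_eq_iff)
      then show ?thesis using b(1) unfolding linked_def union_graph_sel by blast
    qed
    have si: "\<not> single ?U s i" if "meets (G a) s i i" "i < p" for i
    proof
      assume "single ?U s i"
      then obtain x where x: "s i \<inter> pverts ?U = {x}" by (auto simp: single_def is_singleton_def)
      have "meets (G b) s i i" "meets (G b') s i i" using b(4,5) that by (auto simp: atoms_eq_iff)
      then obtain y y' where y: "y \<in> s i" "y \<in> pverts (G b)" "y' \<in> s i" "y' \<in> pverts (G b')"
        by (auto simp: meets_def)
      then have "y \<in> s i \<inter> pverts ?U" "y' \<in> s i \<inter> pverts ?U" using b(1,2) by auto
      then have "y = y'" unfolding x by simp
      moreover have "pverts (G b) \<inter> pverts (G b') = {}" using disj b(1-3) by simp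
      ultimately show False using y by blast
    qed
    have si': "\<not> single (G a) s i \<or> meets ?U s i i" if "i < p" for i
    proof -
      have "meets (G a) s i i" if "single (G a) s i"
        using that by (auto simp: single_def meets_def is_singleton_def)
      then show ?thesis using m that by blast
    qed
    show "game 0 p (union_graph G (insert a I)) s ?U s"
      unfolding union_graph_insert[of G a I s] game.simps atoms_eq_iff
        meets_glue[OF wfa wfU dU] single_glue[OF wfa wfU dU] linked_glue[OF wfa wfU dU]
      using m l si si' by blast
  qed
next
  case (Suc n)
  obtain R where R0: "\<forall>(G :: 'i \<Rightarrow> 'a pair_pre_digraph) I a s.
     finite I \<longrightarrow> a \<notin> I \<longrightarrow> (\<forall>i\<in>insert a I. wf_graph (G i)) \<longrightarrow>
     disjoint_family_on (\<lambda>i. pverts (G i)) (insert a I) \<longrightarrow>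
     R \<le> card {i \<in> I. game n (Suc p) (G i) s (G a) s} \<longrightarrow>
     game n (Suc p) (union_graph G (insert a I)) s (union_graph G I) s"
    using Suc[of "Suc p"] ..
  note R = R0[rule_format]
  obtain c :: "'a pair_pre_digraph \<Rightarrow> (nat \<Rightarrow> 'a set) \<Rightarrow> nat" and N where
    c: "\<And>G s. c G s < N" "\<And>G s H t. game n (Suc p) G s H t \<longleftrightarrow> c G s = c H t"
    using finitely_many_game_types[of n "Suc p"] by metis
  show ?case
  \<comment> \<open>With \<open>N\<close> types available, more than \<open>N * R\<close> pieces
    force some type to occur more than \<open>R\<close> times after the move, that is, at least
    \<open>R\<close> times besides a chosen \<open>b\<close>.\<close>
  proof (intro exI[of _ "Suc (N * R)"] allI impI)
    fix G :: "'i \<Rightarrow> 'a pair_pre_digraph" and I a s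
    assume I: "finite I" "a \<notin> I" "\<forall>i\<in>insert a I. wf_graph (G i)"
      "disjoint_family_on (\<lambda>i. pverts (G i)) (insert a I)"
    define J where "J = {i \<in> I. game (Suc n) p (G i) s (G a) s}"
    assume "Suc (N * R) \<le> card {i \<in> I. game (Suc n) p (G i) s (G a) s}"
    then have J: "N * R < card J" unfolding J_def by linarith
    have fJ: "finite J" using I(1) by (simp add: J_def)
    have disj: "pverts (G i) \<inter> pverts (G j) = {}" if "i \<in> insert a I" "j \<in> insert a I" "i \<noteq> j" for i j
      by (rule disjoint_family_onD[OF I(4) that])
    have popular: "\<exists>b\<in>J. R < card {i \<in> J. game n (Suc p) (G i) s' (G b) s'}" for s'
      by (rule pigeonhole_class[of J "\<lambda>i. c (G i) s'" N R, OF fJ c(1) J]) (auto simp: c(2))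
    show "game (Suc n) p (union_graph G (insert a I)) s (union_graph G I) s"
      unfolding game.simps
    proof (intro conjI allI)
      \<comment> \<open>Move in the larger union: the frequent piece \<open>b\<close> is dropped by
        the induction hypothesis, and \<open>a\<close> with its part of \<open>S\<close> is then
        replaced by \<open>b\<close>, which had the same type before the move.\<close>
      fix S
      define s' where "s' = s(p := S)"
      obtain b where b: "b \<in> J" "R < card {i \<in> J. game n (Suc p) (G i) s' (G b) s'}"
        using popular by blast
      have bI: "b \<in> I" "b \<noteq> a" using b I(2) by (auto simp: J_def)
      define I' where "I' = I - {b}"
      have I': "insert a I = insert b (insert a I')" "I = insert b I'" "b \<notin> insert a I'" "a \<notin> I'" "b \<notin> I'"
        using bI I(2) by (auto simp: I'_def)
      have "R \<le> card ({i \<in> J. game n (Suc p) (G i) s' (G b) s'} - {b})"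
        using b fJ by (simp add: card_Diff_singleton game_refl)
      also have "\<dots> \<le> card {i \<in> insert a I'. game n (Suc p) (G i) s' (G b) s'}"
        by (rule card_mono) (use I(1) in \<open>auto simp: I'_def J_def\<close>)
      finally have 1: "game n (Suc p) (union_graph G (insert a I)) s' (union_graph G (insert a I')) s'"
        unfolding I'(1) by (rule R[rotated -1]) (use I I'(1,3) in \<open>auto simp: I'_def\<close>)
      have "game (Suc n) p (G a) s (G b) s"
        by (rule game_sym) (use b(1) in \<open>simp add: J_def del: game.simps\<close>)
      then obtain T0 where T0: "game n (Suc p) (G a) s' (G b) (s(p := T0))"
        unfolding s'_def game.simps by blast
      define T where "T = (T0 \<inter> pverts (G b)) \<union> (S - pverts (G b))"
      have 2: "game n (Suc p) (G a) s' (G b) (s(p := T))"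
        by (rule game_trans[OF T0]) (rule game_restrict, auto simp: T_def)
      have db: "pverts (G b) \<inter> pverts (union_graph G I') = {}"
        by (rule disjoint_union_graph, rule disjoint_family_on_mono[OF _ I(4)])
          (use bI in \<open>auto simp: I'_def\<close>)
      have da: "pverts (G a) \<inter> pverts (union_graph G I') = {}"
        by (rule disjoint_union_graph, rule disjoint_family_on_mono[OF _ I(4)])
          (use I(2) in \<open>auto simp: I'_def\<close>)
      have 3: "game n (Suc p) (union_graph G I') s' (union_graph G I') (s(p := T))"
        unfolding s'_def by (rule game_restrict) (use db in \<open>auto simp: T_def\<close>)
      have wf: "wf_graph (union_graph G I')" "wf_graph (G a)" "wf_graph (G b)"
        using I(3) bI by (auto intro: wf_union_graph simp: I'_def)
      have "game n (Suc p) (union_graph G (insert a I')) s' (union_graph G I) (s(p := T))"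
        unfolding I'(2) union_graph_insert[of G a I' s'] union_graph_insert[of G b I' "s(p := T)"]
        by (rule game_glue[OF 2 3]) (use wf da db in auto)
      with 1 show "\<exists>T. game n (Suc p) (union_graph G (insert a I)) (s(p := S)) (union_graph G I) (s(p := T))"
        unfolding s'_def using game_trans by blast
    next
      \<comment> \<open>Move in the smaller union: \<open>a\<close> imitates the frequent piece
        \<open>b\<close>, so its type after the move is frequent and the induction hypothesis
        removes \<open>a\<close>.\<close>
      fix S
      define s' where "s' = s(p := S)"
      obtain b where b: "b \<in> J" "R < card {i \<in> J. game n (Suc p) (G i) s' (G b) s'}"
        using popular by blast
      have "game (Suc n) p (G a) s (G b) s"
        by (rule game_sym) (use b(1) in \<open>simp add: J_def del: game.simps\<close>)
      then obtain T0 where T0: "game n (Suc p) (G a) (s(p := T0)) (G b) s'"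
        unfolding s'_def game.simps by blast
      define T where "T = (T0 \<inter> pverts (G a)) \<union> (S - pverts (G a))"
      have 2: "game n (Suc p) (G a) (s(p := T)) (G b) s'"
        by (rule game_trans[OF _ T0]) (rule game_restrict, auto simp: T_def)
      have 3: "game n (Suc p) (G i) (s(p := T)) (G i) s'" if "i \<in> I" for i
        unfolding s'_def using disj[of a i] that I(2) by (intro game_restrict) (auto simp: T_def)
      have "{i \<in> J. game n (Suc p) (G i) s' (G b) s'} \<subseteq>
         {i \<in> I. game n (Suc p) (G i) (s(p := T)) (G a) (s(p := T))}"
      proof clarify
        fix i assume "i \<in> J" and i: "game n (Suc p) (G i) s' (G b) s'"
        then have "i \<in> I" by (simp add: J_def)
        then show "i \<in> I \<and> game n (Suc p) (G i) (s(p := T)) (G a) (s(p := T))"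
          using game_trans[OF game_trans[OF 3 i] game_sym[OF 2]] by blast
      qed
      from card_mono[OF _ this] b I(1)
      have "R \<le> card {i \<in> I. game n (Suc p) (G i) (s(p := T)) (G a) (s(p := T))}" by simp
      then have "game n (Suc p) (union_graph G (insert a I)) (s(p := T)) (union_graph G I) (s(p := T))"
        using I by (intro R) auto
      moreover have "game n (Suc p) (union_graph G I) (s(p := T)) (union_graph G I) s'"
        unfolding s'_def using disjoint_union_graph[OF I(4,2)]
        by (intro game_restrict) (auto simp: T_def)
      ultimately show "\<exists>T. game n (Suc p) (union_graph G (insert a I)) (s(p := T)) (union_graph G I) (s(p := S))"
        unfolding s'_def using game_trans by blast
    qed
  qed
qed

section \<open>From games to monadic second-order formulas\<close>

text \<open>The maps \<open>a\<close> and \<open>b\<close> record the slot that holds the value of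
  each variable, a vertex being stored as a singleton. A quantifier of either kind costs one move,
  into the fresh slot \<open>p\<close>.\<close>

lemma mso_sat_game:
  assumes "game n p G s H t" "quantifier_rank \<phi> \<le> n"
    and "\<And>x. x \<in> free_vars \<phi> \<Longrightarrow> a x < p \<and> s (a x) \<inter> pverts G = {e x} \<and> t (a x) \<inter> pverts H = {e' x}"
    and "\<And>X. X \<in> free_set_vars \<phi> \<Longrightarrow> b X < p \<and> r X \<inter> pverts G = s (b X) \<inter> pverts G \<and>
           r' X \<inter> pverts H = t (b X) \<inter> pverts H"
  shows "mso_sat G e r \<phi> \<longleftrightarrow> mso_sat H e' r' \<phi>"
  using assms
proof (induction \<phi> arbitrary: n p s t a b e e' r r')
  case (Mem x X)
  have 1: "a x < p" "s (a x) \<inter> pverts G = {e x}" "t (a x) \<inter> pverts H = {e' x}"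
    using Mem.prems(3) by auto
  have 2: "b X < p" "r X \<inter> pverts G = s (b X) \<inter> pverts G" "r' X \<inter> pverts H = t (b X) \<inter> pverts H"
    using Mem.prems(4) by auto
  have "meets G s (a x) (b X) = meets H t (a x) (b X)"
    using game_atoms[OF Mem.prems(1)] 1 2 by (auto simp: atoms_eq_iff)
  moreover have "s (a x) \<inter> s (b X) \<inter> pverts G = {e x} \<inter> r X"
    using 1(2) 2(2) by (auto simp: set_eq_iff)
  moreover have "t (a x) \<inter> t (b X) \<inter> pverts H = {e' x} \<inter> r' X"
    using 1(3) 2(3) by (auto simp: set_eq_iff)
  ultimately show ?case by (simp add: meets_def)
next
  case (Edge x y)
  have 1: "a x < p" "s (a x) \<inter> pverts G = {e x}" "t (a x) \<inter> pverts H = {e' x}"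
    "a y < p" "s (a y) \<inter> pverts G = {e y}" "t (a y) \<inter> pverts H = {e' y}"
    using Edge.prems(3) by auto
  have "linked G s (a x) (a y) = linked H t (a x) (a y)"
    using game_atoms[OF Edge.prems(1)] 1 by (auto simp: atoms_eq_iff)
  then show ?case using 1 by (auto simp: linked_def)
next
  case (Neg \<phi>)
  show ?case using Neg.IH[of n p s t a e e' b r r'] Neg.prems by simp
next
  case (Conj \<phi> \<psi>)
  show ?case
    using Conj.IH(1)[of n p s t a e e' b r r'] Conj.IH(2)[of n p s t a e e' b r r'] Conj.prems by simp
next
  case (ExV x \<phi>)
  then obtain k where k: "n = Suc k" "quantifier_rank \<phi> \<le> k" by (cases n) auto
  have step: "mso_sat G (e(x := u)) r \<phi> \<longleftrightarrow> mso_sat H (e'(x := v)) r' \<phi>"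
    if "game k (Suc p) G (s(p := S)) H (t(p := T))" "S \<inter> pverts G = {u}" "T \<inter> pverts H = {v}" for S T u v
    by (rule ExV.IH[of k "Suc p" "s(p := S)" "t(p := T)" "a(x := p)" _ _ b])
      (use that k ExV.prems in \<open>force+\<close>)
  \<comment> \<open>Because singletons are atomic, the answer to a singleton is a singleton and thus
    a legitimate value for a vertex variable.\<close>
  have s: "is_singleton (S \<inter> pverts G) = is_singleton (T \<inter> pverts H)"
    if "game k (Suc p) G (s(p := S)) H (t(p := T))" for S T
    using game_atoms[OF that] by (auto simp: atoms_eq_iff single_def dest!: spec[of _ p])
  have "\<exists>v\<in>pverts H. mso_sat H (e'(x := v)) r' \<phi>" if u: "u \<in> pverts G" "mso_sat G (e(x := u)) r \<phi>" for u
  proof -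
    obtain T where T: "game k (Suc p) G (s(p := {u})) H (t(p := T))" using ExV.prems(1) k by auto
    then obtain v where "T \<inter> pverts H = {v}" using s[OF T] u by (auto simp: is_singleton_def)
    then show ?thesis using step[OF T, of u v] u by auto
  qed
  moreover have "\<exists>u\<in>pverts G. mso_sat G (e(x := u)) r \<phi>" if u: "u \<in> pverts H" "mso_sat H (e'(x := u)) r' \<phi>" for u
  proof -
    obtain S where S: "game k (Suc p) G (s(p := S)) H (t(p := {u}))" using ExV.prems(1) k by auto
    then obtain v where "S \<inter> pverts G = {v}" using s[OF S] u by (auto simp: is_singleton_def)
    then show ?thesis using step[OF S, of v u] u by auto
  qed
  ultimately show ?case by auto
next
  case (ExS X \<phi>)
  then obtain k where k: "n = Suc k" "quantifier_rank \<phi> \<le> k" by (cases n) auto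
  have step: "mso_sat G e (r(X := S \<inter> pverts G)) \<phi> \<longleftrightarrow> mso_sat H e' (r'(X := T \<inter> pverts H)) \<phi>"
    if "game k (Suc p) G (s(p := S)) H (t(p := T))" for S T
    by (rule ExS.IH[of k "Suc p" "s(p := S)" "t(p := T)" a _ _ "b(X := p)"])
      (use that k ExS.prems in \<open>force+\<close>)
  have "\<exists>T\<subseteq>pverts H. mso_sat H e' (r'(X := T)) \<phi>" if u: "S \<subseteq> pverts G" "mso_sat G e (r(X := S)) \<phi>" for S
  proof -
    obtain T where T: "game k (Suc p) G (s(p := S)) H (t(p := T))" using ExS.prems(1) k by auto
    then show ?thesis using step[OF T] u by (intro exI[of _ "T \<inter> pverts H"]) (auto simp: Int_absorb2)
  qed
  moreover have "\<exists>S\<subseteq>pverts G. mso_sat G e (r(X := S)) \<phi>" if u: "T \<subseteq> pverts H" "mso_sat H e' (r'(X := T)) \<phi>" for T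
  proof -
    obtain S where S: "game k (Suc p) G (s(p := S)) H (t(p := T))" using ExS.prems(1) k by auto
    then show ?thesis using step[OF S] u by (intro exI[of _ "S \<inter> pverts G"]) (auto simp: Int_absorb2)
  qed
  ultimately show ?case by auto
qed

lemma game_mso_equiv:
  assumes "game m p G s H t"
  shows "mso_equiv m G H"
  unfolding mso_equiv_def mso_models_def
proof (intro allI impI)
  fix \<phi> assume "mso_sentence \<phi> \<and> quantifier_rank \<phi> \<le> m"
  then have *: "mso_sat G e r \<phi> \<longleftrightarrow> mso_sat H e' r' \<phi>" for e r e' r'
    using mso_sat_game[OF assms, of \<phi>] by (auto simp: mso_sentence_def)
  show "(\<forall>e s. mso_sat G e s \<phi>) = (\<forall>e s. mso_sat H e s \<phi>)"
    using * by blast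
qed

section \<open>Components of graphs\<close>

abbreviation conn_graph :: "'a pair_pre_digraph \<Rightarrow> bool" where
  "conn_graph G \<equiv> Digraph_Component.connected (with_proj G)"

lemma pair_graph_iff:
  "pair_graph G \<longleftrightarrow> finite (pverts G) \<and> wf_graph G \<and> sym (parcs G) \<and> irrefl (parcs G)"
proof
  assume "pair_graph G"
  then interpret pair_graph G .
  show "finite (pverts G) \<and> wf_graph G \<and> sym (parcs G) \<and> irrefl (parcs G)"
    using pair_finite_verts arcs_symmetric no_loops'
    by (auto simp: wf_graph_def in_arcsD1 in_arcsD2 irrefl_def intro: symI)
next
  assume *: "finite (pverts G) \<and> wf_graph G \<and> sym (parcs G) \<and> irrefl (parcs G)"
  then have "finite (parcs G)"
    unfolding wf_graph_def using finite_subset by blast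
  with * show "pair_graph G"
    by unfold_locales (auto simp: wf_graph_def symmetric_def irrefl_def)
qed

lemma pair_graphD:
  assumes "pair_graph G"
  shows "finite (pverts G)" "wf_graph G" "sym (parcs G)" "irrefl (parcs G)"
  using assms by (auto simp: pair_graph_iff)

lemma rtrancl_closed:
  assumes "(v, w) \<in> E\<^sup>*" "v \<in> X" "E `` X \<subseteq> X"
  shows "w \<in> X \<and> (v, w) \<in> (E \<inter> X \<times> X)\<^sup>*"
  using assms(1)
proof induction
  case (step y z)
  then have "z \<in> X" using assms(3) by auto
  with step show ?case by (auto intro: rtrancl_into_rtrancl)
qed (use assms in auto)

lemma conn_graph_iff:
  assumes "pair_graph G"
  shows "conn_graph G \<longleftrightarrow> pverts G \<noteq> {} \<and> (\<forall>u\<in>pverts G. \<forall>v\<in>pverts G. (u, v) \<in> (parcs G)\<^sup>*)"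
proof -
  have mk: "mk_symmetric (with_proj G) = G"
    using pair_graphD(3)[OF assms]
    by (auto simp: mk_symmetric_def sym_def intro!: pair_pre_digraph.equality)
  have "u \<rightarrow>\<^sup>*\<^bsub>with_proj G\<^esub> v \<longleftrightarrow> (u, v) \<in> (parcs G)\<^sup>*" if "u \<in> pverts G" "v \<in> pverts G" for u v
    using that pair_graphD(2)[OF assms] rtrancl_consistent_rtrancl_on[of u v "parcs G" "pverts G"]
    by (auto simp: reachable_def wf_graph_def dest: rtrancl_on_rtranclI)
  then show ?thesis
    unfolding connected_def mk strongly_connected_def by auto
qed

definition induced :: "'a pair_pre_digraph \<Rightarrow> 'a set \<Rightarrow> 'a pair_pre_digraph" where
  "induced G W = \<lparr>pverts = W, parcs = parcs G \<inter> W \<times> W\<rparr>"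

lemma induced_sel [simp]: "pverts (induced G W) = W" "parcs (induced G W) = parcs G \<inter> W \<times> W"
  by (auto simp: induced_def)

lemma pair_graph_induced: "pair_graph G \<Longrightarrow> W \<subseteq> pverts G \<Longrightarrow> pair_graph (induced G W)"
  by (auto simp: pair_graph_iff wf_graph_def sym_def irrefl_def dest: finite_subset)

definition comp :: "'a pair_pre_digraph \<Rightarrow> 'a \<Rightarrow> 'a set" where
  "comp G v = (parcs G)\<^sup>* `` {v}"

lemma comp_self: "v \<in> comp G v"
  by (simp add: comp_def)

lemma comp_subset:
  assumes "wf_graph G" "v \<in> pverts G"
  shows "comp G v \<subseteq> pverts G"
  using rtrancl_closed[of v _ "parcs G" "pverts G"] assms by (auto simp: comp_def wf_graph_def)

lemma comp_eq:
  assumes "sym (parcs G)" "w \<in> comp G v"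
  shows "comp G w = comp G v"
proof -
  have "(v, w) \<in> (parcs G)\<^sup>*" "(w, v) \<in> (parcs G)\<^sup>*"
    using assms sym_rtrancl[OF assms(1)] by (auto simp: comp_def sym_def)
  then show ?thesis unfolding comp_def by (auto intro: rtrancl_trans)
qed

lemma comp_closed: "parcs G `` comp G v \<subseteq> comp G v"
  by (auto simp: comp_def intro: rtrancl_into_rtrancl)

lemma conn_graph_comp:
  assumes "pair_graph G" "v \<in> pverts G"
  shows "conn_graph (induced G (comp G v))"
proof -
  have pg: "pair_graph (induced G (comp G v))"
    using assms by (intro pair_graph_induced comp_subset pair_graphD)
  have "(u, w) \<in> (parcs G \<inter> comp G v \<times> comp G v)\<^sup>*" if "u \<in> comp G v" "w \<in> comp G v" for u w
  proof -
    have "w \<in> comp G u" using comp_eq[of G u v] pair_graphD(3)[OF assms(1)] that by auto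
    then show ?thesis using rtrancl_closed[OF _ that(1) comp_closed] by (auto simp: comp_def)
  qed
  then show ?thesis using comp_self[of v G] by (auto simp: conn_graph_iff[OF pg])
qed

lemma subgraph_with_proj:
  "subgraph (with_proj H) (with_proj G) \<longleftrightarrow>
     pverts H \<subseteq> pverts G \<and> parcs H \<subseteq> parcs G \<and> wf_graph G \<and> wf_graph H"
  by (auto simp: subgraph_def compatible_def wf_graph_def wf_digraph_def)

lemma subgraph_into_with_proj:
  assumes "subgraph H' (with_proj G)"
  obtains H where "H' = with_proj H"
proof -
  have "H' = with_proj \<lparr>pverts = verts H', parcs = arcs H'\<rparr>"
    using assms by (auto simp: subgraph_def compatible_def with_proj_def)
  then show thesis using that by blast
qed

lemma with_proj_inject: "with_proj G = with_proj H \<longleftrightarrow> G = H"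
  by (auto simp: with_proj_def)

text \<open>The subgraphs competing for maximality need not be symmetric, and their connectedness
  refers to the symmetric closure. Symmetry of \<open>G\<close> puts the reversed arcs into
  \<open>G\<close> as well, so a connected subgraph through \<open>v\<close> stays among the
  vertices reachable from \<open>v\<close>. The graph induced there is therefore the only maximal
  one through \<open>v\<close>.\<close>

lemma graph_components_eq:
  assumes G: "pair_graph G"
  shows "graph_components G = (\<lambda>v. induced G (comp G v)) ` pverts G"
proof -
  note g = pair_graphD[OF G]
  have connD: "w \<in> comp G u"
    if "subgraph (with_proj H) (with_proj G)" "conn_graph H" "u \<in> pverts H" "w \<in> pverts H" for H u w
  proof -
    have "(u, w) \<in> (parcs H \<union> (parcs H)\<inverse>)\<^sup>*"
    proof -
      have "mk_symmetric (with_proj H) = \<lparr>pverts = pverts H, parcs = parcs H \<union> (parcs H)\<inverse>\<rparr>"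
        by (fastforce simp: mk_symmetric_def)
      then show ?thesis
        using that(2-4) by (auto simp: connected_def strongly_connected_def reachable_def
            dest: rtrancl_on_rtranclI)
    qed
    moreover have "parcs H \<union> (parcs H)\<inverse> \<subseteq> parcs G"
      using that(1) g(3) by (auto simp: subgraph_with_proj sym_def)
    ultimately show ?thesis unfolding comp_def using rtrancl_mono by blast
  qed
  have below: "subgraph (with_proj H) (with_proj (induced G (comp G v)))"
    if "subgraph (with_proj H) (with_proj G)" "conn_graph H" "v \<in> pverts H" for H v
    using that connD[OF that] by (auto simp: subgraph_with_proj wf_graph_def)
  have sub: "subgraph (with_proj (induced G (comp G v))) (with_proj G)" if "v \<in> pverts G" for v
    using g comp_subset[OF g(2) that] by (auto simp: subgraph_with_proj wf_graph_def)
  show ?thesis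
  proof (intro equalityI subsetI)
    fix H assume "H \<in> graph_components G"
    then have H: "subgraph (with_proj H) (with_proj G)" "conn_graph H"
      and max: "\<And>H'. H' \<noteq> with_proj H \<Longrightarrow> subgraph (with_proj H) H' \<Longrightarrow>
        \<not> (subgraph H' (with_proj G) \<and> Digraph_Component.connected H')"
      by (auto simp: graph_components_def pre_digraph.max_subgraph_def)
    obtain v where v: "v \<in> pverts H"
      using H(2) by (auto simp: connected_def strongly_connected_def mk_symmetric_def)
    then have vG: "v \<in> pverts G" using H(1) by (auto simp: subgraph_with_proj)
    have "with_proj (induced G (comp G v)) = with_proj H"
      using max[OF _ below[OF H v]] sub[OF vG] conn_graph_comp[OF G vG] by blast
    then show "H \<in> (\<lambda>v. induced G (comp G v)) ` pverts G"
      using vG by (auto simp: with_proj_inject)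
  next
    fix K assume "K \<in> (\<lambda>v. induced G (comp G v)) ` pverts G"
    then obtain v where v: "v \<in> pverts G" and K: "K = induced G (comp G v)" by auto
    have "H' = with_proj K" if H': "subgraph (with_proj K) H'" "subgraph H' (with_proj G)"
      "Digraph_Component.connected H'" for H'
    proof -
      obtain H where H: "H' = with_proj H" using subgraph_into_with_proj[OF H'(2)] .
      have "v \<in> pverts H" using H'(1) comp_self[of v G] by (auto simp: H K subgraph_with_proj)
      then have "subgraph (with_proj H) (with_proj K)" unfolding K using H' below by (auto simp: H)
      then have "H = K" using H'(1) by (auto simp: H subgraph_with_proj intro!: pair_pre_digraph.equality)
      then show ?thesis by (simp add: H)
    qed
    then show "K \<in> graph_components G"
      using sub[OF v] conn_graph_comp[OF G v]
      by (auto simp: graph_components_def pre_digraph.max_subgraph_def K)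
  qed
qed

lemma pair_graph_component:
  assumes "pair_graph G" "H \<in> graph_components G"
  shows "pair_graph H" "conn_graph H" "pverts H \<subseteq> pverts G" "pverts H \<noteq> {}"
proof -
  obtain v where v: "v \<in> pverts G" "H = induced G (comp G v)"
    using assms by (auto simp: graph_components_eq)
  show "pair_graph H" "conn_graph H" "pverts H \<subseteq> pverts G" "pverts H \<noteq> {}"
    using v assms comp_subset[OF pair_graphD(2)[OF assms(1)] v(1)] comp_self[of v G]
    by (auto intro: pair_graph_induced conn_graph_comp)
qed

lemma finite_graph_components: "pair_graph G \<Longrightarrow> finite (graph_components G)"
  by (simp add: graph_components_eq pair_graphD)

lemma components_disjoint:
  assumes G: "pair_graph G" and "H \<in> graph_components G" "K \<in> graph_components G"
    and "pverts H \<inter> pverts K \<noteq> {}"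
  shows "H = K"
proof -
  obtain u v where "u \<in> pverts G" "H = induced G (comp G u)" "v \<in> pverts G" "K = induced G (comp G v)"
    using assms by (auto simp: graph_components_eq)
  moreover from this obtain w where "w \<in> comp G u" "w \<in> comp G v" using assms(4) by auto
  ultimately show ?thesis using comp_eq[OF pair_graphD(3)[OF G]] by metis
qed

lemma graph_components_conn:
  assumes "pair_graph G" "conn_graph G"
  shows "graph_components G = {G}"
proof -
  have "comp G v = pverts G" if "v \<in> pverts G" for v
    using assms that comp_subset[OF pair_graphD(2)[OF assms(1)] that]
    by (auto simp: conn_graph_iff comp_def)
  moreover have "induced G (pverts G) = G"
    using pair_graphD(2)[OF assms(1)]
    by (auto simp: wf_graph_def intro!: pair_pre_digraph.equality)
  ultimately show ?thesis using assms by (auto simp: graph_components_eq conn_graph_iff)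
qed

subsection \<open>Isomorphic copies\<close>

lemma pair_graph_image:
  assumes "pair_graph G" "inj_on f (pverts G)"
  shows "pair_graph (image_graph f G)"
proof -
  have "f x \<noteq> f y" if "(x, y) \<in> parcs G" for x y
  proof
    assume "f x = f y"
    then have "x = y" using that assms by (auto simp: pair_graph_iff wf_graph_def dest: inj_onD)
    then show False using that assms(1) by (auto simp: pair_graph_iff irrefl_def)
  qed
  then show ?thesis
    using assms(1) by (fastforce simp: pair_graph_iff wf_graph_def sym_def irrefl_def)
qed

lemma digraph_iso_image:
  assumes "pair_graph G" "inj_on f (pverts G)"
  shows "digraph_iso (with_proj G) (with_proj (image_graph f G))"
proof -
  have wf: "wf_digraph (with_proj G)"
    using pair_graphD(2)[OF assms(1)] by (auto simp: wf_graph_def wf_digraph_def)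
  have "inj_on (map_prod f f) (parcs G)"
    using map_prod_inj_on[OF assms(2) assms(2)] pair_graphD(2)[OF assms(1)]
    by (auto simp: wf_graph_def intro: inj_on_subset)
  then have "pre_digraph.digraph_isomorphism (with_proj G)
      \<lparr>iso_verts = f, iso_arcs = map_prod f f, iso_head = snd, iso_tail = fst\<rparr>"
    using wf assms(2) by (auto simp: pre_digraph.digraph_isomorphism_def)
  then show ?thesis
    unfolding digraph_iso_def by (intro exI conjI) (auto simp: app_iso_def with_proj_def)
qed

lemma class_image:
  assumes "graph_class C" "G \<in> C" "inj_on f (pverts G)"
  shows "image_graph f G \<in> C"
  using assms digraph_iso_image[of G f] unfolding graph_class_def by blast

lemma image_graph_comp:
  assumes "image_graph f G = G'" "\<And>v. v \<in> pverts G \<Longrightarrow> g (f v) = v" "wf_graph G"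
  shows "image_graph g G' = G"
proof -
  have "(\<lambda>x. g (f x)) ` pverts G = pverts G" using assms(2) by (auto simp: image_iff)
  moreover have "map_prod (\<lambda>x. g (f x)) (\<lambda>x. g (f x)) ` parcs G = parcs G"
  proof -
    have "map_prod (\<lambda>x. g (f x)) (\<lambda>x. g (f x)) ` parcs G = id ` parcs G"
      using assms(2,3) by (intro image_cong) (auto simp: wf_graph_def)
    then show ?thesis by simp
  qed
  ultimately show ?thesis
    unfolding assms(1)[symmetric] image_graph_def
    by (simp add: image_image map_prod_def split_beta)
qed

lemma comp_image:
  assumes "pair_graph G" "inj_on f (pverts G)" "v \<in> pverts G"
  shows "comp (image_graph f G) (f v) = f ` comp G v"
proof (intro equalityI subsetI)
  fix y assume "y \<in> comp (image_graph f G) (f v)"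
  then have "(f v, y) \<in> (parcs (image_graph f G))\<^sup>*" by (simp add: comp_def)
  then show "y \<in> f ` comp G v"
  proof induction
    case base then show ?case by (simp add: comp_self)
  next
    case (step y z)
    then obtain w where w: "w \<in> comp G v" "y = f w" by auto
    then have wV: "w \<in> pverts G" using comp_subset[OF pair_graphD(2)[OF assms(1)] assms(3)] by auto
    obtain a b where ab: "(a, b) \<in> parcs G" "f a = y" "f b = z" using step.hyps(2) by auto
    then have "a = w" using w wV assms by (auto simp: pair_graph_iff wf_graph_def dest: inj_onD)
    then have "b \<in> comp G v" using ab w(1) comp_closed[of G v] by auto
    then show ?case using ab by auto
  qed
next
  fix y assume "y \<in> f ` comp G v"
  then obtain w where "(v, w) \<in> (parcs G)\<^sup>*" "y = f w" by (auto simp: comp_def)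
  moreover have "(v, w) \<in> (parcs G)\<^sup>* \<Longrightarrow> (f v, f w) \<in> (parcs (image_graph f G))\<^sup>*" for w
    by (induction rule: rtrancl_induct) (auto intro: rtrancl_into_rtrancl)
  ultimately show "y \<in> comp (image_graph f G) (f v)" by (simp add: comp_def)
qed

lemma induced_image:
  assumes "pair_graph G" "inj_on f (pverts G)" "W \<subseteq> pverts G"
  shows "induced (image_graph f G) (f ` W) = image_graph f (induced G W)"
proof -
  have "map_prod f f ` parcs G \<inter> f ` W \<times> f ` W \<subseteq> map_prod f f ` (parcs G \<inter> W \<times> W)"
  proof
    fix e assume e: "e \<in> map_prod f f ` parcs G \<inter> f ` W \<times> f ` W"
    then obtain a b where ab: "e = (f a, f b)" "(a, b) \<in> parcs G" by auto
    with e obtain c d where cd: "f a = f c" "f b = f d" "c \<in> W" "d \<in> W" by auto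
    have "a \<in> pverts G" "b \<in> pverts G"
      using ab(2) assms(1) by (auto simp: pair_graph_iff wf_graph_def)
    then have "a = c" "b = d" using cd assms(2,3) by (auto dest: inj_onD)
    with ab cd show "e \<in> map_prod f f ` (parcs G \<inter> W \<times> W)" by auto
  qed
  moreover have "map_prod f f ` (parcs G \<inter> W \<times> W) \<subseteq> map_prod f f ` parcs G \<inter> f ` W \<times> f ` W"
    by auto
  ultimately have "map_prod f f ` parcs G \<inter> f ` W \<times> f ` W = map_prod f f ` (parcs G \<inter> W \<times> W)"
    by (rule equalityI)
  then show ?thesis by (simp add: induced_def image_graph_def)
qed

lemma graph_components_image:
  assumes "pair_graph G" "inj_on f (pverts G)"
  shows "graph_components (image_graph f G) = image_graph f ` graph_components G"
proof -
  have "induced (image_graph f G) (comp (image_graph f G) (f v)) = image_graph f (induced G (comp G v))"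
    if "v \<in> pverts G" for v
    using comp_image[OF assms that] induced_image[OF assms comp_subset[OF pair_graphD(2)[OF assms(1)] that]]
    by simp
  then show ?thesis
    using assms by (auto simp: graph_components_eq pair_graph_image image_image)
qed

lemma conn_graph_image:
  assumes "pair_graph G" "inj_on f (pverts G)" "conn_graph G"
  shows "conn_graph (image_graph f G)"
proof -
  have "graph_components (image_graph f G) = {image_graph f G}"
    using graph_components_image[OF assms(1,2)] graph_components_conn[OF assms(1,3)] by simp
  then show ?thesis using pair_graph_component(2)[OF pair_graph_image[OF assms(1,2)]] by blast
qed

subsection \<open>Disjoint unions\<close>

definition gunion :: "'a pair_pre_digraph \<Rightarrow> 'a pair_pre_digraph \<Rightarrow> 'a pair_pre_digraph" where
  "gunion A B = \<lparr>pverts = pverts A \<union> pverts B, parcs = parcs A \<union> parcs B\<rparr>"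

lemma gunion_sel [simp]:
  "pverts (gunion A B) = pverts A \<union> pverts B" "parcs (gunion A B) = parcs A \<union> parcs B"
  by (auto simp: gunion_def)

lemma gunion_commute: "gunion A B = gunion B A"
  by (auto simp: gunion_def)

lemma pair_graph_gunion: "pair_graph A \<Longrightarrow> pair_graph B \<Longrightarrow> pair_graph (gunion A B)"
  by (auto simp: pair_graph_iff wf_graph_def sym_def irrefl_def)

lemma comp_gunion:
  assumes "wf_graph A" "wf_graph B" "pverts A \<inter> pverts B = {}" "v \<in> pverts A"
  shows "comp (gunion A B) v = comp A v" "induced (gunion A B) (comp A v) = induced A (comp A v)"
proof -
  have *: "(parcs A \<union> parcs B) `` pverts A \<subseteq> pverts A"
    "(parcs A \<union> parcs B) \<inter> pverts A \<times> pverts A = parcs A"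
    using assms by (auto simp: wf_graph_def)
  have "(v, w) \<in> (parcs A)\<^sup>*" if "(v, w) \<in> (parcs A \<union> parcs B)\<^sup>*" for w
    using rtrancl_closed[OF that assms(4) *(1)] unfolding *(2) by simp
  then show "comp (gunion A B) v = comp A v"
    by (auto simp: comp_def intro: in_rtrancl_UnI)
  have "comp A v \<subseteq> pverts A" using assms by (intro comp_subset)
  then show "induced (gunion A B) (comp A v) = induced A (comp A v)"
    using assms by (auto simp: induced_def wf_graph_def)
qed

lemma graph_components_gunion:
  assumes "pair_graph A" "pair_graph B" "pverts A \<inter> pverts B = {}"
  shows "graph_components (gunion A B) = graph_components A \<union> graph_components B"
proof -
  have wf: "wf_graph A" "wf_graph B" using assms by (auto simp: pair_graph_iff)
  have "(\<lambda>v. induced (gunion A B) (comp (gunion A B) v)) ` pverts A =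
      (\<lambda>v. induced A (comp A v)) ` pverts A"
    by (intro image_cong) (simp_all add: comp_gunion[OF wf assms(3)])
  moreover have "pverts B \<inter> pverts A = {}" using assms by auto
  then have "(\<lambda>v. induced (gunion A B) (comp (gunion A B) v)) ` pverts B =
      (\<lambda>v. induced B (comp B v)) ` pverts B"
    unfolding gunion_commute[of A B]
    by (intro image_cong) (simp_all add: comp_gunion[OF wf(2,1)])
  ultimately show ?thesis
    unfolding graph_components_eq[OF assms(1)] graph_components_eq[OF assms(2)]
      graph_components_eq[OF pair_graph_gunion[OF assms(1,2)]] gunion_sel image_Un
    by simp
qed

text \<open>No arc leaves a reachable set, so deleting a component loses only its own arcs.\<close>

lemma component_split:
  assumes G: "pair_graph G" and H: "H \<in> graph_components G"
  shows "gunion H (induced G (pverts G - pverts H)) = G"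
proof -
  obtain v where v: "v \<in> pverts G" "H = induced G (comp G v)"
    using assms by (auto simp: graph_components_eq)
  have cl: "(a \<in> comp G v) = (b \<in> comp G v)" if "(a, b) \<in> parcs G" for a b
  proof -
    have "(b, a) \<in> parcs G" using that pair_graphD(3)[OF G] by (auto simp: sym_def)
    then show ?thesis using that comp_closed[of G v] by blast
  qed
  have "comp G v \<subseteq> pverts G" using comp_subset[OF pair_graphD(2)[OF G] v(1)] .
  then show ?thesis
    using cl pair_graphD(2)[OF G] unfolding v(2)
    by (auto simp: wf_graph_def intro!: pair_pre_digraph.equality)
qed

lemma decomposable_gunion:
  assumes "graph_class C" "decomposable C" "pair_graph A" "pair_graph B" "pverts A \<inter> pverts B = {}"
  shows "gunion A B \<in> C \<longleftrightarrow> A \<in> C \<and> B \<in> C"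
proof -
  have "gunion A B \<in> C \<longleftrightarrow> (\<forall>H\<in>graph_components A \<union> graph_components B. H \<in> C)"
    using assms graph_components_gunion[of A B] pair_graph_gunion[of A B]
    unfolding decomposable_def by auto
  then show ?thesis using assms unfolding decomposable_def by auto
qed

subsection \<open>Bridges\<close>

text \<open>Pairs are ordered, as they are in \<open>bridges\<close>, so the two sides of the
  switching count orientations consistently.\<close>

definition cross :: "'a pair_pre_digraph \<Rightarrow> ('a \<times> 'a) set" where
  "cross G = {(u, v) \<in> pverts G \<times> pverts G. v \<notin> comp G u}"

lemma add_edge_sel [simp]:
  "pverts (add_edge u v G) = pverts G" "parcs (add_edge u v G) = parcs G \<union> {(u, v), (v, u)}"
  by (auto simp: add_edge_def)

lemma finite_cross: "pair_graph G \<Longrightarrow> finite (cross G)"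
  by (rule finite_subset[of _ "pverts G \<times> pverts G"]) (auto simp: cross_def pair_graphD)

lemma bridge_addable_cross:
  assumes "graph_class C" "bridge_addable C" "G \<in> C" "(u, v) \<in> cross G"
  shows "add_edge u v G \<in> C"
proof -
  have G: "pair_graph G" using assms by (auto simp: graph_class_def)
  have uv: "u \<in> pverts G" "v \<in> pverts G" "v \<notin> comp G u" using assms by (auto simp: cross_def)
  let ?H = "induced G (comp G u)" and ?K = "induced G (comp G v)"
  have "?H \<in> graph_components G" "?K \<in> graph_components G"
    using uv by (auto simp: graph_components_eq[OF G])
  moreover have "u \<in> pverts ?H" "v \<in> pverts ?K" by (auto simp: comp_self)
  moreover have "?H \<noteq> ?K" using uv(3) comp_self[of v G] by (metis induced_sel(1))
  ultimately show ?thesis using assms(2,3) unfolding bridge_addable_def by blast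
qed

definition bridges :: "'a rel \<Rightarrow> 'a rel" where
  "bridges E = {(u, v) \<in> E. (u, v) \<notin> (E - {(u, v), (v, u)})\<^sup>*}"

text \<open>Delete one bridge: \<open>F\<close> loses at most its two orientations, the other
  members of \<open>F\<close> remain bridges, and the number of components grows. Without bridges
  the bound says that there are at most as many components as vertices.\<close>

lemma card_bridges_plus_classes:
  assumes "finite V" "finite F" "E \<subseteq> V \<times> V" "F \<subseteq> bridges E" "sym E"
  shows "card F + 2 * card ((\<lambda>v. E\<^sup>* `` {v}) ` V) \<le> 2 * card V"
  using assms(2-5)
proof (induction "card F" arbitrary: E F rule: less_induct)
  case less
  show ?case
  proof (cases "F = {}")
    case True
    then show ?thesis using card_image_le[OF assms(1)] by simp
  next
    case False
    then obtain u v where uv: "(u, v) \<in> F" by auto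
    define E' where "E' = E - {(u, v), (v, u)}"
    define F' where "F' = F - {(u, v), (v, u)}"
    have E': "E' \<subseteq> V \<times> V" using less.prems by (auto simp: E'_def)
    have "(a, b) \<notin> (E' - {(a, b), (b, a)})\<^sup>*" if "(a, b) \<in> F" for a b
    proof -
      have "(a, b) \<notin> (E - {(a, b), (b, a)})\<^sup>*" using that less.prems by (auto simp: bridges_def)
      moreover have "(E' - {(a, b), (b, a)})\<^sup>* \<subseteq> (E - {(a, b), (b, a)})\<^sup>*"
        by (rule rtrancl_mono) (auto simp: E'_def)
      ultimately show ?thesis by blast
    qed
    then have "F' \<subseteq> bridges E'" using less.prems by (auto simp: bridges_def F'_def E'_def)
    moreover have "card F' < card F" using uv less.prems(1) by (auto simp: F'_def intro: psubset_card_mono)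
    moreover have "sym E'" using less.prems(4) by (auto simp: E'_def sym_def)
    ultimately have IH: "card F' + 2 * card ((\<lambda>v. E'\<^sup>* `` {v}) ` V) \<le> 2 * card V"
      using less.prems(1) E' by (intro less.hyps) (auto simp: F'_def)
    have fF': "finite F'" using less.prems(1) by (simp add: F'_def)
    have "card F \<le> card (insert (u, v) (insert (v, u) F'))"
      using less.prems(1) by (intro card_mono) (auto simp: F'_def)
    also have "\<dots> \<le> Suc (Suc (card F'))"
    proof -
      have "card (insert x X) \<le> Suc (card X)" for x :: "'a \<times> 'a" and X
        by (cases "finite X") (auto simp: card_insert_if)
      then show ?thesis by (meson Suc_le_mono le_trans)
    qed
    finally have 1: "card F \<le> card F' + 2" by simp
    have uvV: "u \<in> V" "v \<in> V" and nr: "(u, v) \<notin> E'\<^sup>*" and uvE: "(u, v) \<in> E"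
      using uv less.prems by (auto simp: bridges_def E'_def)
    have sub: "E'\<^sup>* \<subseteq> E\<^sup>*" by (rule rtrancl_mono) (auto simp: E'_def)
    let ?h = "\<lambda>c. E\<^sup>* `` c"
    have h: "?h (E'\<^sup>* `` {w}) = E\<^sup>* `` {w}" for w
      using sub by (auto intro: rtrancl_trans)
    \<comment> \<open>Closing under \<open>E\<close> maps the old classes onto the new ones. If
      their numbers agreed, this map would be injective, but it merges the distinct classes of
      \<open>u\<close> and \<open>v\<close>.\<close>
    have 2: "card ((\<lambda>v. E\<^sup>* `` {v}) ` V) < card ((\<lambda>v. E'\<^sup>* `` {v}) ` V)"
    proof (rule ccontr)
      assume "\<not> ?thesis"
      moreover have img: "(\<lambda>v. E\<^sup>* `` {v}) ` V = ?h ` (\<lambda>v. E'\<^sup>* `` {v}) ` V"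
        unfolding image_image h ..
      ultimately have "card (?h ` (\<lambda>v. E'\<^sup>* `` {v}) ` V) = card ((\<lambda>v. E'\<^sup>* `` {v}) ` V)"
        using card_image_le[of "(\<lambda>v. E'\<^sup>* `` {v}) ` V" ?h] assms(1) by simp
      then have inj: "inj_on ?h ((\<lambda>v. E'\<^sup>* `` {v}) ` V)"
        using assms(1) by (intro eq_card_imp_inj_on) auto
      have "(u, v) \<in> E\<^sup>*" "(v, u) \<in> E\<^sup>*" using uvE less.prems(4) by (auto simp: sym_def)
      then have euv: "E\<^sup>* `` {u} = E\<^sup>* `` {v}"
        by (intro equalityI subsetI) (meson Image_singleton_iff rtrancl_trans)+
      have "E'\<^sup>* `` {u} = E'\<^sup>* `` {v}"
      proof (rule inj_onD[OF inj])
        show "?h (E'\<^sup>* `` {u}) = ?h (E'\<^sup>* `` {v})" unfolding h by (rule euv)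
      qed (use uvV in blast)+
      then show False using nr by auto
    qed
    show ?thesis using IH 1 2 by simp
  qed
qed

lemma card_bridges_le:
  assumes "finite V" "E \<subseteq> V \<times> V" "sym E"
  shows "card (bridges E) \<le> 2 * card V"
proof -
  have "finite (bridges E)"
    using assms by (auto simp: bridges_def intro: finite_subset[of _ "V \<times> V"])
  then show ?thesis using card_bridges_plus_classes[OF assms(1) _ assms(2) order_refl assms(3)] by simp
qed

lemma bridges_add_edge:
  assumes "pair_graph G" "(u, v) \<in> cross G"
  shows "(u, v) \<in> bridges (parcs (add_edge u v G))" "parcs G = parcs (add_edge u v G) - {(u, v), (v, u)}"
proof -
  have uv: "(u, v) \<notin> (parcs G)\<^sup>*" using assms by (auto simp: cross_def comp_def)
  then have "(u, v) \<notin> parcs G" by auto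
  moreover from this have "(v, u) \<notin> parcs G" using pair_graphD(3)[OF assms(1)] by (auto simp: sym_def)
  ultimately have *: "parcs (add_edge u v G) - {(u, v), (v, u)} = parcs G" by auto
  then show "parcs G = parcs (add_edge u v G) - {(u, v), (v, u)}" ..
  show "(u, v) \<in> bridges (parcs (add_edge u v G))"
    unfolding bridges_def mem_Collect_eq split_conv * using uv by simp
qed

section \<open>A universal pendant graph\<close>

definition join :: "'a \<Rightarrow> 'a \<Rightarrow> 'a pair_pre_digraph \<Rightarrow> 'a pair_pre_digraph \<Rightarrow> 'a pair_pre_digraph" where
  "join x y A B = add_edge x y (gunion A B)"

lemma join_sel [simp]:
  "pverts (join x y A B) = pverts A \<union> pverts B"
  "parcs (join x y A B) = parcs A \<union> parcs B \<union> {(x, y), (y, x)}"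
  by (auto simp: join_def)

lemma glue_eq_join:
  assumes "s 0 \<inter> pverts A = {x}" "s 1 \<inter> pverts B = {y}"
  shows "glue {(0, 1)} s A B = join x y A B"
  using assms by (intro pair_pre_digraph.equality) auto

text \<open>Slot 0 holds the root of one part and slot 1 that of the other. In each part the foreign
  slot is empty, so the game with one root extends to two slots, and gluing along
  \<open>(0, 1)\<close> creates exactly the bridge. Either root may be retained afterwards.\<close>

lemma game_join:
  assumes A: "game m 1 A (\<lambda>_. {x}) A' (\<lambda>_. {x'})" and B: "game m 1 B (\<lambda>_. {y}) B' (\<lambda>_. {y'})"
    and wf: "wf_graph A" "wf_graph B" "wf_graph A'" "wf_graph B'"
    and disj: "pverts A \<inter> pverts B = {}" "pverts A' \<inter> pverts B' = {}"
    and xy: "x \<in> pverts A" "x' \<in> pverts A'" "y \<in> pverts B" "y' \<in> pverts B'"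
  shows "game m 1 (join x y A B) (\<lambda>_. {x}) (join x' y' A' B') (\<lambda>_. {x'})"
    and "game m 1 (join x y A B) (\<lambda>_. {y}) (join x' y' A' B') (\<lambda>_. {y'})"
proof -
  define s where "s = (\<lambda>i::nat. if i = 0 then {x} else {y})"
  define s' where "s' = (\<lambda>i::nat. if i = 0 then {x'} else {y'})"
  have "game m 2 A (\<lambda>i. if i = 1 then {} else {x}) A' (\<lambda>i. if i = 1 then {} else {x'})"
    using game_subst[OF A, of 2 "\<lambda>i. i = 1" "\<lambda>_. 0"] by simp
  moreover have "game m 2 A s A (\<lambda>i. if i = 1 then {} else {x})"
    by (rule game_restrict) (use xy disj in \<open>auto simp: s_def\<close>)
  moreover have "game m 2 A' (\<lambda>i. if i = 1 then {} else {x'}) A' s'"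
    by (rule game_restrict) (use xy disj in \<open>auto simp: s'_def\<close>)
  ultimately have 1: "game m 2 A s A' s'" using game_trans by metis
  have "game m 2 B (\<lambda>i. if i = 0 then {} else {y}) B' (\<lambda>i. if i = 0 then {} else {y'})"
    using game_subst[OF B, of 2 "\<lambda>i. i = 0" "\<lambda>_. 0"] by simp
  moreover have "game m 2 B s B (\<lambda>i. if i = 0 then {} else {y})"
    by (rule game_restrict) (use xy disj in \<open>auto simp: s_def\<close>)
  moreover have "game m 2 B' (\<lambda>i. if i = 0 then {} else {y'}) B' s'"
    by (rule game_restrict) (use xy disj in \<open>auto simp: s'_def\<close>)
  ultimately have 2: "game m 2 B s B' s'" using game_trans by metis
  have "game m 2 (glue {(0, 1)} s A B) s (glue {(0, 1)} s' A' B') s'"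
    by (rule game_glue[OF 1 2 wf disj]) auto
  moreover have "glue {(0, 1)} s A B = join x y A B"
    by (rule glue_eq_join) (use xy in \<open>auto simp: s_def\<close>)
  moreover have "glue {(0, 1)} s' A' B' = join x' y' A' B'"
    by (rule glue_eq_join) (use xy in \<open>auto simp: s'_def\<close>)
  ultimately have j: "game m 2 (join x y A B) s (join x' y' A' B') s'" by simp
  show "game m 1 (join x y A B) (\<lambda>_. {x}) (join x' y' A' B') (\<lambda>_. {x'})"
    using game_subst[OF j, of 1 "\<lambda>_. False" "\<lambda>_. 0"] by (simp add: s_def s'_def)
  show "game m 1 (join x y A B) (\<lambda>_. {y}) (join x' y' A' B') (\<lambda>_. {y'})"
    using game_subst[OF j, of 1 "\<lambda>_. False" "\<lambda>_. 1"] by (simp add: s_def s'_def)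
qed

lemma game_image_root:
  assumes "inj_on f (pverts G)" "wf_graph G" "x \<in> pverts G"
  shows "game m 1 G (\<lambda>_. {x}) (image_graph f G) (\<lambda>_. {f x})"
  by (rule game_image) (use assms in auto)

lemma mso_equiv_image:
  assumes "inj_on f (pverts G)" "wf_graph G"
  shows "mso_equiv m G (image_graph f G)"
  by (rule game_mso_equiv[of m 0 _ "\<lambda>_. {}" _ "\<lambda>_. {}"], rule game_image) (use assms in auto)

lemma mso_equiv_sym: "mso_equiv m G H \<Longrightarrow> mso_equiv m H G"
  by (auto simp: mso_equiv_def)

lemma mso_equiv_trans: "mso_equiv m G H \<Longrightarrow> mso_equiv m H K \<Longrightarrow> mso_equiv m G K"
  by (auto simp: mso_equiv_def)

section \<open>Absorbing rooted graphs in an addable class\<close>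

locale addable_class =
  fixes C :: "nat pair_pre_digraph set"
  assumes graph_class: "graph_class C" and decomposable: "decomposable C"
    and bridge_addable: "bridge_addable C"
begin

lemma pair_graph_class: "G \<in> C \<Longrightarrow> pair_graph G"
  using graph_class by (simp add: graph_class_def)

definition conn_members :: "nat pair_pre_digraph set" where
  "conn_members = {G \<in> C. conn_graph G}"

lemma conn_membersD:
  assumes "G \<in> conn_members"
  shows "G \<in> C" "conn_graph G" "pair_graph G" "wf_graph G" "finite (pverts G)" "pverts G \<noteq> {}"
  using assms by (auto simp: conn_members_def pair_graph_class pair_graphD conn_graph_iff)

lemma component_conn_members:
  assumes "G \<in> C" "H \<in> graph_components G"
  shows "H \<in> conn_members"
proof -
  have G: "pair_graph G" using assms(1) by (rule pair_graph_class)
  then have "H \<in> C" using decomposable assms unfolding decomposable_def by blast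
  then show ?thesis using pair_graph_component(2)[OF G assms(2)] by (simp add: conn_members_def)
qed

lemma conn_members_image:
  assumes "G \<in> conn_members" "inj_on f (pverts G)"
  shows "image_graph f G \<in> conn_members"
  using class_image[OF graph_class conn_membersD(1)[OF assms(1)] assms(2)]
    conn_graph_image[OF conn_membersD(3)[OF assms(1)] assms(2) conn_membersD(2)[OF assms(1)]]
  by (simp add: conn_members_def)

lemma join_conn_members:
  assumes A: "A \<in> conn_members" and B: "B \<in> conn_members"
    and disj: "pverts A \<inter> pverts B = {}" and xy: "x \<in> pverts A" "y \<in> pverts B"
  shows "join x y A B \<in> conn_members"
proof -
  note a = conn_membersD[OF A] and b = conn_membersD[OF B]
  have "gunion A B \<in> C"
    using decomposable_gunion[OF graph_class decomposable a(3) b(3) disj] a b by simp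
  moreover have "(x, y) \<in> cross (gunion A B)"
    using xy disj comp_gunion(1)[OF a(4) b(4) disj xy(1)] comp_subset[OF a(4) xy(1)]
    by (auto simp: cross_def)
  ultimately have J: "join x y A B \<in> C"
    unfolding join_def by (rule bridge_addable_cross[OF graph_class bridge_addable])
  have reach: "(x, w) \<in> (parcs (join x y A B))\<^sup>*" if "w \<in> pverts (join x y A B)" for w
  proof -
    have sub: "(parcs A)\<^sup>* \<subseteq> (parcs (join x y A B))\<^sup>*" "(parcs B)\<^sup>* \<subseteq> (parcs (join x y A B))\<^sup>*"
      by (rule rtrancl_mono; force)+
    have "(x, w) \<in> (parcs A)\<^sup>* \<or> (y, w) \<in> (parcs B)\<^sup>*"
      using that xy a(2) b(2) by (auto simp: conn_graph_iff a(3) b(3))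
    then show ?thesis
    proof
      assume "(y, w) \<in> (parcs B)\<^sup>*"
      then show ?thesis using sub(2) by (intro converse_rtrancl_into_rtrancl[of x y]) auto
    qed (use sub in auto)
  qed
  have pg: "pair_graph (join x y A B)" using J by (rule pair_graph_class)
  have "(u, w) \<in> (parcs (join x y A B))\<^sup>*"
    if "u \<in> pverts (join x y A B)" "w \<in> pverts (join x y A B)" for u w
  proof -
    have "(u, x) \<in> (parcs (join x y A B))\<^sup>*"
      using reach[OF that(1)] sym_rtrancl[OF pair_graphD(3)[OF pg]] by (meson symD)
    then show ?thesis using reach[OF that(2)] by (rule rtrancl_trans)
  qed
  then have "conn_graph (join x y A B)" using a(6) by (auto simp: conn_graph_iff[OF pg] simp del: join_sel(2))
  then show ?thesis using J by (simp add: conn_members_def)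
qed

text \<open>The equivalence keeps the root \<open>x\<close>, so that it can be used again inside
  larger graphs attached at \<open>x\<close>.\<close>

definition absorbing :: "nat \<Rightarrow> nat pair_pre_digraph \<Rightarrow> nat \<Rightarrow> bool" where
  "absorbing m A x \<longleftrightarrow> (\<forall>N\<in>conn_members. \<forall>y\<in>pverts N. pverts A \<inter> pverts N = {} \<longrightarrow>
     game m 1 (join x y A N) (\<lambda>_. {x}) A (\<lambda>_. {x}))"

lemma absorbingD:
  "absorbing m A x \<Longrightarrow> N \<in> conn_members \<Longrightarrow> y \<in> pverts N \<Longrightarrow> pverts A \<inter> pverts N = {} \<Longrightarrow>
     game m 1 (join x y A N) (\<lambda>_. {x}) A (\<lambda>_. {x})"
  by (simp add: absorbing_def)

lemma shift_graph:
  assumes "finite (V :: nat set)" 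
  obtains f :: "nat \<Rightarrow> nat" where "inj f" "\<And>v. f v \<notin> V"
proof -
  have "f v \<notin> V" if "f = (\<lambda>v. v + Suc (Max V))" for f v
    using Max_ge[OF assms] that by (metis add_leE not_less_eq_eq le_refl add.commute)
  then show thesis using that[of "\<lambda>v. v + Suc (Max V)"] by (auto simp: inj_def)
qed

text \<open>\<open>N\<close> avoids \<open>A'\<close> but may overlap \<open>A\<close>, so a shifted
  copy of \<open>N\<close> is attached to \<open>A\<close> instead.\<close>

lemma absorbing_cong:
  assumes "absorbing m A x" "game m 1 A' (\<lambda>_. {x'}) A (\<lambda>_. {x})"
    and "wf_graph A" "wf_graph A'" "finite (pverts A)" "x \<in> pverts A" "x' \<in> pverts A'"
  shows "absorbing m A' x'"
  unfolding absorbing_def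
proof (intro ballI impI)
  fix N y assume N: "N \<in> conn_members" and y: "y \<in> pverts N" and disj: "pverts A' \<inter> pverts N = {}"
  obtain f :: "nat \<Rightarrow> nat" where f: "inj f" "\<And>v. f v \<notin> pverts A" using shift_graph[OF assms(5)] by blast
  have fN: "inj_on f (pverts N)" by (rule inj_on_subset[OF f(1) subset_UNIV])
  have N': "image_graph f N \<in> conn_members" by (rule conn_members_image[OF N fN])
  have d': "pverts A \<inter> pverts (image_graph f N) = {}" using f by auto
  have "game m 1 (join x' y A' N) (\<lambda>_. {x'}) (join x (f y) A (image_graph f N)) (\<lambda>_. {x})"
    by (rule game_join(1)[OF assms(2) game_image_root[OF fN conn_membersD(4)[OF N] y]])
      (use assms conn_membersD(4)[OF N] conn_membersD(4)[OF N'] disj d' y in auto)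
  moreover have "game m 1 (join x (f y) A (image_graph f N)) (\<lambda>_. {x}) A (\<lambda>_. {x})"
    by (rule absorbingD[OF assms(1) N' _ d']) (use y in auto)
  ultimately show "game m 1 (join x' y A' N) (\<lambda>_. {x'}) A' (\<lambda>_. {x'})"
    using game_trans game_sym[OF assms(2)] by metis
qed

text \<open>
  The rest \<open>B\<close> need not be in the class, so it cannot be absorbed directly. Let \<open>U'\<close> be a
  disjoint copy of \<open>U\<close>, joined to the root of the pendant copy \<open>A\<close>. Seen from \<open>U'\<close>, the whole
  of \<open>join x y A B\<close> is absorbed; seen from \<open>A\<close>, the graph \<open>U'\<close> is absorbed.
\<close>

lemma mso_equiv_pendant:
  assumes U: "U \<in> conn_members" "u \<in> pverts U" "absorbing m U u"
    and A: "game m 1 A (\<lambda>_. {x}) U (\<lambda>_. {u})" "wf_graph A" "x \<in> pverts A"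
    and B: "wf_graph B" "y \<in> pverts B" "pverts A \<inter> pverts B = {}"
    and J: "join x y A B \<in> conn_members"
  shows "mso_equiv m (join x y A B) U"
proof -
  note uD = conn_membersD[OF U(1)]
  have "finite (pverts (join x y A B))" using conn_membersD(5)[OF J] .
  then obtain f :: "nat \<Rightarrow> nat" where f: "inj f" "\<And>v. f v \<notin> pverts (join x y A B)"
    using shift_graph by blast
  have fU: "inj_on f (pverts U)" by (rule inj_on_subset[OF f(1) subset_UNIV])
  define U' where "U' = image_graph f U"
  have U': "U' \<in> conn_members" unfolding U'_def by (rule conn_members_image[OF U(1) fU])
  have gU: "game m 1 U (\<lambda>_. {u}) U' (\<lambda>_. {f u})"
    unfolding U'_def by (rule game_image_root[OF fU uD(4) U(2)])
  have fu: "f u \<in> pverts U'" using U(2) by (simp add: U'_def)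
  have dA: "pverts A \<inter> pverts U' = {}" and dB: "pverts B \<inter> pverts U' = {}"
    using f(2) by (auto simp: U'_def)
  have "absorbing m U' (f u)"
    by (rule absorbing_cong[OF U(3) game_sym[OF gU]]) (use uD U conn_membersD(4)[OF U'] fu in auto)
  then have "game m 1 (join (f u) x U' (join x y A B)) (\<lambda>_. {f u}) U' (\<lambda>_. {f u})"
    by (rule absorbingD[OF _ J]) (use A(3) dA dB in auto)
  then have 1: "mso_equiv m (join (f u) x U' (join x y A B)) U'" by (rule game_mso_equiv)
  have "absorbing m A x"
    by (rule absorbing_cong[OF U(3) A(1)]) (use uD U A in auto)
  then have "game m 1 (join x (f u) A U') (\<lambda>_. {x}) A (\<lambda>_. {x})"
    by (rule absorbingD[OF _ U' fu dA])
  from game_join(1)[OF this game_refl[of m 1 B "\<lambda>_. {y}"]]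
  have "game m 1 (join x y (join x (f u) A U') B) (\<lambda>_. {x}) (join x y A B) (\<lambda>_. {x})"
    using A B dA dB fu conn_membersD(4)[OF U'] by (force simp: wf_graph_def)
  moreover have "join x y (join x (f u) A U') B = join (f u) x U' (join x y A B)"
    by (intro pair_pre_digraph.equality) auto
  ultimately have 2: "mso_equiv m (join (f u) x U' (join x y A B)) (join x y A B)"
    by (auto intro: game_mso_equiv)
  have 3: "mso_equiv m U U'" using gU by (rule game_mso_equiv)
  show ?thesis using 1 2 3 mso_equiv_sym mso_equiv_trans by blast
qed

text \<open>Attach to one vertex \<open>x\<close> of some connected graph \<open>R\<close> copies of
  each rooted type, where \<open>R\<close> is the threshold for two slots. A newly attached graph is
  then one more piece of a type that is already frequent, and \<open>game_union_threshold\<close>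
  removes it. Joining all roots to \<open>x\<close> afterwards is a gluing and preserves the
  equivalence.\<close>

lemma exists_absorbing:
  assumes "conn_members \<noteq> {}"
  shows "\<exists>U\<in>conn_members. \<exists>u\<in>pverts U. absorbing m U u"
proof -
  obtain c :: "nat pair_pre_digraph \<Rightarrow> (nat \<Rightarrow> nat set) \<Rightarrow> nat" and M where
    c: "\<And>G s. c G s < M" "\<And>G s H t. game m 1 G s H t \<longleftrightarrow> c G s = c H t"
    using finitely_many_game_types[of m 1] by blast
  obtain R where R0: "\<forall>(G :: nat \<Rightarrow> nat pair_pre_digraph) I a s.
     finite I \<longrightarrow> a \<notin> I \<longrightarrow> (\<forall>i\<in>insert a I. wf_graph (G i)) \<longrightarrow>
     disjoint_family_on (\<lambda>i. pverts (G i)) (insert a I) \<longrightarrow>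
     R \<le> card {i \<in> I. game m 2 (G i) s (G a) s} \<longrightarrow>
     game m 2 (union_graph G (insert a I)) s (union_graph G I) s"
    using game_union_threshold[where ?'i = nat and ?'a = nat, of m 2] ..
  note R = R0[rule_format]
  define T where "T = {c H (\<lambda>_. {y}) | H y. H \<in> conn_members \<and> y \<in> pverts H}"
  have "finite T" by (rule finite_subset[of _ "{..<M}"]) (auto simp: T_def c(1))
  have "\<forall>t\<in>T. \<exists>H y. H \<in> conn_members \<and> y \<in> pverts H \<and> c H (\<lambda>_. {y}) = t"
    by (auto simp: T_def)
  then obtain Hs ys where Hs: "\<And>t. t \<in> T \<Longrightarrow> Hs t \<in> conn_members"
    "\<And>t. t \<in> T \<Longrightarrow> ys t \<in> pverts (Hs t)" "\<And>t. t \<in> T \<Longrightarrow> c (Hs t) (\<lambda>_. {ys t}) = t"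
    by metis
  \<comment> \<open>Index 0 is reserved for the centre \<open>K0\<close>, hence the successor.
    Tagging vertices by their index makes all copies disjoint.\<close>
  define ix where "ix t j = Suc (prod_encode (t, j))" for t j
  define I where "I = (\<lambda>(t, j). ix t j) ` (T \<times> {..<R})"
  define kind where "kind i = fst (prod_decode (i - 1))" for i
  define e where "e i v = prod_encode (i, v)" for i v
  have kind: "kind (ix t j) = t" for t j by (simp add: kind_def ix_def)
  have kindI: "kind i \<in> T" if "i \<in> I" for i using that by (auto simp: I_def kind)
  have "finite I" using \<open>finite T\<close> by (simp add: I_def)
  have "0 \<notin> I" by (auto simp: I_def ix_def)
  have inj_e: "inj (e i)" for i by (auto simp: e_def inj_def)
  have e_eq: "e i v = e j w \<longleftrightarrow> i = j \<and> v = w" for i j v w by (simp add: e_def)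
  obtain K where K: "K \<in> conn_members" using assms by auto
  obtain k where k: "k \<in> pverts K" using conn_membersD(6)[OF K] by auto
  define K0 where "K0 = image_graph (e 0) K"
  define x where "x = e 0 k"
  define B where "B i = image_graph (e i) (Hs (kind i))" for i
  define b where "b i = e i (ys (kind i))" for i
  have inj_on_e: "inj_on (e i) X" for i X using inj_e by (rule inj_on_subset) simp
  have K0: "K0 \<in> conn_members" unfolding K0_def by (rule conn_members_image[OF K inj_on_e])
  have x: "x \<in> pverts K0" using k by (simp add: K0_def x_def)
  have B: "B i \<in> conn_members" if "i \<in> I" for i
    unfolding B_def by (rule conn_members_image[OF Hs(1)[OF kindI[OF that]] inj_on_e])
  have b: "b i \<in> pverts (B i)" if "i \<in> I" for i
    using Hs(2)[OF kindI[OF that]] by (simp add: B_def b_def)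
  have dB: "pverts (B i) \<inter> pverts (B j) = {}" if "i \<noteq> j" for i j
    using that by (auto simp: B_def e_eq)
  have bB: "b j \<notin> pverts (B i)" if "i \<noteq> j" for i j
    using that by (auto simp: B_def b_def e_eq)
  have dK: "pverts K0 \<inter> pverts (B i) = {}" if "i \<in> I" for i
    using that \<open>0 \<notin> I\<close> by (auto simp: K0_def B_def e_eq)
  define U where "U J = \<lparr>pverts = pverts K0 \<union> pverts (union_graph B J),
     parcs = parcs K0 \<union> parcs (union_graph B J) \<union> {x} \<times> b ` J \<union> b ` J \<times> {x}\<rparr>" for J
  have U_sel [simp]: "pverts (U J) = pverts K0 \<union> pverts (union_graph B J)"
    "parcs (U J) = parcs K0 \<union> parcs (union_graph B J) \<union> {x} \<times> b ` J \<union> b ` J \<times> {x}" for J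
    by (simp_all add: U_def)
  \<comment> \<open>The star is built one bridge at a time, so bridge-addability keeps it in the
    class.\<close>
  have U: "U J \<in> conn_members" if "finite J" "J \<subseteq> I" for J
    using that
  proof (induction J)
    case empty
    have "U {} = K0" by (intro pair_pre_digraph.equality) auto
    with K0 show ?case by (simp only:)
  next
    case (insert j J)
    have "U (insert j J) = join x (b j) (U J) (B j)"
      by (intro pair_pre_digraph.equality) auto
    moreover have "pverts (U J) \<inter> pverts (B j) = {}"
    proof -
      have "pverts (B i) \<inter> pverts (B j) = {}" if "i \<in> J" for i
        by (rule dB) (use that insert.hyps(2) in auto)
      moreover have "pverts K0 \<inter> pverts (B j) = {}" using insert.prems dK by simp
      ultimately show ?thesis by auto
    qed
    moreover have "U J \<in> conn_members" "B j \<in> conn_members" "x \<in> pverts (U J)" "b j \<in> pverts (B j)"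
      using insert.IH insert.prems B b x by simp_all
    ultimately show ?case by (metis join_conn_members)
  qed
  have "absorbing m (U I) x"
    unfolding absorbing_def
  proof (intro ballI impI)
    fix N y assume N: "N \<in> conn_members" and y: "y \<in> pverts N" and disj: "pverts (U I) \<inter> pverts N = {}"
    obtain a where a: "a \<notin> I" using \<open>finite I\<close> ex_new_if_finite infinite_UNIV_nat by metis
    define B' where "B' = B(a := N)"
    define s :: "nat \<Rightarrow> nat set" where "s = (\<lambda>i. if i = 0 then {x} else insert y (b ` I))"
    have B'I: "B' i = B i" if "i \<in> I" for i using that a by (auto simp: B'_def)
    have UI: "union_graph B' I = union_graph B I"
      by (auto simp: union_graph_def B'I)
    have wf: "wf_graph (B' i)" if "i \<in> insert a I" for i
      using that B N conn_membersD(4) by (auto simp: B'_def)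
    have dfam: "disjoint_family_on (\<lambda>i. pverts (B' i)) (insert a I)"
      unfolding disjoint_family_on_def
    proof (intro ballI impI)
      fix i j assume ij: "i \<in> insert a I" "j \<in> insert a I" "i \<noteq> j"
      have "pverts (B i) \<inter> pverts N = {}" if "i \<in> I" for i using disj that by auto
      then show "pverts (B' i) \<inter> pverts (B' j) = {}" using ij dB[OF ij(3)] by (auto simp: B'_def)
    qed
    have xN: "x \<notin> pverts N" and bN: "b i \<notin> pverts N" if "i \<in> I" for i
      using disj x b[OF that] that by auto
    have xN: "x \<notin> pverts N" using disj x by auto
    have yB: "y \<notin> pverts (B i)" if "i \<in> I" for i using disj y that by auto
    have sB: "game m 2 (B i) (\<lambda>j. if j = 0 then {} else {b i}) (B i) s" if "i \<in> I" for i
    proof (rule game_restrict)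
      fix j :: nat
      have "x \<notin> pverts (B i)" using dK[OF that] x by auto
      moreover have "insert y (b ` I) \<inter> pverts (B i) = {b i}"
      proof -
        have "b j \<in> pverts (B i) \<longleftrightarrow> j = i" for j using bB[of i j] b[OF that] by blast
        then show ?thesis using yB[OF that] that by auto
      qed
      ultimately show "(if j = 0 then {} else {b i}) \<inter> pverts (B i) = s j \<inter> pverts (B i)"
        using b[OF that] by (auto simp: s_def)
    qed
    have sN: "game m 2 N (\<lambda>j. if j = 0 then {} else {y}) N s"
      by (rule game_restrict) (use xN bN y in \<open>auto simp: s_def\<close>)
    let ?t = "c N (\<lambda>_. {y})"
    have tT: "?t \<in> T" using N y by (auto simp: T_def)
    have "game m 2 (B' i) s (B' a) s" if i: "i \<in> ix ?t ` {..<R}" for i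
    proof -
      have iI: "i \<in> I" and ti: "kind i = ?t" using i tT by (auto simp: I_def kind)
      have "game m 1 (Hs ?t) (\<lambda>_. {ys ?t}) N (\<lambda>_. {y})" unfolding c(2) by (rule Hs(3)[OF tT])
      moreover have "game m 1 (Hs ?t) (\<lambda>_. {ys ?t}) (B i) (\<lambda>_. {b i})"
        unfolding B_def b_def ti
        by (rule game_image_root[OF inj_on_e conn_membersD(4)[OF Hs(1)[OF tT]] Hs(2)[OF tT]])
      ultimately have "game m 1 (B i) (\<lambda>_. {b i}) N (\<lambda>_. {y})" using game_trans game_sym by metis
      from game_subst[OF this, of 2 "\<lambda>j. j = 0" "\<lambda>_. 0"]
      have "game m 2 (B i) (\<lambda>j. if j = 0 then {} else {b i}) N (\<lambda>j. if j = 0 then {} else {y})"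
        by simp
      from game_trans[OF game_trans[OF game_sym[OF sB[OF iI]] this] sN]
      show ?thesis using B'I[OF iI] by (simp add: B'_def)
    qed
    then have "ix ?t ` {..<R} \<subseteq> {i \<in> I. game m 2 (B' i) s (B' a) s}"
      using tT by (auto simp: I_def)
    then have "card (ix ?t ` {..<R}) \<le> card {i \<in> I. game m 2 (B' i) s (B' a) s}"
      using \<open>finite I\<close> by (intro card_mono) auto
    moreover have "card (ix ?t ` {..<R}) = R"
      by (subst card_image) (auto simp: inj_on_def ix_def)
    ultimately have g: "game m 2 (union_graph B' (insert a I)) s (union_graph B' I) s"
      using \<open>finite I\<close> a wf dfam by (intro R) auto
    have wfU: "wf_graph (union_graph B' (insert a I))" "wf_graph (union_graph B' I)"
      using wf by (auto intro: wf_union_graph)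
    have dI: "pverts K0 \<inter> pverts (union_graph B' I) = {}" using dK by (auto simp: UI)
    then have da: "pverts K0 \<inter> pverts (union_graph B' (insert a I)) = {}"
      using disj by (auto simp: B'_def)
    have "game m 2 (glue {(0, 1)} s K0 (union_graph B' (insert a I))) s
        (glue {(0, 1)} s K0 (union_graph B' I)) s"
      by (rule game_glue[OF game_refl g conn_membersD(4)[OF K0] wfU(1)
            conn_membersD(4)[OF K0] wfU(2) da dI]) auto
    moreover have "glue {(0, 1)} s K0 (union_graph B' I) = U I"
    proof -
      have "s 0 \<inter> pverts K0 = {x}" using x by (auto simp: s_def)
      moreover have "s 1 \<inter> pverts (union_graph B' I) = b ` I"
        using b yB by (auto simp: s_def UI)
      ultimately show ?thesis by (intro pair_pre_digraph.equality) (simp_all add: UI Un_assoc)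
    qed
    moreover have "glue {(0, 1)} s K0 (union_graph B' (insert a I)) = join x y (U I) N"
    proof -
      have V: "pverts (union_graph B' (insert a I)) = pverts (union_graph B I) \<union> pverts N"
        "parcs (union_graph B' (insert a I)) = parcs (union_graph B I) \<union> parcs N"
        using B'I by (auto simp: B'_def)
      have "s 0 \<inter> pverts K0 = {x}" using x by (auto simp: s_def)
      moreover have "s 1 \<inter> (pverts (union_graph B I) \<union> pverts N) = insert y (b ` I)"
        using b y by (auto simp: s_def)
      ultimately show ?thesis
        by (intro pair_pre_digraph.equality) (simp_all add: V del: union_graph_sel, auto)
    qed
    ultimately have "game m 2 (join x y (U I) N) s (U I) s" by simp
    from game_subst[OF this, of 1 "\<lambda>_. False" "\<lambda>_. 0"]
    show "game m 1 (join x y (U I) N) (\<lambda>_. {x}) (U I) (\<lambda>_. {x})"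
      by (simp add: s_def)
  qed
  moreover have "U I \<in> conn_members" using U \<open>finite I\<close> by simp
  moreover have "x \<in> pverts (U I)" using x by simp
  ultimately show ?thesis by blast
qed

end

section \<open>Counting graphs of the class\<close>

lemma image_graph_inverse:
  assumes "inj_on f V" "wf_graph G" "pverts G \<subseteq> V"
  shows "image_graph (the_inv_into V f) (image_graph f G) = G"
  by (rule image_graph_comp[OF refl]) (use assms in \<open>auto simp: the_inv_into_f_f\<close>)

lemma inj_on_image_graph:
  assumes "inj_on f V"
  shows "inj_on (image_graph f) {G. wf_graph G \<and> pverts G \<subseteq> V}"
  by (rule inj_on_inverseI[of _ "image_graph (the_inv_into V f)"])
    (use image_graph_inverse[OF assms] in auto)

lemma sum_Pow_card:
  assumes "finite V"
  shows "(\<Sum>W\<in>Pow V. g (card W)) = (\<Sum>h\<le>card V. of_nat (card V choose h) * (g h :: real))"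
proof -
  have "(\<Sum>W\<in>Pow V. g (card W)) = (\<Sum>h\<le>card V. \<Sum>W\<in>{W \<in> Pow V. card W = h}. g (card W))"
    by (rule sum.group[symmetric]) (use assms in \<open>auto intro: card_mono\<close>)
  also have "\<dots> = (\<Sum>h\<le>card V. of_nat (card V choose h) * g h)"
  proof (rule sum.cong[OF refl])
    fix h
    have "(\<Sum>W\<in>{W \<in> Pow V. card W = h}. g (card W)) = (\<Sum>W\<in>{W \<in> Pow V. card W = h}. g h)"
      by (rule sum.cong) auto
    then show "(\<Sum>W\<in>{W \<in> Pow V. card W = h}. g (card W)) = of_nat (card V choose h) * g h"
      using n_subsets[OF assms, of h] by (simp add: Pow_def)
  qed
  finally show ?thesis .
qed

section \<open>Pairs of vertices in different components\<close>

lemma card_cross: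
  assumes "pair_graph G"
  shows "card (cross G) = (\<Sum>v\<in>pverts G. card (pverts G - comp G v))"
proof -
  have "cross G = Sigma (pverts G) (\<lambda>v. pverts G - comp G v)" by (auto simp: cross_def)
  then show ?thesis using pair_graphD(1)[OF assms] by simp
qed

lemma card_cross_ge:
  assumes "pair_graph G" "\<And>v. v \<in> pverts G \<Longrightarrow> k \<le> card (pverts G - comp G v)"
  shows "card (pverts G) * k \<le> card (cross G)"
  unfolding card_cross[OF assms(1)] using sum_mono[of "pverts G" "\<lambda>_. k"] assms(2) by simp

text \<open>A representative of every component other than that of \<open>v\<close> forms a crossing
  pair with \<open>v\<close>.\<close>

lemma card_cross_components:
  assumes G: "pair_graph G"
  shows "card (pverts G) * (card (graph_components G) - 1) \<le> card (cross G)"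
proof (rule card_cross_ge[OF G])
  fix v assume v: "v \<in> pverts G"
  define Z where "Z = induced G (comp G v)"
  have Z: "Z \<in> graph_components G" using v by (auto simp: graph_components_eq[OF G] Z_def)
  define r where "r H = (SOME w. w \<in> pverts H)" for H :: "'a pair_pre_digraph"
  have r: "r H \<in> pverts H" if "H \<in> graph_components G" for H
    unfolding r_def by (rule someI_ex) (use pair_graph_component(4)[OF G that] in auto)
  have "inj_on r (graph_components G - {Z})"
  proof (rule inj_onI)
    fix H K assume "H \<in> graph_components G - {Z}" "K \<in> graph_components G - {Z}" "r H = r K"
    then show "H = K" using r components_disjoint[OF G, of H K] by force
  qed
  moreover have "r ` (graph_components G - {Z}) \<subseteq> pverts G - comp G v"
  proof
    fix w assume "w \<in> r ` (graph_components G - {Z})"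
    then obtain H where H: "H \<in> graph_components G" "H \<noteq> Z" "w = r H" by auto
    have "w \<notin> pverts Z" using components_disjoint[OF G H(1) Z] H r by auto
    then show "w \<in> pverts G - comp G v"
      using r[OF H(1)] pair_graph_component(3)[OF G H(1)] H(3) by (auto simp: Z_def)
  qed
  ultimately have "card (graph_components G - {Z}) \<le> card (pverts G - comp G v)"
    using pair_graphD(1)[OF G] by (intro card_inj_on_le) auto
  then show "card (graph_components G) - 1 \<le> card (pverts G - comp G v)"
    using Z by (simp add: card_Diff_singleton)
qed

text \<open>Every vertex lies outside at least one of the two large components and forms crossing
  pairs with all of its vertices.\<close>

lemma card_cross_two_large:
  assumes G: "pair_graph G" and "H \<in> graph_components G" "K \<in> graph_components G" "H \<noteq> K"
    and "L < card (pverts H)" "L < card (pverts K)"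
  shows "card (pverts G) * L \<le> card (cross G)"
proof (rule card_cross_ge[OF G])
  fix v assume v: "v \<in> pverts G"
  define Z where "Z = induced G (comp G v)"
  have Z: "Z \<in> graph_components G" using v by (auto simp: graph_components_eq[OF G] Z_def)
  obtain M where M: "M \<in> graph_components G" "M \<noteq> Z" "L < card (pverts M)"
    using assms by metis
  then have "pverts M \<subseteq> pverts G - comp G v"
    using components_disjoint[OF G M(1) Z] pair_graph_component(3)[OF G M(1)] by (auto simp: Z_def)
  then have "card (pverts M) \<le> card (pverts G - comp G v)"
    using pair_graphD(1)[OF G] by (intro card_mono) auto
  then show "L \<le> card (pverts G - comp G v)" using M(3) by simp
qed

text \<open>Every vertex has at least half of the vertices outside its component; the quotient
  \<open>(card (pverts G) + 1) div 2\<close> is that half rounded up.\<close>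

lemma card_cross_no_large:
  assumes G: "pair_graph G" and small: "\<And>v. v \<in> pverts G \<Longrightarrow> 2 * card (comp G v) \<le> card (pverts G)"
  shows "card (pverts G) * card (pverts G) \<le> 2 * card (cross G)"
proof -
  have "card (pverts G) * ((card (pverts G) + 1) div 2) \<le> card (cross G)"
  proof (rule card_cross_ge[OF G])
    fix v assume v: "v \<in> pverts G"
    have "card (pverts G - comp G v) = card (pverts G) - card (comp G v)"
      using comp_subset[OF pair_graphD(2)[OF G] v] pair_graphD(1)[OF G]
      by (intro card_Diff_subset) (auto dest: finite_subset)
    then show "(card (pverts G) + 1) div 2 \<le> card (pverts G - comp G v)"
      using small[OF v] by linarith
  qed
  moreover have "card (pverts G) * card (pverts G) \<le> 2 * (card (pverts G) * ((card (pverts G) + 1) div 2))"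
  proof -
    have "card (pverts G) \<le> 2 * ((card (pverts G) + 1) div 2)" by linarith
    then have "card (pverts G) * card (pverts G) \<le> card (pverts G) * (2 * ((card (pverts G) + 1) div 2))"
      by (rule mult_left_mono) simp
    then show ?thesis by (simp add: mult.left_commute)
  qed
  ultimately show ?thesis by linarith
qed

definition count_in :: "'a pair_pre_digraph set \<Rightarrow> 'a pair_pre_digraph \<Rightarrow> nat" where
  "count_in F G = card {H \<in> graph_components G. H \<in> F}"

lemma count_in_le: "pair_graph G \<Longrightarrow> count_in F G \<le> card (graph_components G)"
  unfolding count_in_def by (intro card_mono finite_graph_components) auto

lemma count_in_gunion:
  assumes "pair_graph H" "conn_graph H" "H \<in> F" "pair_graph G" "pverts H \<inter> pverts G = {}"
  shows "count_in F (gunion H G) = Suc (count_in F G)"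
proof -
  have "H \<notin> graph_components G"
    using pair_graph_component(3,4)[OF assms(4), of H] assms(5) by blast
  moreover have "{K \<in> graph_components (gunion H G). K \<in> F} = insert H {K \<in> graph_components G. K \<in> F}"
    using assms by (auto simp: graph_components_gunion graph_components_conn)
  ultimately show ?thesis
    unfolding count_in_def using finite_graph_components[OF assms(4)] by simp
qed

section \<open>Averages over the graphs on a given vertex set\<close>

context addable_class
begin

definition on :: "nat set \<Rightarrow> nat pair_pre_digraph set" where
  "on V = {G \<in> C. pverts G = V}"

abbreviation cnt :: "nat \<Rightarrow> nat" where
  "cnt n \<equiv> card (graphs_on C n)"

lemma graphs_on_eq: "graphs_on C n = on {1..n}"
  by (auto simp: graphs_on_def on_def)

lemma onD:
  assumes "G \<in> on V"
  shows "G \<in> C" "pair_graph G" "wf_graph G" "pverts G = V"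
  using assms pair_graph_class pair_graphD(2) by (auto simp: on_def)

lemma finite_on: "finite V \<Longrightarrow> finite (on V)"
proof -
  assume V: "finite V"
  have "on V \<subseteq> (\<lambda>E. \<lparr>pverts = V, parcs = E\<rparr>) ` Pow (V \<times> V)"
  proof
    fix G assume G: "G \<in> on V"
    then have "parcs G \<subseteq> V \<times> V" using onD[OF G] by (auto simp: wf_graph_def)
    moreover have "G = \<lparr>pverts = V, parcs = parcs G\<rparr>" using onD[OF G] by simp
    ultimately show "G \<in> (\<lambda>E. \<lparr>pverts = V, parcs = E\<rparr>) ` Pow (V \<times> V)" by blast
  qed
  then show ?thesis by (rule finite_subset) (use V in auto)
qed

lemma finite_graphs_on [simp]: "finite (graphs_on C n)"
  by (simp add: graphs_on_eq finite_on)

lemma image_on: "bij_betw f V W \<Longrightarrow> G \<in> on V \<Longrightarrow> image_graph f G \<in> on W"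
  using class_image[OF graph_class, of G f] by (auto simp: on_def bij_betw_def)

lemma bij_betw_on:
  assumes "bij_betw f V W"
  shows "bij_betw (image_graph f) (on V) (on W)"
proof -
  have f: "inj_on f V" "W = f ` V" using assms by (auto simp: bij_betw_def)
  have g: "bij_betw (the_inv_into V f) W V" by (rule bij_betw_the_inv_into[OF assms])
  show ?thesis
  proof (rule bij_betw_byWitness[where f' = "image_graph (the_inv_into V f)"])
    show "\<forall>G\<in>on V. image_graph (the_inv_into V f) (image_graph f G) = G"
      using image_graph_inverse[OF f(1)] onD by auto
    show "\<forall>G\<in>on W. image_graph f (image_graph (the_inv_into V f) G) = G"
      using onD by (auto intro!: image_graph_comp[OF refl] simp: f(2) the_inv_into_f_f[OF f(1)])
    show "image_graph f ` on V \<subseteq> on W" using image_on[OF assms] by auto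
    show "image_graph (the_inv_into V f) ` on W \<subseteq> on V" using image_on[OF g] by auto
  qed
qed

lemma sum_relabel:
  assumes "finite V"
    and inv: "\<And>G f. G \<in> C \<Longrightarrow> inj_on f (pverts G) \<Longrightarrow> \<phi> (image_graph f G) = \<phi> G"
  shows "sum \<phi> (on V) = sum \<phi> (graphs_on C (card V))"
proof -
  obtain f where f: "bij_betw f {1..card V} V"
    using ex_bij_betw_nat_finite_1[OF assms(1)] by blast
  have "sum \<phi> (on V) = (\<Sum>G\<in>on {1..card V}. \<phi> (image_graph f G))"
    by (rule sum.reindex_bij_betw[OF bij_betw_on[OF f], symmetric])
  also have "\<dots> = sum \<phi> (on {1..card V})"
    using f onD by (intro sum.cong inv) (auto simp: bij_betw_def)
  finally show ?thesis by (simp add: graphs_on_eq)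
qed

text \<open>Switching: adding the edge of a crossing pair stays in the class and turns the pair into
  an oriented bridge. Deleting that bridge recovers the graph, and a graph on \<open>n\<close>
  vertices has at most \<open>2 * n\<close> oriented bridges.\<close>

lemma sum_card_cross: "(\<Sum>G\<in>graphs_on C n. card (cross G)) \<le> 2 * n * cnt n"
proof -
  let ?D = "graphs_on C n"
  define \<Phi> where "\<Phi> = (\<lambda>(G :: nat pair_pre_digraph, (u, v)). (add_edge u v G, (u, v)))"
  have D: "G \<in> C" "pverts G = {1..n}" "pair_graph G" if "G \<in> ?D" for G
    using that pair_graph_class by (auto simp: graphs_on_def)
  have finC: "finite (cross G)" if "G \<in> ?D" for G using finite_cross[OF D(3)[OF that]] .
  have finB: "finite (bridges (parcs G))" if "G \<in> ?D" for G
    by (rule finite_subset[of _ "{1..n} \<times> {1..n}"])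
      (use D[OF that] in \<open>auto simp: bridges_def pair_graph_iff wf_graph_def\<close>)
  have "(\<Sum>G\<in>?D. card (cross G)) = card (Sigma ?D cross)"
    using finC by (simp add: card_SigmaI)
  also have "\<dots> \<le> card (Sigma ?D (\<lambda>G. bridges (parcs G)))"
  proof (rule card_inj_on_le)
    show "inj_on \<Phi> (Sigma ?D cross)"
    proof (rule inj_onI)
      fix p q assume pq: "p \<in> Sigma ?D cross" "q \<in> Sigma ?D cross" "\<Phi> p = \<Phi> q"
      obtain G u v where p: "p = (G, (u, v))" by (cases p) auto
      obtain G' where q: "q = (G', (u, v))" using pq(3) p by (cases q) (auto simp: \<Phi>_def)
      have GG: "G \<in> ?D" "(u, v) \<in> cross G" "G' \<in> ?D" "(u, v) \<in> cross G'"
        "add_edge u v G = add_edge u v G'"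
        using pq unfolding p q \<Phi>_def by simp_all
      have "parcs G = parcs G'"
        unfolding bridges_add_edge(2)[OF D(3)[OF GG(1)] GG(2)]
          bridges_add_edge(2)[OF D(3)[OF GG(3)] GG(4)] GG(5) ..
      then show "p = q" using p q pq(1,2) D(2) by auto
    qed
    show "\<Phi> ` Sigma ?D cross \<subseteq> Sigma ?D (\<lambda>G. bridges (parcs G))"
      using bridge_addable_cross[OF graph_class bridge_addable] bridges_add_edge(1)[OF D(3)]
      by (auto simp: \<Phi>_def graphs_on_def simp del: add_edge_sel(2))
    show "finite (Sigma ?D (\<lambda>G. bridges (parcs G)))" using finB by auto
  qed
  also have "\<dots> = (\<Sum>G\<in>?D. card (bridges (parcs G)))" using finB by (simp add: card_SigmaI)
  also have "\<dots> \<le> (\<Sum>G\<in>?D. 2 * n)"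
  proof (rule sum_mono)
    fix G assume G: "G \<in> ?D"
    show "card (bridges (parcs G)) \<le> 2 * n"
      using card_bridges_le[of "{1..n}" "parcs G"] D(2,3)[OF G]
      by (auto simp: pair_graph_iff wf_graph_def)
  qed
  finally show ?thesis by (simp add: mult.commute)
qed

text \<open>Markov's inequality for the number of crossing pairs, whose mean is at most
  \<open>2 * n\<close>. The factor \<open>l\<close> keeps a bound by half of the pairs within the
  natural numbers.\<close>

lemma card_cross_markov:
  assumes "\<And>G. G \<in> graphs_on C n \<Longrightarrow> P G \<Longrightarrow> n * k \<le> l * card (cross G)" "0 < n"
  shows "card {G \<in> graphs_on C n. P G} * k \<le> 2 * l * cnt n"
proof -
  have "n * (card {G \<in> graphs_on C n. P G} * k) = (\<Sum>G\<in>{G \<in> graphs_on C n. P G}. n * k)" by simp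
  also have "\<dots> \<le> (\<Sum>G\<in>{G \<in> graphs_on C n. P G}. l * card (cross G))"
    by (rule sum_mono) (use assms(1) in auto)
  also have "\<dots> \<le> (\<Sum>G\<in>graphs_on C n. l * card (cross G))"
    by (rule sum_mono2) auto
  also have "\<dots> = l * (\<Sum>G\<in>graphs_on C n. card (cross G))" by (simp add: sum_distrib_left)
  also have "\<dots> \<le> l * (2 * n * cnt n)" by (rule mult_left_mono[OF sum_card_cross]) simp
  also have "\<dots> = n * (2 * l * cnt n)" by simp
  finally show ?thesis using assms(2) by simp
qed

text \<open>Of the constant 3, 2 bounds the mean excess over one component and 1 pays for that
  component.\<close>

lemma sum_components:
  assumes "0 < n"
  shows "(\<Sum>G\<in>graphs_on C n. card (graph_components G)) \<le> 3 * cnt n"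
proof -
  have D: "pverts G = {1..n}" "pair_graph G" if "G \<in> graphs_on C n" for G
    using that pair_graph_class by (auto simp: graphs_on_def)
  have "n * (\<Sum>G\<in>graphs_on C n. card (graph_components G) - 1) \<le> (\<Sum>G\<in>graphs_on C n. card (cross G))"
    unfolding sum_distrib_left using card_cross_components D by (intro sum_mono) fastforce
  also have "\<dots> \<le> n * (2 * cnt n)" using sum_card_cross[of n] by simp
  finally have "(\<Sum>G\<in>graphs_on C n. card (graph_components G) - 1) \<le> 2 * cnt n"
    using assms by simp
  moreover have "(\<Sum>G\<in>graphs_on C n. card (graph_components G)) \<le>
      (\<Sum>G\<in>graphs_on C n. (card (graph_components G) - 1) + 1)"
    by (rule sum_mono) simp
  moreover have "\<dots> = (\<Sum>G\<in>graphs_on C n. card (graph_components G) - 1) + cnt n"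
    unfolding sum.distrib by simp
  ultimately show ?thesis by linarith
qed

lemma two_large_components_rare:
  assumes "0 < n"
  shows "card {G \<in> graphs_on C n. \<exists>H\<in>graph_components G. \<exists>K\<in>graph_components G.
      H \<noteq> K \<and> L < card (pverts H) \<and> L < card (pverts K)} * L \<le> 2 * cnt n"
proof -
  have "card {G \<in> graphs_on C n. \<exists>H\<in>graph_components G. \<exists>K\<in>graph_components G.
      H \<noteq> K \<and> L < card (pverts H) \<and> L < card (pverts K)} * L \<le> 2 * 1 * cnt n"
  proof (rule card_cross_markov[OF _ assms])
    fix G assume G: "G \<in> graphs_on C n"
      and "\<exists>H\<in>graph_components G. \<exists>K\<in>graph_components G.
        H \<noteq> K \<and> L < card (pverts H) \<and> L < card (pverts K)"
    moreover have "pair_graph G" "card (pverts G) = n"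
      using G pair_graph_class by (auto simp: graphs_on_def)
    ultimately show "n * L \<le> 1 * card (cross G)" using card_cross_two_large[of G _ _ L] by auto
  qed
  then show ?thesis by simp
qed

lemma no_large_component_rare:
  assumes "0 < n"
  shows "card {G \<in> graphs_on C n. \<forall>v\<in>pverts G. 2 * card (comp G v) \<le> n} * n \<le> 4 * cnt n"
proof -
  have "card {G \<in> graphs_on C n. \<forall>v\<in>pverts G. 2 * card (comp G v) \<le> n} * n \<le> 2 * 2 * cnt n"
  proof (rule card_cross_markov[OF _ assms])
    fix G assume G: "G \<in> graphs_on C n" and s: "\<forall>v\<in>pverts G. 2 * card (comp G v) \<le> n"
    have "pair_graph G" "card (pverts G) = n"
      using G pair_graph_class by (auto simp: graphs_on_def)
    then show "n * n \<le> 2 * card (cross G)" using card_cross_no_large[of G] s by auto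
  qed
  then show ?thesis by simp
qed

definition iso_closed :: "nat pair_pre_digraph set \<Rightarrow> bool" where
  "iso_closed F \<longleftrightarrow> (\<forall>H\<in>F. \<forall>f. inj_on f (pverts H) \<longrightarrow> image_graph f H \<in> F)"

lemma count_in_image:
  assumes F: "iso_closed F" and G: "pair_graph G" and f: "inj_on f (pverts G)"
  shows "count_in F (image_graph f G) = count_in F G"
proof -
  have sub: "wf_graph H" "pverts H \<subseteq> pverts G" if "H \<in> graph_components G" for H
    using pair_graph_component[OF G that] by (auto simp: pair_graph_iff)
  have F_iff: "image_graph f H \<in> F \<longleftrightarrow> H \<in> F" if H: "H \<in> graph_components G" for H
  proof
    assume "image_graph f H \<in> F"
    moreover have "inj_on (the_inv_into (pverts G) f) (pverts (image_graph f H))"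
      using inj_on_the_inv_into[OF f] sub[OF H] by (auto intro: inj_on_subset)
    ultimately have "image_graph (the_inv_into (pverts G) f) (image_graph f H) \<in> F"
      using F unfolding iso_closed_def by blast
    then show "H \<in> F" using image_graph_inverse[OF f sub[OF H]] by simp
  next
    assume "H \<in> F"
    then show "image_graph f H \<in> F"
      using F inj_on_subset[OF f sub(2)[OF H]] unfolding iso_closed_def by blast
  qed
  have "{K \<in> graph_components (image_graph f G). K \<in> F} = image_graph f ` {H \<in> graph_components G. H \<in> F}"
    using F_iff by (auto simp: graph_components_image[OF G f])
  moreover have "inj_on (image_graph f) {H \<in> graph_components G. H \<in> F}"
    by (rule inj_on_subset[OF inj_on_image_graph[OF f]]) (use sub in auto)
  ultimately show ?thesis unfolding count_in_def by (simp add: card_image)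
qed

lemma card_relabel:
  assumes "finite V"
    and inv: "\<And>G f. G \<in> C \<Longrightarrow> inj_on f (pverts G) \<Longrightarrow> P (image_graph f G) = P G"
  shows "card {G \<in> on V. P G} = card {G \<in> graphs_on C (card V). P G}"
proof -
  have "card {G \<in> S. P G} = (\<Sum>G\<in>S. if P G then 1 else 0)" if "finite S" for S
    using that by (simp add: sum.If_cases Int_def)
  then show ?thesis
    using sum_relabel[OF assms(1), of "\<lambda>G. if P G then 1 else (0::nat)"] inv finite_on[OF assms(1)] by simp
qed

lemma iso_closed_iff:
  assumes F: "iso_closed F" and G: "G \<in> C" and f: "inj_on f (pverts G)"
  shows "image_graph f G \<in> F \<longleftrightarrow> G \<in> F"
proof
  assume "image_graph f G \<in> F"
  moreover have "inj_on (the_inv_into (pverts G) f) (pverts (image_graph f G))"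
    using inj_on_the_inv_into[OF f] by simp
  ultimately have "image_graph (the_inv_into (pverts G) f) (image_graph f G) \<in> F"
    using F unfolding iso_closed_def by blast
  then show "G \<in> F" using image_graph_inverse[OF f pair_graphD(2)[OF pair_graph_class[OF G]]] by simp
next
  assume "G \<in> F"
  then show "image_graph f G \<in> F" using F f unfolding iso_closed_def by blast
qed

text \<open>Double counting of the pairs of a graph and one of its components in \<open>F\<close>.\<close>

lemma sum_remove_component:
  fixes w :: "nat \<Rightarrow> real"
  assumes F: "iso_closed F" "F \<subseteq> conn_members"
  shows "(\<Sum>G\<in>graphs_on C n. count_in F G * w (count_in F G - 1)) =
    (\<Sum>h\<le>n. (n choose h) * (card {H \<in> graphs_on C h. H \<in> F} *
       (\<Sum>G\<in>graphs_on C (n - h). w (count_in F G))))"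
proof -
  let ?V = "{1..n}"
  define FW where "FW W = {H \<in> on W. H \<in> F}" for W
  have F': "H \<in> C" "conn_graph H" "pair_graph H" "pverts H \<noteq> {}" if "H \<in> F" for H
    using that F(2) conn_membersD by blast+
  have "(\<Sum>G\<in>on ?V. count_in F G * w (count_in F G - 1)) =
      (\<Sum>G\<in>on ?V. \<Sum>H\<in>{H \<in> graph_components G. H \<in> F}. w (count_in F G - 1))"
    by (simp add: count_in_def)
  also have "\<dots> = (\<Sum>(G, H)\<in>Sigma (on ?V) (\<lambda>G. {H \<in> graph_components G. H \<in> F}). w (count_in F G - 1))"
    by (rule sum.Sigma) (use finite_graph_components[OF onD(2)] in \<open>auto simp: finite_on\<close>)
  \<comment> \<open>Splitting off \<open>H\<close> and reuniting are inverse to each other.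
    Decomposability is used in both directions: the remainder and the reunion both lie in the class.
    The remainder has one component in \<open>F\<close> fewer, which explains the argument
    \<open>count_in F G - 1\<close>.\<close>
  also have "\<dots> = (\<Sum>(W, (H, G'))\<in>Sigma (Pow ?V) (\<lambda>W. FW W \<times> on (?V - W)). w (count_in F G'))"
  proof (rule sum.reindex_bij_witness[where
        i = "\<lambda>(W, (H, G')). (gunion H G', H)" and
        j = "\<lambda>(G, H). (pverts H, (H, induced G (?V - pverts H)))"])
    fix p assume "p \<in> Sigma (on ?V) (\<lambda>G. {H \<in> graph_components G. H \<in> F})"
    then obtain G H where p: "p = (G, H)" and G: "G \<in> on ?V" and H: "H \<in> graph_components G" "H \<in> F"
      by auto
    note pg = onD[OF G]
    have HV: "pverts H \<subseteq> ?V" using pair_graph_component(3)[OF pg(2) H(1)] pg(4) by simp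
    have split: "gunion H (induced G (?V - pverts H)) = G"
      using component_split[OF pg(2) H(1)] pg(4) by simp
    have pi: "pair_graph (induced G (?V - pverts H))"
      by (rule pair_graph_induced[OF pg(2)]) (use pg(4) in auto)
    have "induced G (?V - pverts H) \<in> C"
      using decomposable_gunion[OF graph_class decomposable F'(3)[OF H(2)] pi] split pg(1) by auto
    then show "(case p of (G, H) \<Rightarrow> (pverts H, (H, induced G (?V - pverts H)))) \<in>
        Sigma (Pow ?V) (\<lambda>W. FW W \<times> on (?V - W))"
      using HV F'[OF H(2)] H(2) by (auto simp: p FW_def on_def)
    show "(case case p of (G, H) \<Rightarrow> (pverts H, (H, induced G (?V - pverts H))) of
        (W, (H, G')) \<Rightarrow> (gunion H G', H)) = p"
      by (simp only: p prod.case split)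
    have "count_in F G = Suc (count_in F (induced G (?V - pverts H)))"
      using count_in_gunion[OF F'(3,2)[OF H(2)] H(2) pi] split by auto
    then show "(case case p of (G, H) \<Rightarrow> (pverts H, (H, induced G (?V - pverts H))) of
        (W, (H, G')) \<Rightarrow> w (count_in F G')) = (case p of (G, H) \<Rightarrow> w (count_in F G - 1))"
      by (simp add: p)
  next
    fix q assume "q \<in> Sigma (Pow ?V) (\<lambda>W. FW W \<times> on (?V - W))"
    then obtain W H G' where q: "q = (W, (H, G'))" and W: "W \<subseteq> ?V" and H: "H \<in> on W" "H \<in> F"
      and G': "G' \<in> on (?V - W)"
      by (auto simp: FW_def)
    note h = onD[OF H(1)] and g = onD[OF G']
    have disj: "pverts H \<inter> pverts G' = {}" using h(4) g(4) by auto
    have "gunion H G' \<in> C"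
      using decomposable_gunion[OF graph_class decomposable h(2) g(2) disj] h(1) g(1) by simp
    moreover have "pverts (gunion H G') = ?V" using W h(4) g(4) by auto
    moreover have "H \<in> graph_components (gunion H G')"
      using graph_components_gunion[OF h(2) g(2) disj] graph_components_conn[OF h(2) F'(2)[OF H(2)]] by simp
    ultimately show "(case q of (W, (H, G')) \<Rightarrow> (gunion H G', H)) \<in>
        Sigma (on ?V) (\<lambda>G. {H \<in> graph_components G. H \<in> F})"
      using H by (auto simp: q on_def)
    have "induced (gunion H G') (?V - W) = G'"
      using h g by (intro pair_pre_digraph.equality) (auto simp: wf_graph_def)
    then show "(case case q of (W, (H, G')) \<Rightarrow> (gunion H G', H) of
        (G, H) \<Rightarrow> (pverts H, (H, induced G (?V - pverts H)))) = q"
      by (simp add: q h(4))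
  qed
  also have "\<dots> = (\<Sum>W\<in>Pow ?V. \<Sum>(H, G')\<in>FW W \<times> on (?V - W). w (count_in F G'))"
  proof (rule sum.Sigma[symmetric])
    show "\<forall>W\<in>Pow ?V. finite (FW W \<times> on (?V - W))"
    proof
      fix W assume "W \<in> Pow ?V"
      then have "finite W" by (auto intro: finite_subset)
      then show "finite (FW W \<times> on (?V - W))" by (simp add: FW_def finite_on)
    qed
  qed simp
  also have "\<dots> = (\<Sum>W\<in>Pow ?V. card {H \<in> graphs_on C (card W). H \<in> F} *
      (\<Sum>G\<in>graphs_on C (n - card W). w (count_in F G)))"
  proof (rule sum.cong[OF refl])
    fix W assume W: "W \<in> Pow ?V"
    then have fW: "finite W" by (auto intro: finite_subset)
    have "card (?V - W) = n - card W" using W fW by (auto simp: card_Diff_subset)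
    moreover have "sum (\<lambda>G. w (count_in F G)) (on (?V - W)) =
        sum (\<lambda>G. w (count_in F G)) (graphs_on C (card (?V - W)))"
      by (rule sum_relabel) (auto simp: count_in_image[OF F(1) pair_graph_class])
    moreover have "card (FW W) = card {H \<in> graphs_on C (card W). H \<in> F}"
      unfolding FW_def by (rule card_relabel[OF fW iso_closed_iff[OF F(1)]])
    ultimately show "(\<Sum>(H, G')\<in>FW W \<times> on (?V - W). w (count_in F G')) =
        card {H \<in> graphs_on C (card W). H \<in> F} * (\<Sum>G\<in>graphs_on C (n - card W). w (count_in F G))"
      by (simp add: sum.cartesian_product[symmetric])
  qed
  also have "\<dots> = (\<Sum>h\<le>n. (n choose h) * (card {H \<in> graphs_on C h. H \<in> F} *
       (\<Sum>G\<in>graphs_on C (n - h). w (count_in F G))))"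
    using sum_Pow_card[of ?V "\<lambda>h. card {H \<in> graphs_on C h. H \<in> F} *
      (\<Sum>G\<in>graphs_on C (n - h). w (count_in F G))"] by simp
  finally show ?thesis by (simp add: graphs_on_eq)
qed

end

section \<open>Pendant copies\<close>

definition pendant :: "'b pair_pre_digraph \<Rightarrow> 'b \<Rightarrow> 'a pair_pre_digraph \<Rightarrow> 'a set \<Rightarrow> 'a \<Rightarrow> 'a \<Rightarrow> bool" where
  "pendant U u G W x v \<longleftrightarrow> W \<subseteq> pverts G \<and> v \<in> pverts G - W \<and> (x, v) \<in> parcs G \<and>
     (\<forall>a\<in>W. \<forall>b\<in>pverts G - W. (a, b) \<in> parcs G \<longrightarrow> a = x \<and> b = v) \<and>
     (\<exists>f. inj_on f (pverts U) \<and> induced G W = image_graph f U \<and> f u = x)"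

section \<open>Overlaps of pendant copies\<close>

locale rooted_pattern =
  fixes U :: "'b pair_pre_digraph" and u :: 'b
  assumes U: "pair_graph U" "conn_graph U" and u: "u \<in> pverts U"
begin

abbreviation "pend \<equiv> pendant U u"

lemma pendD:
  assumes "pend G W x v"
  shows "W \<subseteq> pverts G" "v \<in> pverts G" "v \<notin> W" "(x, v) \<in> parcs G" "x \<in> W"
    "card W = card (pverts U)"
    "\<And>a b. a \<in> W \<Longrightarrow> b \<in> pverts G \<Longrightarrow> b \<notin> W \<Longrightarrow> (a, b) \<in> parcs G \<Longrightarrow> a = x \<and> b = v"
proof -
  obtain f where f: "inj_on f (pverts U)" "induced G W = image_graph f U" "f u = x"
    using assms by (auto simp: pendant_def)
  from f(2) have "pverts (induced G W) = pverts (image_graph f U)" by (rule arg_cong)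
  then have W: "W = f ` pverts U" by simp
  show "x \<in> W" using W f(3) u by auto
  show "card W = card (pverts U)" using W f(1) by (simp add: card_image)
qed (use assms in \<open>auto simp: pendant_def\<close>)

lemma pend_conn:
  assumes "pair_graph G" "pend G W x v" "a \<in> W" "b \<in> W"
  shows "(a, b) \<in> (parcs G \<inter> W \<times> W)\<^sup>*"
proof -
  obtain f where f: "inj_on f (pverts U)" "induced G W = image_graph f U"
    using assms by (auto simp: pendant_def)
  have pg: "pair_graph (induced G W)" by (rule pair_graph_induced[OF assms(1) pendD(1)[OF assms(2)]])
  have "conn_graph (induced G W)" unfolding f(2) by (rule conn_graph_image[OF U(1) f(1) U(2)])
  then show ?thesis using assms(3,4) by (simp add: conn_graph_iff[OF pg])
qed

text \<open>\<open>W\<close> is connected and contains vertices inside and outside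
  \<open>W'\<close>, so some edge within \<open>W\<close> leaves \<open>W'\<close>. The only such
  edge is the attachment edge of \<open>W'\<close>.\<close>

lemma pend_exit:
  assumes G: "pair_graph G" and W: "pend G W x v" "pend G W' x' v'"
    and c: "c \<in> W" "c \<in> W'" and "\<not> W \<subseteq> W'"
  shows "x' \<in> W" "v' \<in> W"
proof -
  obtain d where d: "d \<in> W" "d \<notin> W'" using assms(6) by auto
  have "(c, d) \<in> (parcs G \<inter> W \<times> W)\<^sup>*" by (rule pend_conn[OF G W(1) c(1) d(1)])
  then have "\<not> (parcs G \<inter> W \<times> W) `` W' \<subseteq> W'"
    using rtrancl_closed[of c d "parcs G \<inter> W \<times> W" W'] c(2) d(2) by auto
  then obtain a b where ab: "(a, b) \<in> parcs G" "a \<in> W" "b \<in> W" "a \<in> W'" "b \<notin> W'" by auto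
  then have "a = x' \<and> b = v'" using pendD(7)[OF W(2), of a b] pendD(1)[OF W(1)] by auto
  then show "x' \<in> W" "v' \<in> W" using ab by auto
qed

text \<open>Attachment edges identify pendant copies, so copies can be counted by counting edges. If
  one copy were not contained in the other, \<open>pend_exit\<close> would put \<open>v\<close> into
  it.\<close>

lemma pend_unique:
  assumes G: "pair_graph G" and W: "pend G W x v" "pend G W' x v"
  shows "W = W'"
proof -
  have "W \<subseteq> W'" if "pend G W x v" "pend G W' x v" for W W'
    using pend_exit(2)[OF G that] pendD(3,5)[OF that(1)] pendD(5)[OF that(2)] by blast
  then show ?thesis using W by blast
qed

text \<open>A walk from \<open>v\<close> that enters \<open>W\<close> can leave it only at
  \<open>v\<close> and may be restarted there.\<close>

lemma pend_delete_reach: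
  assumes G: "pair_graph G" and W: "pend G W x v" and w: "w \<in> comp G v"
  shows "w \<in> W \<or> w \<in> comp (induced G (pverts G - W)) v"
proof -
  let ?G = "induced G (pverts G - W)"
  have vG: "v \<in> pverts ?G" using pendD(2,3)[OF W] by simp
  have pg: "pair_graph ?G" by (rule pair_graph_induced[OF G]) auto
  have "(v, w) \<in> (parcs G)\<^sup>*" using w by (simp add: comp_def)
  then show ?thesis
  proof induction
    case base then show ?case by (simp add: comp_self)
  next
    case (step w z)
    have z: "z \<in> pverts G" using step.hyps(2) G by (auto simp: pair_graph_iff wf_graph_def)
    show ?case
    proof (cases "z \<in> W")
      case False
      show ?thesis
      proof (cases "w \<in> W")
        case True
        then have "z = v" using pendD(7)[OF W True z False step.hyps(2)] by simp
        then show ?thesis by (simp add: comp_self)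
      next
        case wW: False
        then have wc: "w \<in> comp ?G v" using step.IH by simp
        then have "w \<in> pverts ?G" using comp_subset[OF pair_graphD(2)[OF pg] vG] by auto
        then have "(w, z) \<in> parcs ?G" using step.hyps(2) z False by simp
        then show ?thesis using wc comp_closed[of ?G v] by blast
      qed
    qed simp
  qed
qed

definition good_comp :: "'a pair_pre_digraph \<Rightarrow> 'a \<Rightarrow> bool" where
  "good_comp G z \<longleftrightarrow> (\<exists>W x v. pend G W x v \<and> v \<in> comp G z)"

text \<open>These are the copies that a switching step may have just attached to a bad component.
  The condition after deletion is what keeps their number bounded even when the graph has many
  pendant copies.\<close>

definition removable :: "'a pair_pre_digraph \<Rightarrow> 'a set \<Rightarrow> bool" where
  "removable G W \<longleftrightarrow> (\<exists>x v. pend G W x v \<and> card (pverts G) < 2 * card (comp G v) \<and>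
     \<not> good_comp (induced G (pverts G - W)) v)"

text \<open>Two components with more than half of the vertices coincide. If \<open>W'\<close> is
  disjoint from \<open>W\<close> and not attached to it, it survives the deletion of
  \<open>W\<close> in the component of \<open>v\<close>, which is excluded. If it is attached to
  \<open>W\<close>, its edge is that of \<open>W\<close> reversed; if it overlaps \<open>W\<close>,
  its edge lies inside \<open>W\<close> by \<open>pend_exit\<close>.\<close>

lemma removable_exit:
  assumes G: "pair_graph G"
    and W: "pend G W x v" "card (pverts G) < 2 * card (comp G v)" "\<not> good_comp (induced G (pverts G - W)) v"
    and W': "pend G W' x' v'" "card (pverts G) < 2 * card (comp G v')" "W' \<noteq> W"
  shows "(x', v') \<in> insert (v, x) (W \<times> W)"
proof (cases "W \<inter> W' = {}")
  case False
  then obtain c where c: "c \<in> W" "c \<in> W'" by auto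
  have "finite W'" using pendD(1)[OF W'(1)] pair_graphD(1)[OF G] by (rule finite_subset)
  then have "\<not> W \<subseteq> W'"
    using W'(3) card_subset_eq[of W' W] pendD(6)[OF W(1)] pendD(6)[OF W'(1)] by auto
  then show ?thesis using pend_exit[OF G W(1) W'(1) c] by auto
next
  case disj: True
  show ?thesis
  proof (cases "v' \<in> W")
    case True
    have "(v', x') \<in> parcs G" using pendD(4)[OF W'(1)] pair_graphD(3)[OF G] by (auto simp: sym_def)
    moreover have "x' \<in> pverts G" "x' \<notin> W" using pendD(1,5)[OF W'(1)] disj by auto
    ultimately have "v' = x \<and> x' = v" using pendD(7)[OF W(1) True] by blast
    then show ?thesis by simp
  next
    case False
    let ?G = "induced G (pverts G - W)"
    have "induced ?G W' = induced G W'"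
      using disj pendD(1)[OF W'(1)] by (intro pair_pre_digraph.equality) auto
    then have p: "pend ?G W' x' v'"
      using W'(1) disj False pendD(5)[OF W'(1)] unfolding pendant_def by auto
    have fin: "finite (pverts G)" using pair_graphD(1)[OF G] .
    have sub: "comp G v \<subseteq> pverts G" "comp G v' \<subseteq> pverts G"
      using comp_subset[OF pair_graphD(2)[OF G]] pendD(2)[OF W(1)] pendD(2)[OF W'(1)] by auto
    have "comp G v \<inter> comp G v' \<noteq> {}"
    proof
      assume "comp G v \<inter> comp G v' = {}"
      then have "card (comp G v) + card (comp G v') = card (comp G v \<union> comp G v')"
        using sub fin by (metis card_Un_disjoint finite_subset)
      also have "\<dots> \<le> card (pverts G)" using sub fin by (intro card_mono) auto
      finally show False using W(2) W'(2) by linarith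
    qed
    then obtain c where "c \<in> comp G v" "c \<in> comp G v'" by auto
    then have "comp G v = comp G v'" using comp_eq[OF pair_graphD(3)[OF G]] by metis
    then have "v' \<in> comp G v" using comp_self[of v' G] by simp
    then have "v' \<in> comp ?G v" using pend_delete_reach[OF G W(1)] False by blast
    then show ?thesis using W(3) p unfolding good_comp_def by blast
  qed
qed

text \<open>Fix one removable copy \<open>W\<close>. It accounts for 1, the reversed attachment edge
  for another 1, and the pairs inside \<open>W\<close> for the square.\<close>

lemma card_removable:
  assumes G: "pair_graph G"
  shows "card {W. removable G W} \<le> card (pverts U) * card (pverts U) + 2"
proof (cases "{W. removable G W} = {}")
  case False
  then obtain W x v where W: "pend G W x v" "card (pverts G) < 2 * card (comp G v)"
    "\<not> good_comp (induced G (pverts G - W)) v"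
    by (auto simp: removable_def)
  have fW: "finite W" using pendD(1)[OF W(1)] pair_graphD(1)[OF G] by (rule finite_subset)
  have "\<exists>e. \<forall>W'. removable G W' \<longrightarrow> pend G W' (fst (e W')) (snd (e W')) \<and>
      card (pverts G) < 2 * card (comp G (snd (e W')))"
    unfolding removable_def
    by (intro choice allI) (metis fst_conv snd_conv)
  then obtain e where e: "\<And>W'. removable G W' \<Longrightarrow> pend G W' (fst (e W')) (snd (e W'))"
    "\<And>W'. removable G W' \<Longrightarrow> card (pverts G) < 2 * card (comp G (snd (e W')))"
    by blast
  have "inj_on e ({W. removable G W} - {W})"
  proof (rule inj_onI)
    fix W1 W2 assume "W1 \<in> {W. removable G W} - {W}" "W2 \<in> {W. removable G W} - {W}" "e W1 = e W2"
    then show "W1 = W2" using pend_unique[OF G e(1)[of W1]] e(1)[of W2] by auto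
  qed
  moreover have "e ` ({W. removable G W} - {W}) \<subseteq> insert (v, x) (W \<times> W)"
  proof
    fix p assume "p \<in> e ` ({W. removable G W} - {W})"
    then obtain W' where W': "removable G W'" "W' \<noteq> W" "p = e W'" by auto
    show "p \<in> insert (v, x) (W \<times> W)"
      using removable_exit[OF G W e(1)[OF W'(1)] e(2)[OF W'(1)] W'(2)] W'(3) by simp
  qed
  ultimately have "card ({W. removable G W} - {W}) \<le> card (insert (v, x) (W \<times> W))"
    using fW by (intro card_inj_on_le) auto
  also have "\<dots> \<le> Suc (card (W \<times> W))" by (rule card_insert_le_m1[THEN order_trans]) auto
  also have "card (W \<times> W) = card (pverts U) * card (pverts U)"
    using pendD(6)[OF W(1)] by (simp add: card_cartesian_product)
  finally have "card ({W. removable G W} - {W}) \<le> Suc (card (pverts U) * card (pverts U))" .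
  moreover have "card {W. removable G W} \<le> Suc (card ({W. removable G W} - {W}))"
    by (simp add: card_Diff_singleton_if) linarith
  ultimately show ?thesis by simp
qed simp

lemma pend_image:
  assumes G: "pair_graph G" and f: "inj_on f (pverts G)" and W: "pend G W x v"
  shows "pend (image_graph f G) (f ` W) (f x) (f v)"
proof -
  note p = pendD[OF W]
  have m: "f a \<in> f ` W \<longleftrightarrow> a \<in> W" if "a \<in> pverts G" for a
    using inj_on_image_mem_iff[OF f that p(1)] .
  obtain g where g: "inj_on g (pverts U)" "induced G W = image_graph g U" "g u = x"
    using W by (auto simp: pendant_def)
  from g(2) have "pverts (induced G W) = pverts (image_graph g U)" by (rule arg_cong)
  then have gW: "W = g ` pverts U" by simp
  have "inj_on (f \<circ> g) (pverts U)"
    using g(1) inj_on_subset[OF f p(1)] gW by (auto intro: comp_inj_on)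
  moreover have "induced (image_graph f G) (f ` W) = image_graph (f \<circ> g) U"
    unfolding induced_image[OF G f p(1)] g(2)
    by (auto simp: image_graph_def image_comp map_prod_compose)
  moreover have ex: "a = f x \<and> b = f v"
    if ab: "a \<in> f ` W" "b \<in> f ` pverts G" "b \<notin> f ` W" "(a, b) \<in> parcs (image_graph f G)" for a b
  proof -
    obtain a' b' where ab': "a = f a'" "b = f b'" "(a', b') \<in> parcs G" using ab(4) by auto
    then have V: "a' \<in> pverts G" "b' \<in> pverts G" using G by (auto simp: pair_graph_iff wf_graph_def)
    have "a' \<in> W" "b' \<notin> W" using ab(1,3) m[OF V(1)] m[OF V(2)] by (simp_all add: ab')
    then show ?thesis using p(7)[OF _ V(2) _ ab'(3)] ab'(1,2) by simp
  qed
  moreover have "f v \<notin> f ` W" using m[OF p(2)] p(3) by simp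
  ultimately show ?thesis
    unfolding pendant_def
  proof (intro conjI exI[of _ "f \<circ> g"] ballI impI)
    show "f ` W \<subseteq> pverts (image_graph f G)" using p(1) by auto
    show "(f x, f v) \<in> parcs (image_graph f G)" using p(4) by force
    show "(f \<circ> g) u = f x" using g(3) by simp
    fix a b assume "a \<in> f ` W" "b \<in> pverts (image_graph f G) - f ` W" "(a, b) \<in> parcs (image_graph f G)"
    then show "a = f x" "b = f v" using ex[of a b] by auto
  qed (use p(2) in auto)
qed

lemma good_comp_image:
  assumes G: "pair_graph G" and f: "inj_on f (pverts G)" and z: "z \<in> pverts G"
  shows "good_comp (image_graph f G) (f z) \<longleftrightarrow> good_comp G z"
proof
  assume "good_comp G z"
  then obtain W x v where "pend G W x v" "v \<in> comp G z" by (auto simp: good_comp_def)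
  then show "good_comp (image_graph f G) (f z)"
    using pend_image[OF G f] comp_image[OF G f z] unfolding good_comp_def by blast
next
  assume "good_comp (image_graph f G) (f z)"
  then obtain W x v where W: "pend (image_graph f G) W x v" "v \<in> f ` comp G z"
    using comp_image[OF G f z] by (auto simp: good_comp_def)
  let ?g = "the_inv_into (pverts G) f"
  have g: "inj_on ?g (pverts (image_graph f G))" using inj_on_the_inv_into[OF f] by simp
  have "pend (image_graph ?g (image_graph f G)) (?g ` W) (?g x) (?g v)"
    by (rule pend_image[OF pair_graph_image[OF G f] g W(1)])
  moreover have "image_graph ?g (image_graph f G) = G"
    by (rule image_graph_inverse[OF f pair_graphD(2)[OF G]]) simp
  moreover have "?g v \<in> comp G z"
    using W(2) comp_subset[OF pair_graphD(2)[OF G] z] by (auto simp: the_inv_into_f_f[OF f])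
  ultimately show "good_comp G z" unfolding good_comp_def by auto
qed

definition bad :: "'a pair_pre_digraph \<Rightarrow> bool" where
  "bad G \<longleftrightarrow> (\<exists>z\<in>pverts G. card (pverts G) < 2 * card (comp G z) \<and> \<not> good_comp G z)"

lemma bad_image:
  assumes G: "pair_graph G" and f: "inj_on f (pverts G)"
  shows "bad (image_graph f G) = bad G"
proof -
  have "card (comp (image_graph f G) (f z)) = card (comp G z)" if "z \<in> pverts G" for z
    using comp_image[OF G f that] comp_subset[OF pair_graphD(2)[OF G] that]
    by (simp add: card_image inj_on_subset[OF f])
  then show ?thesis
    unfolding bad_def using good_comp_image[OF G f] by (auto simp: card_image[OF f])
qed

end

section \<open>Switching away bad graphs\<close>

context addable_class
begin

lemma join_in_class:
  assumes A: "A \<in> C" and B: "B \<in> C"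
    and disj: "pverts A \<inter> pverts B = {}" and xy: "x \<in> pverts A" "y \<in> pverts B"
  shows "join x y A B \<in> C"
proof -
  note a = pair_graph_class[OF A] and b = pair_graph_class[OF B]
  have "gunion A B \<in> C"
    using decomposable_gunion[OF graph_class decomposable a b disj] A B by simp
  moreover have "(x, y) \<in> cross (gunion A B)"
    using xy disj comp_gunion(1)[OF pair_graphD(2)[OF a] pair_graphD(2)[OF b] disj xy(1)]
      comp_subset[OF pair_graphD(2)[OF a] xy(1)]
    by (auto simp: cross_def)
  ultimately show ?thesis
    unfolding join_def by (rule bridge_addable_cross[OF graph_class bridge_addable])
qed

end

lemma comp_join:
  assumes A: "pair_graph A" "conn_graph A" and B: "pair_graph B" and xy: "x \<in> pverts A" "y \<in> pverts B"
  shows "pverts A \<union> comp B y \<subseteq> comp (join x y A B) y"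
proof -
  have "(parcs A)\<^sup>* \<subseteq> (parcs (join x y A B))\<^sup>*" "(parcs B)\<^sup>* \<subseteq> (parcs (join x y A B))\<^sup>*"
    by (rule rtrancl_mono; force)+
  moreover have "(y, x) \<in> parcs (join x y A B)" by simp
  moreover have "(x, w) \<in> (parcs A)\<^sup>*" if "w \<in> pverts A" for w
    using A xy that by (simp add: conn_graph_iff)
  ultimately show ?thesis
    unfolding comp_def by (blast intro: converse_rtrancl_into_rtrancl)
qed

locale addable_pattern = addable_class C + rooted_pattern U u
  for C and U :: "nat pair_pre_digraph" and u +
  assumes UC: "U \<in> C"
begin

text \<open>
  Attaching copies of \<open>U\<close> to a bad component: no graph arises in many ways,
  because one removal already leaves a component without pendant copies.
\<close>

lemma bad_switching:
  fixes n :: nat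
  defines "h \<equiv> card (pverts U)"
  shows "((n + h) choose h) * (card {G \<in> graphs_on C n. bad G} * n)
    \<le> 2 * (h * h + 2) * cnt (n + h)"
proof -
  define N where "N = n + h"
  let ?V = "{1..N}"
  have finU: "finite (pverts U)" and wfU: "wf_graph U" using U by (auto simp: pair_graph_iff)
  define Ws where "Ws = {W. W \<subseteq> ?V \<and> card W = h}"
  have finWs: "finite Ws" by (auto simp: Ws_def)
  \<comment> \<open>One fixed labelling of the copy of \<open>U\<close> for each \<open>W\<close>:
    the attached copy is then determined by \<open>W\<close>, as injectivity of \<Phi>
    requires.\<close>
  define \<sigma> where "\<sigma> W = (SOME f. bij_betw f (pverts U) W)" for W :: "nat set"
  have \<sigma>: "inj_on (\<sigma> W) (pverts U)" "\<sigma> W ` pverts U = W" if "W \<in> Ws" for W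
  proof -
    have "finite W" using that by (auto simp: Ws_def intro: finite_subset)
    then have "\<exists>f. bij_betw f (pverts U) W"
      using that finU by (intro finite_same_card_bij) (auto simp: Ws_def h_def)
    then have "bij_betw (\<sigma> W) (pverts U) W" unfolding \<sigma>_def by (rule someI_ex)
    then show "inj_on (\<sigma> W) (pverts U)" "\<sigma> W ` pverts U = W" by (auto simp: bij_betw_def)
  qed
  \<comment> \<open>The possible attachment vertices. They include a whole bad component, hence more
    than half of the vertices of a bad graph; this is the origin of the factors \<open>n\<close> and
    2 in the bound.\<close>
  define D where "D G = {v \<in> pverts G. card (pverts G) < 2 * card (comp G v) \<and> \<not> good_comp G v}"
    for G :: "nat pair_pre_digraph"
  define Bad where "Bad W = {G \<in> on (?V - W). bad G}" for W
  define T where "T = Sigma Ws (\<lambda>W. Sigma (Bad W) D)"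
  define \<Phi> where "\<Phi> = (\<lambda>(W, G, v). (join (\<sigma> W u) v (image_graph (\<sigma> W) U) G, W))"
  have finBad: "finite (Bad W)" for W unfolding Bad_def using finite_on by simp
  have finD: "finite (D G)" if "G \<in> Bad W" for G W
  proof -
    have "G \<in> on (?V - W)" using that by (simp add: Bad_def)
    then have "finite (pverts G)" by (rule pair_graphD(1)[OF onD(2)])
    then show ?thesis by (simp add: D_def)
  qed
  have cardV: "card (?V - W) = n" if "W \<in> Ws" for W
    using that by (auto simp: Ws_def N_def card_Diff_subset finite_subset[of W ?V])
  have D_large: "n \<le> 2 * card (D G)" if W: "W \<in> Ws" and G: "G \<in> Bad W" for W G
  proof -
    have pg: "pair_graph G" "card (pverts G) = n"
      using G onD cardV[OF W] by (auto simp: Bad_def)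
    obtain z where z: "z \<in> pverts G" "n < 2 * card (comp G z)" "\<not> good_comp G z"
      using G pg by (auto simp: Bad_def bad_def)
    have "comp G z \<subseteq> D G"
    proof
      fix w assume w: "w \<in> comp G z"
      then have "comp G w = comp G z" by (rule comp_eq[OF pair_graphD(3)[OF pg(1)]])
      then show "w \<in> D G"
        using z w comp_subset[OF pair_graphD(2)[OF pg(1)] z(1)] pg(2) by (auto simp: D_def good_comp_def)
    qed
    then have "card (comp G z) \<le> card (D G)" using finD[OF G] by (intro card_mono)
    then show ?thesis using z(2) by linarith
  qed
  \<comment> \<open>Removability bounds the number of sets \<open>W\<close> per resulting graph. The
    last two facts recover \<open>G\<close> and \<open>v\<close> from the graph and
    \<open>W\<close>.\<close>
  have \<Phi>: "join (\<sigma> W u) v (image_graph (\<sigma> W) U) G \<in> on ?V \<and>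
      removable (join (\<sigma> W u) v (image_graph (\<sigma> W) U) G) W \<and>
      induced (join (\<sigma> W u) v (image_graph (\<sigma> W) U) G) (?V - W) = G \<and>
      (\<forall>v'. (\<sigma> W u, v') \<in> parcs (join (\<sigma> W u) v (image_graph (\<sigma> W) U) G) \<and> v' \<in> ?V - W \<longrightarrow> v' = v)"
    if W: "W \<in> Ws" and G: "G \<in> Bad W" and v: "v \<in> D G" for W G v
  proof -
    define A where "A = image_graph (\<sigma> W) U"
    define x where "x = \<sigma> W u"
    let ?J = "join x v A G"
    have A: "A \<in> C" "pair_graph A" "conn_graph A" "pverts A = W" "x \<in> pverts A"
      unfolding A_def x_def using class_image[OF graph_class UC \<sigma>(1)[OF W]]
        pair_graph_image[OF U(1) \<sigma>(1)[OF W]] conn_graph_image[OF U(1) \<sigma>(1)[OF W] U(2)] \<sigma>(2)[OF W] u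
      by auto
    have G': "G \<in> C" "pair_graph G" "pverts G = ?V - W" using G onD by (auto simp: Bad_def)
    have wfs: "parcs A \<subseteq> W \<times> W" "parcs G \<subseteq> (?V - W) \<times> (?V - W)"
      using A(2,4) G'(2,3) by (auto simp: pair_graph_iff wf_graph_def)
    have v': "v \<in> pverts G" "n < 2 * card (comp G v)" "\<not> good_comp G v"
      using v G'(3) cardV[OF W] by (auto simp: D_def)
    have WV: "W \<subseteq> ?V" "card W = h" using W by (auto simp: Ws_def)
    have J: "?J \<in> C" by (rule join_in_class[OF A(1) G'(1) _ A(5) v'(1)]) (use A(4) G'(3) in auto)
    have VJ: "pverts ?J = ?V" using A(4) G'(3) WV by auto
    have iA: "induced ?J W = A"
      using wfs A(4,5) v'(1) G'(3) by (intro pair_pre_digraph.equality) auto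
    have iG: "induced ?J (?V - W) = G"
      using wfs A(4,5) v'(1) G'(3) by (intro pair_pre_digraph.equality) auto
    have ex: "a = x \<and> b = v" if "a \<in> W" "b \<in> ?V - W" "(a, b) \<in> parcs ?J" for a b
      using that wfs A(4,5) v'(1) G'(3) by auto
    have "pend ?J W x v"
      unfolding pendant_def VJ iA
    proof (intro conjI exI[of _ "\<sigma> W"] ballI impI)
      show "W \<subseteq> ?V" by (rule WV(1))
      show "v \<in> ?V - W" using v'(1) G'(3) by simp
      show "(x, v) \<in> parcs ?J" by simp
      show "inj_on (\<sigma> W) (pverts U)" by (rule \<sigma>(1)[OF W])
      show "A = image_graph (\<sigma> W) U" "\<sigma> W u = x" by (simp_all add: A_def x_def)
    qed (use ex in blast)+
    \<comment> \<open>Both the graph and the component grow by \<open>h\<close> vertices, so the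
      component still has more than half of them.\<close>
    moreover have "card ?V < 2 * card (comp ?J v)"
    proof -
      have pJ: "pair_graph ?J" using J by (rule pair_graph_class)
      have "comp ?J v \<subseteq> ?V" using comp_subset[OF pair_graphD(2)[OF pJ], of v] v'(1) VJ by auto
      then have "card (W \<union> comp G v) \<le> card (comp ?J v)"
        using comp_join[OF A(2,3) G'(2) A(5) v'(1)] A(4) by (intro card_mono) (auto intro: finite_subset)
      moreover have "card (W \<union> comp G v) = h + card (comp G v)"
      proof -
        have "comp G v \<subseteq> ?V - W" using comp_subset[OF pair_graphD(2)[OF G'(2)] v'(1)] G'(3) by simp
        then show ?thesis
          using WV by (subst card_Un_disjoint) (auto intro: finite_subset)
      qed
      ultimately show ?thesis using v'(2) by (simp add: N_def)
    qed
    ultimately have "removable ?J W"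
      unfolding removable_def VJ using iG v'(3) by auto
    moreover have "\<forall>v'. (x, v') \<in> parcs ?J \<and> v' \<in> ?V - W \<longrightarrow> v' = v"
      using ex A(4,5) by blast
    moreover have "?J \<in> on ?V" using J VJ unfolding on_def by simp
    ultimately show ?thesis
      using iG unfolding A_def x_def by (intro conjI)
  qed
  have "inj_on \<Phi> T"
  proof (rule inj_onI)
    fix p q assume pq: "p \<in> T" "q \<in> T" "\<Phi> p = \<Phi> q"
    obtain W G v where p: "p = (W, G, v)" by (cases p)
    obtain G' v' where q: "q = (W, G', v')" using pq(3) p by (cases q) (auto simp: \<Phi>_def)
    have 1: "W \<in> Ws" "G \<in> Bad W" "v \<in> D G" "G' \<in> Bad W" "v' \<in> D G'"
      using pq p q by (auto simp: T_def)
    have e: "join (\<sigma> W u) v (image_graph (\<sigma> W) U) G = join (\<sigma> W u) v' (image_graph (\<sigma> W) U) G'"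
      using pq(3) by (simp add: p q \<Phi>_def)
    note a = \<Phi>[OF 1(1-3)] and b = \<Phi>[OF 1(1,4,5)]
    have "G = G'" using a b e by metis
    moreover have "v' \<in> ?V - W" using 1(4,5) onD(4) by (auto simp: D_def Bad_def)
    then have "v' = v" using a e by auto
    ultimately show "p = q" using p q by simp
  qed
  moreover have "\<Phi> ` T \<subseteq> Sigma (on ?V) (\<lambda>G. {W. removable G W})"
    using \<Phi> by (auto simp: T_def \<Phi>_def)
  moreover have finR: "finite {W. removable G W}" if "G \<in> on ?V" for G
  proof (rule finite_subset)
    show "{W. removable G W} \<subseteq> Pow ?V" using pendD(1) onD(4)[OF that] by (fastforce simp: removable_def)
  qed simp
  ultimately have "card T \<le> card (Sigma (on ?V) (\<lambda>G. {W. removable G W}))"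
    using finite_on by (intro card_inj_on_le[of \<Phi>]) auto
  also have "\<dots> = (\<Sum>G\<in>on ?V. card {W. removable G W})"
    using finR finite_on by (simp add: card_SigmaI)
  also have "\<dots> \<le> (\<Sum>G\<in>on ?V. h * h + 2)"
    unfolding h_def using card_removable onD(2) by (intro sum_mono) auto
  also have "\<dots> = (h * h + 2) * cnt N" by (simp add: graphs_on_eq)
  finally have upper: "card T \<le> (h * h + 2) * cnt N" .
  have "((n + h) choose h) * (card {G \<in> graphs_on C n. bad G} * n) =
      (\<Sum>W\<in>Ws. card (Bad W) * n)"
  proof -
    have "card (Bad W) = card {G \<in> graphs_on C n. bad G}" if W: "W \<in> Ws" for W
      unfolding Bad_def using card_relabel[of "?V - W" bad] bad_image pair_graph_class cardV[OF W] by auto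
    then show ?thesis using n_subsets[of ?V h] by (simp add: Ws_def N_def)
  qed
  also have "\<dots> \<le> (\<Sum>W\<in>Ws. 2 * card (Sigma (Bad W) D))"
  proof (rule sum_mono)
    fix W assume W: "W \<in> Ws"
    have "card (Bad W) * n = (\<Sum>G\<in>Bad W. n)" by simp
    also have "\<dots> \<le> (\<Sum>G\<in>Bad W. 2 * card (D G))" by (intro sum_mono D_large[OF W])
    also have "\<dots> = 2 * card (Sigma (Bad W) D)"
      using finBad finD by (simp add: card_SigmaI sum_distrib_left)
    finally show "card (Bad W) * n \<le> 2 * card (Sigma (Bad W) D)" .
  qed
  also have "\<dots> = 2 * card T"
  proof -
    have "finite (Sigma (Bad W) D)" for W by (rule finite_SigmaI) (use finBad finD in auto)
    then show ?thesis unfolding T_def using finWs by (simp add: card_SigmaI sum_distrib_left)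
  qed
  also have "\<dots> \<le> 2 * ((h * h + 2) * cnt N)" using upper by simp
  finally show ?thesis by (simp add: N_def)
qed

end

section \<open>Limits\<close>

text \<open>A sequence that convergent sequences approximate arbitrarily well is Cauchy. The limits
  of the approximations need not be compared with each other.\<close>

lemma convergent_approx:
  fixes q :: "nat \<Rightarrow> real"
  assumes "\<And>e. 0 < e \<Longrightarrow> \<exists>y. convergent y \<and> (\<forall>\<^sub>F n in sequentially. \<bar>q n - y n\<bar> \<le> e)"
  shows "convergent q"
proof (rule real_Cauchy_convergent, rule CauchyI)
  fix e :: real assume "0 < e"
  then obtain y where y: "convergent y" "\<forall>\<^sub>F n in sequentially. \<bar>q n - y n\<bar> \<le> e / 4"
    using assms[of "e / 4"] by auto
  obtain N1 where N1: "\<And>n. n \<ge> N1 \<Longrightarrow> \<bar>q n - y n\<bar> \<le> e / 4"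
    using y(2) by (auto simp: eventually_sequentially)
  have "Cauchy y" using y(1) by (rule convergent_Cauchy)
  then obtain N2 where N2: "\<And>a b. a \<ge> N2 \<Longrightarrow> b \<ge> N2 \<Longrightarrow> norm (y a - y b) < e / 4"
    using CauchyD[of y "e / 4"] \<open>0 < e\<close> by (auto simp: less_imp_le)
  have "norm (q a - q b) < e" if ab: "a \<ge> max N1 N2" "b \<ge> max N1 N2" for a b
  proof -
    have "\<bar>q a - y a\<bar> \<le> e / 4" "\<bar>q b - y b\<bar> \<le> e / 4" "\<bar>y a - y b\<bar> < e / 4"
      using N1[of a] N1[of b] N2[of a b] ab by auto
    then show ?thesis using \<open>0 < e\<close> by (simp add: abs_if split: if_splits)
  qed
  then show "\<exists>M. \<forall>a\<ge>M. \<forall>b\<ge>M. norm (q a - q b) < e" by blast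
qed

lemma alternating_binomial_sum:
  "(\<Sum>j\<le>J. (- 1) ^ j * real (Suc y choose j)) = (- 1) ^ J * real (y choose J)"
  by (induction J) (auto simp: algebra_simps)

text \<open>For positive \<open>x\<close> the truncated alternating sum telescopes by Pascal's rule
  to a single binomial coefficient of \<open>x - 1\<close>, which Pascal's rule also bounds.\<close>

lemma bonferroni_zero:
  "\<bar>(if x = 0 then 1 else 0) - (\<Sum>j\<le>J. (- 1) ^ j * real (x choose j))\<bar> \<le> real (x choose Suc J)"
proof (cases x)
  case 0
  have "(\<Sum>j\<le>J. (- 1) ^ j * real (0 choose j)) = (\<Sum>j\<in>{0}. (- 1) ^ j * real (0 choose j))"
    by (rule sum.mono_neutral_right) auto
  then show ?thesis using 0 by simp
next
  case (Suc y)
  show ?thesis unfolding Suc alternating_binomial_sum by (simp add: abs_mult power_abs)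
qed

lemma exponential_tail:
  fixes \<mu> :: real
  assumes "0 < e"
  obtains J where "\<mu> ^ J / fact J < e" "0 < J"
proof -
  have "(\<lambda>J. inverse (fact J) * \<mu> ^ J) \<longlonglongrightarrow> 0"
    using summable_exp[of \<mu>] by (rule summable_LIMSEQ_zero)
  then have "\<forall>\<^sub>F J in sequentially. inverse (fact J) * \<mu> ^ J < e"
    using assms by (rule order_tendstoD)
  then have "\<forall>\<^sub>F J in sequentially. inverse (fact J) * \<mu> ^ J < e \<and> 0 < J"
    using eventually_gt_at_top[of "0::nat"] by (rule eventually_conj)
  then obtain J where "inverse (fact J) * \<mu> ^ J < e" "0 < J"
    using eventually_happens'[OF sequentially_bot] by blast
  then show thesis using that by (simp add: field_simps)
qed

section \<open>Consequences of smoothness\<close>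

locale smooth_class = addable_class +
  fixes \<gamma> :: real
  assumes nonempty: "\<forall>\<^sub>F n in sequentially. graphs_on C n \<noteq> {}"
    and ratio: "(\<lambda>n. real (cnt n) / (real n * real (cnt (n - 1)))) \<longlonglongrightarrow> \<gamma>"
begin

lemma eventually_cnt_pos: "\<forall>\<^sub>F n in sequentially. 0 < cnt n"
  using nonempty by eventually_elim (simp add: card_gt_0_iff)

lemma eventually_cnt_pos_shift: "\<forall>\<^sub>F n in sequentially. 0 < cnt (n - h)"
  using eventually_cnt_pos filterlim_minus_const_nat_at_top[of h]
  unfolding filterlim_iff by blast

text \<open>The quotient is a product of \<open>h\<close> consecutive smoothness quotients, since
  \<open>fact h * (n choose h)\<close> is the falling factorial. Cancelling needs the intermediate
  counts to be positive, which holds eventually.\<close>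

lemma ratio_power:
  "(\<lambda>n. real (cnt n) / (fact h * real (n choose h) * real (cnt (n - h)))) \<longlonglongrightarrow> \<gamma> ^ h"
proof (induction h)
  case 0
  have "\<forall>\<^sub>F n in sequentially. real (cnt n) / (fact 0 * real (n choose 0) * real (cnt (n - 0))) = 1"
    using eventually_cnt_pos by eventually_elim (auto simp: card_gt_0_iff)
  then show ?case by (simp add: tendsto_eventually)
next
  case (Suc h)
  have "(\<lambda>n. real (cnt (n - h)) / (real (n - h) * real (cnt (n - h - 1)))) \<longlonglongrightarrow> \<gamma>"
    using filterlim_compose[OF ratio filterlim_minus_const_nat_at_top[of h]] .
  then have lim: "(\<lambda>n. real (cnt n) / (fact h * real (n choose h) * real (cnt (n - h))) *
      (real (cnt (n - h)) / (real (n - h) * real (cnt (n - h - 1))))) \<longlonglongrightarrow> \<gamma> ^ h * \<gamma>"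
    using Suc by (intro tendsto_mult)
  have "\<forall>\<^sub>F n in sequentially. real (cnt n) / (fact h * real (n choose h) * real (cnt (n - h))) *
      (real (cnt (n - h)) / (real (n - h) * real (cnt (n - h - 1)))) =
      real (cnt n) / (fact (Suc h) * real (n choose Suc h) * real (cnt (n - Suc h)))"
    using eventually_cnt_pos_shift[of h]
  proof eventually_elim
    fix n assume "0 < cnt (n - h)"
    moreover have "Suc h * (n choose Suc h) = (n choose h) * (n - h)"
      using binomial_absorb_comp[of n h] binomial_absorption[of h n]
      by (cases "h \<le> n") (auto simp: choose_mult mult.commute binomial_eq_0)
    then have "real (Suc h) * real (n choose Suc h) = real (n choose h) * real (n - h)"
      by (metis of_nat_mult)
    then have "fact (Suc h) * real (n choose Suc h) = fact h * real (n choose h) * real (n - h)"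
      unfolding fact_Suc by (simp add: mult.assoc mult.left_commute)
    ultimately show "real (cnt n) / (fact h * real (n choose h) * real (cnt (n - h))) *
      (real (cnt (n - h)) / (real (n - h) * real (cnt (n - h - 1)))) =
      real (cnt n) / (fact (Suc h) * real (n choose Suc h) * real (cnt (n - Suc h)))"
      by (auto simp: card_gt_0_iff)
  qed
  then show ?case using lim by (simp add: tendsto_cong mult.commute)
qed

lemma conn_members_nonempty: "conn_members \<noteq> {}"
proof -
  have "\<forall>\<^sub>F n in sequentially. graphs_on C n \<noteq> {} \<and> 0 < n"
    using nonempty eventually_gt_at_top[of "0::nat"] by (rule eventually_conj)
  then obtain n where "graphs_on C n \<noteq> {}" "0 < n" using eventually_happens'[OF sequentially_bot] by blast
  then obtain G where G: "G \<in> C" "pverts G = {1..n}" "pair_graph G"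
    using pair_graph_class by (auto simp: graphs_on_def)
  then have "1 \<in> pverts G" using \<open>0 < n\<close> by simp
  then have "induced G (comp G 1) \<in> graph_components G" by (auto simp: graph_components_eq[OF G(3)])
  then show ?thesis using component_conn_members[OF G(1)] by blast
qed

lemma sum_remove_component_eq:
  fixes w :: "nat \<Rightarrow> real"
  assumes F: "iso_closed F" "F \<subseteq> conn_members" and L: "\<And>H. H \<in> F \<Longrightarrow> card (pverts H) \<le> L"
    and n: "L \<le> n"
  shows "(\<Sum>G\<in>graphs_on C n. count_in F G * w (count_in F G - 1)) =
    (\<Sum>h\<le>L. (n choose h) * (card {H \<in> graphs_on C h. H \<in> F} *
       (\<Sum>G\<in>graphs_on C (n - h). w (count_in F G))))"
proof -
  have 0: "card {H \<in> graphs_on C h. H \<in> F} = 0" if "L < h" for h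
  proof -
    have "{H \<in> graphs_on C h. H \<in> F} = {}"
      using that L by (force simp: graphs_on_def)
    then show ?thesis by simp
  qed
  show ?thesis
    unfolding sum_remove_component[OF F, where w = w]
  proof (rule sum.mono_neutral_right)
    show "\<forall>h\<in>{..n} - {..L}. (n choose h) * (card {H \<in> graphs_on C h. H \<in> F} *
       (\<Sum>G\<in>graphs_on C (n - h). w (count_in F G))) = 0"
    proof
      fix h assume "h \<in> {..n} - {..L}"
      then have "L < h" by simp
      then show "(n choose h) * (card {H \<in> graphs_on C h. H \<in> F} *
         (\<Sum>G\<in>graphs_on C (n - h). w (count_in F G))) = 0"
        unfolding 0[OF \<open>L < h\<close>] by simp
    qed
  qed (use n in auto)
qed

text \<open>Fix a connected graph of the class, with \<open>h\<close> vertices. Counting graphs with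
  a distinguished component of order \<open>h\<close> gives at least
  \<open>(n choose h) * cnt (n - h)\<close>, while the mean number of components is at most 3. So
  the quotients converging to \<open>\<gamma> ^ h\<close> stay above
  \<open>1 / (3 * fact h)\<close>.\<close>

lemma gamma_pos: "0 < \<gamma>"
proof -
  obtain H0 where H0: "H0 \<in> conn_members" using conn_members_nonempty by auto
  define h where "h = card (pverts H0)"
  note hd = conn_membersD[OF H0]
  have "0 < h" using hd by (simp add: h_def card_gt_0_iff)
  have iso: "iso_closed conn_members"
    unfolding iso_closed_def using conn_members_image by blast
  obtain f where f: "bij_betw f (pverts H0) {1..h}"
    using hd(5) unfolding h_def by (metis ex_bij_betw_finite_nat ex_bij_betw_nat_finite_1 bij_betw_inv)
  then have "image_graph f H0 \<in> {H \<in> graphs_on C h. H \<in> conn_members}"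
    using conn_members_image[OF H0] conn_membersD(1)[OF conn_members_image[OF H0]]
    by (auto simp: bij_betw_def graphs_on_def)
  then have f1: "1 \<le> card {H \<in> graphs_on C h. H \<in> conn_members}"
    by (simp add: Suc_le_eq card_gt_0_iff) blast
  have bound: "real (n choose h) * real (cnt (n - h)) \<le> 3 * real (cnt n)" if n: "h \<le> n" for n
  proof -
    let ?f = "\<lambda>i. real (n choose i) * (real (card {H \<in> graphs_on C i. H \<in> conn_members}) *
       (\<Sum>G\<in>graphs_on C (n - i). 1))"
    have "1 * real (cnt (n - h)) \<le>
        real (card {H \<in> graphs_on C h. H \<in> conn_members}) * (\<Sum>G\<in>graphs_on C (n - h). 1)"
      using f1 by (simp only: sum_constant) (rule mult_mono, auto)
    then have "real (n choose h) * (1 * real (cnt (n - h))) \<le> ?f h"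
      by (rule mult_left_mono) simp
    also have "\<dots> \<le> (\<Sum>i\<le>n. ?f i)"
      by (rule member_le_sum) (use n in auto)
    also have "\<dots> = (\<Sum>G\<in>graphs_on C n. real (count_in conn_members G))"
      using sum_remove_component[OF iso order_refl, where n = n and w = "\<lambda>_. 1"] by simp
    also have "\<dots> \<le> (\<Sum>G\<in>graphs_on C n. real (card (graph_components G)))"
      using pair_graph_class by (intro sum_mono) (auto simp: graphs_on_def intro!: count_in_le)
    also have "\<dots> \<le> 3 * real (cnt n)"
      using of_nat_mono[OF sum_components[of n], where ?'a = real] n \<open>0 < h\<close> by simp
    finally show ?thesis by simp
  qed
  have "\<forall>\<^sub>F n in sequentially.
      1 / (3 * fact h) \<le> real (cnt n) / (fact h * real (n choose h) * real (cnt (n - h)))"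
    using eventually_cnt_pos_shift[of h] eventually_ge_at_top[of h]
  proof eventually_elim
    fix n assume n: "0 < cnt (n - h)" "h \<le> n"
    then have "0 < fact h * real (n choose h) * real (cnt (n - h))" by simp
    then show "1 / (3 * fact h) \<le> real (cnt n) / (fact h * real (n choose h) * real (cnt (n - h)))"
      using bound[OF n(2)] by (simp add: field_simps)
  qed
  then have "1 / (3 * fact h) \<le> \<gamma> ^ h"
    by (rule tendsto_lowerbound[OF ratio_power _ sequentially_bot])
  then have "\<gamma> ^ h > 0" by (smt (verit) divide_pos_pos fact_gt_zero)
  moreover have "0 \<le> \<gamma>"
    by (rule tendsto_lowerbound[OF ratio]) auto
  ultimately show ?thesis using \<open>0 < h\<close> by (cases "\<gamma> = 0") (auto simp: power_0_left)
qed

lemma inverse_ratio: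
  "(\<lambda>n. real (n choose h) * real (cnt (n - h)) / real (cnt n)) \<longlonglongrightarrow> 1 / (fact h * \<gamma> ^ h)"
proof -
  have "(\<lambda>n. 1 / (fact h * (real (cnt n) / (fact h * real (n choose h) * real (cnt (n - h))))))
      \<longlonglongrightarrow> 1 / (fact h * \<gamma> ^ h)"
    using gamma_pos by (intro tendsto_intros ratio_power) auto
  then show ?thesis by simp
qed

definition mean :: "(nat pair_pre_digraph \<Rightarrow> real) \<Rightarrow> nat \<Rightarrow> real" where
  "mean w n = (\<Sum>G\<in>graphs_on C n. w G) / real (cnt n)"

text \<open>The exponential generating function of \<open>F\<close> at \<open>1 / \<gamma>\<close>,
  cut off at order \<open>L\<close>: the limiting mean number of components in
  \<open>F\<close>.\<close>

definition poisson_mean :: "nat pair_pre_digraph set \<Rightarrow> nat \<Rightarrow> real" where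
  "poisson_mean F L = (\<Sum>h\<le>L. real (card {H \<in> graphs_on C h. H \<in> F}) / (fact h * \<gamma> ^ h))"

text \<open>The identity characterising a Poisson variable \<open>X\<close> of mean \<mu>, namely
  that \<open>X * w (X - 1)\<close> has mean \<mu> times that of \<open>w X\<close>, holds in the
  limit. Removing a component of order \<open>h\<close> contributes the factor from
  \<open>inverse_ratio\<close>; finitely many \<open>h\<close> occur because \<open>F\<close> has
  bounded order.\<close>

lemma mean_step:
  fixes w :: "nat \<Rightarrow> real"
  assumes F: "iso_closed F" "F \<subseteq> conn_members" and L: "\<And>H. H \<in> F \<Longrightarrow> card (pverts H) \<le> L"
    and lim: "mean (\<lambda>G. w (count_in F G)) \<longlonglongrightarrow> l"
  shows "mean (\<lambda>G. count_in F G * w (count_in F G - 1)) \<longlonglongrightarrow> poisson_mean F L * l"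
proof -
  let ?f = "\<lambda>h. real (card {H \<in> graphs_on C h. H \<in> F})"
  let ?m = "mean (\<lambda>G. w (count_in F G))"
  have "(\<lambda>n. \<Sum>h\<le>L. ?f h * (real (n choose h) * real (cnt (n - h)) / real (cnt n)) * ?m (n - h))
      \<longlonglongrightarrow> (\<Sum>h\<le>L. ?f h * (1 / (fact h * \<gamma> ^ h)) * l)"
    by (intro tendsto_sum tendsto_mult tendsto_const inverse_ratio
        filterlim_compose[OF lim filterlim_minus_const_nat_at_top])
  moreover have "(\<Sum>h\<le>L. ?f h * (1 / (fact h * \<gamma> ^ h)) * l) = poisson_mean F L * l"
    by (simp add: poisson_mean_def sum_distrib_right)
  moreover have "\<forall>\<^sub>F n in sequentially.
      (\<Sum>h\<le>L. ?f h * (real (n choose h) * real (cnt (n - h)) / real (cnt n)) * ?m (n - h)) =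
      mean (\<lambda>G. count_in F G * w (count_in F G - 1)) n"
    using eventually_ge_at_top[of L]
  proof eventually_elim
    fix n assume n: "L \<le> n"
    \<comment> \<open>Also true when there is no graph of order \<open>k\<close>: both sides are
      then 0.\<close>
    have s: "(\<Sum>G\<in>graphs_on C k. w (count_in F G)) = real (cnt k) * ?m k" for k
      by (cases "graphs_on C k = {}") (auto simp: mean_def)
    have "(\<Sum>G\<in>graphs_on C n. count_in F G * w (count_in F G - 1)) =
      (\<Sum>h\<le>L. (n choose h) * (?f h * (real (cnt (n - h)) * ?m (n - h))))"
      unfolding s[symmetric] by (rule sum_remove_component_eq[OF F L n])
    then have "mean (\<lambda>G. count_in F G * w (count_in F G - 1)) n =
      (\<Sum>h\<le>L. (n choose h) * (?f h * (real (cnt (n - h)) * ?m (n - h)))) / real (cnt n)"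
      unfolding mean_def[of "\<lambda>G. count_in F G * w (count_in F G - 1)"] by (rule arg_cong)
    also have "\<dots> =
      (\<Sum>h\<le>L. ?f h * (real (n choose h) * real (cnt (n - h)) / real (cnt n)) * ?m (n - h))"
      unfolding sum_divide_distrib by (intro sum.cong) auto
    finally show "(\<Sum>h\<le>L. ?f h * (real (n choose h) * real (cnt (n - h)) / real (cnt n)) * ?m (n - h)) =
      mean (\<lambda>G. count_in F G * w (count_in F G - 1)) n" ..
  qed
  ultimately show ?thesis by (simp add: tendsto_cong)
qed

lemma mean_const: "mean (\<lambda>_. c) \<longlonglongrightarrow> c"
proof -
  have "\<forall>\<^sub>F n in sequentially. mean (\<lambda>_. c) n = c"
    using eventually_cnt_pos by eventually_elim (auto simp: mean_def card_gt_0_iff)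
  then show ?thesis by (rule tendsto_eventually)
qed

lemma mean_cmult: "mean (\<lambda>G. c * w G) n = c * mean w n"
  by (simp add: mean_def sum_distrib_left)

lemma mean_mono: "(\<And>G. w G \<le> v G) \<Longrightarrow> mean w n \<le> mean v n"
  by (simp add: mean_def divide_right_mono sum_mono)

lemma mean_diff: "mean (\<lambda>G. w G - v G) n = mean w n - mean v n"
  by (simp add: mean_def sum_subtractf diff_divide_distrib)

lemma mean_sum: "mean (\<lambda>G. \<Sum>j\<in>J. w j G) n = (\<Sum>j\<in>J. mean (w j) n)"
  unfolding mean_def by (subst sum.swap) (simp add: sum_divide_distrib)

lemma abs_mean_le: "\<bar>mean w n\<bar> \<le> mean (\<lambda>G. \<bar>w G\<bar>) n"
  by (simp add: mean_def divide_right_mono)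

section \<open>Components of bounded size\<close>

context
  fixes F L
  assumes F: "iso_closed F" "F \<subseteq> conn_members" and L: "\<And>H. H \<in> F \<Longrightarrow> card (pverts H) \<le> L"
begin

text \<open>Apply \<open>mean_step\<close> to the binomial coefficients of lower index
  \<open>j\<close>. The limits are the binomial moments of a Poisson variable.\<close>

lemma binomial_moments:
  "mean (\<lambda>G. real (count_in F G choose j)) \<longlonglongrightarrow> poisson_mean F L ^ j / fact j"
proof (induction j)
  case 0
  show ?case using mean_const[of 1] by simp
next
  case (Suc j)
  have "x * (x - 1 choose j) = Suc j * (x choose Suc j)" for x
    by (cases x) (simp_all only: mult_0 diff_Suc_1 Suc_times_binomial binomial_0_Suc mult_0_right)
  then have "real x * real (x - 1 choose j) = real (Suc j) * real (x choose Suc j)" for x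
    by (metis of_nat_mult)
  then have "(\<lambda>n. real (Suc j) * mean (\<lambda>G. real (count_in F G choose Suc j)) n)
      \<longlonglongrightarrow> poisson_mean F L * (poisson_mean F L ^ j / fact j)"
    using mean_step[OF F L Suc] unfolding mean_cmult[symmetric] by simp
  then have "(\<lambda>n. real (Suc j) * mean (\<lambda>G. real (count_in F G choose Suc j)) n / real (Suc j))
      \<longlonglongrightarrow> poisson_mean F L * (poisson_mean F L ^ j / fact j) / real (Suc j)"
    by (rule tendsto_divide) auto
  then show ?case by (simp add: field_simps del: of_nat_Suc)
qed

text \<open>The truncation error is at most the next binomial moment, whose limit is a term of an
  exponential series and hence small for a late cutoff \<open>J = Suc I\<close>.\<close>

lemma convergent_count_eq_0: "convergent (mean (\<lambda>G. if count_in F G = 0 then 1 else 0))"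
proof (rule convergent_approx)
  fix e :: real assume "0 < e"
  let ?\<mu> = "poisson_mean F L"
  obtain J where J: "?\<mu> ^ J / fact J < e" "0 < J" using exponential_tail[OF \<open>0 < e\<close>] .
  then obtain I where I: "J = Suc I" by (cases J) auto
  define y where "y n = (\<Sum>j\<le>I. (- 1) ^ j * mean (\<lambda>G. real (count_in F G choose j)) n)" for n
  have "y \<longlonglongrightarrow> (\<Sum>j\<le>I. (- 1) ^ j * (?\<mu> ^ j / fact j))"
    unfolding y_def by (intro tendsto_intros binomial_moments)
  then have "convergent y" by (rule convergentI)
  moreover have "\<forall>\<^sub>F n in sequentially. mean (\<lambda>G. real (count_in F G choose Suc I)) n < e"
    using order_tendstoD(2)[OF binomial_moments] J(1) unfolding I .
  then have "\<forall>\<^sub>F n in sequentially. \<bar>mean (\<lambda>G. if count_in F G = 0 then 1 else 0) n - y n\<bar> \<le> e"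
  proof eventually_elim
    fix n assume n: "mean (\<lambda>G. real (count_in F G choose Suc I)) n < e"
    have "\<bar>mean (\<lambda>G. if count_in F G = 0 then 1 else 0) n - y n\<bar> =
        \<bar>mean (\<lambda>G. (if count_in F G = 0 then 1 else 0) -
          (\<Sum>j\<le>I. (- 1) ^ j * real (count_in F G choose j))) n\<bar>"
      unfolding y_def mean_diff mean_sum mean_cmult ..
    also have "\<dots> \<le> mean (\<lambda>G. real (count_in F G choose Suc I)) n"
      by (rule order_trans[OF abs_mean_le mean_mono[OF bonferroni_zero]])
    finally show "\<bar>mean (\<lambda>G. if count_in F G = 0 then 1 else 0) n - y n\<bar> \<le> e" using n by simp
  qed
  ultimately show "\<exists>y. convergent y \<and>
      (\<forall>\<^sub>F n in sequentially. \<bar>mean (\<lambda>G. if count_in F G = 0 then 1 else 0) n - y n\<bar> \<le> e)"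
    by blast
qed

text \<open>With the indicator of \<open>k\<close> as weight, \<open>mean_step\<close> passes from
  \<open>k\<close> to \<open>Suc k\<close>, so inclusion-exclusion is needed for the value 0
  only.\<close>

lemma convergent_count_eq: "convergent (mean (\<lambda>G. if count_in F G = k then 1 else 0))"
proof (induction k)
  case 0
  show ?case by (rule convergent_count_eq_0)
next
  case (Suc k)
  then obtain l where l: "mean (\<lambda>G. if count_in F G = k then 1 else 0) \<longlonglongrightarrow> l"
    by (auto simp: convergent_def)
  have "real x * (if x - 1 = k then 1 else 0) = real (Suc k) * (if x = Suc k then 1 else 0)" for x
    by (cases x) auto
  then have "(\<lambda>n. real (Suc k) * mean (\<lambda>G. if count_in F G = Suc k then 1 else 0) n)
      \<longlonglongrightarrow> poisson_mean F L * l"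
    using mean_step[OF F L l] unfolding mean_cmult[symmetric] by simp
  then have "(\<lambda>n. real (Suc k) * mean (\<lambda>G. if count_in F G = Suc k then 1 else 0) n / real (Suc k))
      \<longlonglongrightarrow> poisson_mean F L * l / real (Suc k)"
    by (rule tendsto_divide) auto
  then show ?case by (auto simp: convergent_def simp del: of_nat_Suc)
qed

end

lemma mean_indicator: "mean (\<lambda>G. if P G then 1 else 0) n = real (card {G \<in> graphs_on C n. P G}) / real (cnt n)"
  by (simp add: mean_def sum.If_cases Int_def)

end

section \<open>The type of the large component\<close>

locale universal_pattern = addable_pattern +
  fixes m :: nat
  assumes absorbing: "absorbing m U u"
begin

text \<open>The component is the bridge-join of the pendant copy and its remainder, the form treated
  by \<open>mso_equiv_pendant\<close>. The component as a whole is in the class, although the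
  remainder may not be.\<close>

lemma mso_equiv_good_comp:
  assumes G: "G \<in> C" and z: "z \<in> pverts G" and good: "good_comp G z"
  shows "mso_equiv m (induced G (comp G z)) U"
proof -
  have pg: "pair_graph G" using G by (rule pair_graph_class)
  obtain W x v where W: "pend G W x v" and v: "v \<in> comp G z" using good by (auto simp: good_comp_def)
  define Z where "Z = comp G z"
  have cl: "b \<in> Z" if "a \<in> Z" "(a, b) \<in> (parcs G)\<^sup>*" for a b
  proof -
    have "comp G a = Z" using comp_eq[OF pair_graphD(3)[OF pg]] that(1) by (simp add: Z_def)
    then show ?thesis using that(2) by (auto simp: comp_def)
  qed
  have sy: "(b, a) \<in> parcs G" if "(a, b) \<in> parcs G" for a b
    using that pair_graphD(3)[OF pg] by (auto simp: sym_def)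
  have ZV: "Z \<subseteq> pverts G" unfolding Z_def by (rule comp_subset[OF pair_graphD(2)[OF pg] z])
  have vZ: "v \<in> Z - W" using v pendD(3)[OF W] by (simp add: Z_def)
  have "x \<in> Z" using cl[of v x] vZ sy[OF pendD(4)[OF W]] by auto
  have WZ: "W \<subseteq> Z"
  proof
    fix w assume "w \<in> W"
    then have "(x, w) \<in> (parcs G \<inter> W \<times> W)\<^sup>*" by (rule pend_conn[OF pg W pendD(5)[OF W]])
    moreover have "(parcs G \<inter> W \<times> W)\<^sup>* \<subseteq> (parcs G)\<^sup>*" by (rule rtrancl_mono) auto
    ultimately show "w \<in> Z" using cl[OF \<open>x \<in> Z\<close>] by blast
  qed
  have ex: "a = x \<and> b = v" if "a \<in> W" "b \<in> Z" "b \<notin> W" "(a, b) \<in> parcs G" for a b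
    using pendD(7)[OF W that(1) _ that(3,4)] that(2) ZV by auto
  have J: "induced G Z = join x v (induced G W) (induced G (Z - W))"
  proof (rule pair_pre_digraph.equality)
    show "parcs (induced G Z) = parcs (join x v (induced G W) (induced G (Z - W)))"
    proof (intro equalityI subsetI)
      fix e assume e: "e \<in> parcs (induced G Z)"
      obtain a b where ab: "e = (a, b)" by (cases e)
      then have abZ: "(a, b) \<in> parcs G" "a \<in> Z" "b \<in> Z" using e by auto
      show "e \<in> parcs (join x v (induced G W) (induced G (Z - W)))"
        using abZ ex[of a b] ex[of b a] sy[OF abZ(1)] unfolding ab
        by (cases "a \<in> W"; cases "b \<in> W") simp_all
    next
      fix e assume "e \<in> parcs (join x v (induced G W) (induced G (Z - W)))"
      then show "e \<in> parcs (induced G Z)"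
        using WZ vZ \<open>x \<in> Z\<close> pendD(4)[OF W] sy[OF pendD(4)[OF W]] by auto
    qed
  qed (use WZ in auto)
  have comp_Z: "induced G Z \<in> conn_members"
    by (rule component_conn_members[OF G]) (use z in \<open>auto simp: graph_components_eq[OF pg] Z_def\<close>)
  have U': "U \<in> conn_members" using UC U(2) by (simp add: conn_members_def)
  obtain f where f: "inj_on f (pverts U)" "induced G W = image_graph f U" "f u = x"
    using W by (auto simp: pendant_def)
  have "game m 1 (induced G W) (\<lambda>_. {x}) U (\<lambda>_. {u})"
    unfolding f(2) f(3)[symmetric]
    by (rule game_sym[OF game_image_root[OF f(1) pair_graphD(2)[OF U(1)] u]])
  from mso_equiv_pendant[OF U' u absorbing this, of "induced G (Z - W)" v]
  show ?thesis
    using comp_Z pendD(5)[OF W] vZ unfolding J Z_def[symmetric] by (auto simp: wf_graph_def)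
qed

end

locale smooth_universal = universal_pattern C U u m + smooth_class C \<gamma> for C U u m \<gamma>
begin

text \<open>By smoothness \<open>cnt (n + h)\<close> is of the order of
  \<open>((n + h) choose h) * cnt n\<close>, so \<open>bad_switching\<close> leaves a bound of order
  \<open>1 / n\<close>.\<close>

lemma bad_rare: "mean (\<lambda>G. if bad G then 1 else 0) \<longlonglongrightarrow> 0"
proof -
  define h where "h = card (pverts U)"
  define K where "K = real (2 * (h * h + 2))"
  let ?r = "\<lambda>n. real (cnt n) / (fact h * real (n choose h) * real (cnt (n - h)))"
  have "(\<lambda>n. ?r (n + h)) \<longlonglongrightarrow> \<gamma> ^ h"
    using ratio_power[of h] by (rule LIMSEQ_ignore_initial_segment)
  then have "(\<lambda>n. K * fact h * ?r (n + h) * (1 / real n)) \<longlonglongrightarrow> K * fact h * \<gamma> ^ h * 0"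
    by (intro tendsto_intros lim_const_over_n)
  then have up: "(\<lambda>n. K * fact h * ?r (n + h) * (1 / real n)) \<longlonglongrightarrow> 0" by simp
  show ?thesis
  proof (rule tendsto_sandwich[OF _ _ tendsto_const up])
    show "\<forall>\<^sub>F n in sequentially. 0 \<le> mean (\<lambda>G. if bad G then 1 else 0) n"
      by (simp add: mean_indicator)
    show "\<forall>\<^sub>F n in sequentially. mean (\<lambda>G. if bad G then 1 else 0) n \<le> K * fact h * ?r (n + h) * (1 / real n)"
      using eventually_cnt_pos eventually_gt_at_top[of 0]
    proof eventually_elim
      fix n assume n: "0 < cnt n" "0 < n"
      have b: "real ((n + h) choose h) * (real (card {G \<in> graphs_on C n. bad G}) * real n)
          \<le> K * real (cnt (n + h))"
        using of_nat_mono[OF bad_switching[of n], where ?'a = real]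
        unfolding h_def[symmetric] K_def by (simp only: of_nat_mult)
      have c: "0 < real ((n + h) choose h)" by simp
      have r: "K * fact h * ?r (n + h) * (1 / real n) =
          K * real (cnt (n + h)) / (real ((n + h) choose h) * real n) / real (cnt n)"
        by simp
      have le: "real (card {G \<in> graphs_on C n. bad G}) \<le>
          K * real (cnt (n + h)) / (real ((n + h) choose h) * real n)"
        using b c n(2) by (simp add: pos_le_divide_eq mult_ac)
      show "mean (\<lambda>G. if bad G then 1 else 0) n \<le> K * fact h * ?r (n + h) * (1 / real n)"
        unfolding mean_indicator r by (rule divide_right_mono[OF le]) simp
    qed
  qed
qed

text \<open>Outside three rare events the count equals that of the small members plus the constant
  \<delta>. The probabilities for the small members converge for each \<open>L\<close>, and
  \<open>convergent_approx\<close> removes the cutoff.\<close>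

lemma convergent_count_mso_class:
  fixes H0 :: "nat pair_pre_digraph"
  defines "A \<equiv> {H \<in> connected_graphs. mso_equiv m H0 H}"
  shows "convergent (mean (\<lambda>G. if count_in A G = k then 1 else 0))"
proof (rule convergent_approx)
  fix e :: real assume e: "0 < e"
  \<comment> \<open>Chosen so that the bound \<open>2 / L\<close> on the probability of two
    components with more than \<open>L\<close> vertices is at most \<open>e / 3\<close>.\<close>
  obtain L :: nat where L: "6 / e < real L" using reals_Archimedean2 by blast
  have "0 < 6 / e" using e by simp
  then have L0: "0 < L" using L by (metis gr0I less_asym of_nat_0)
  define F where "F = {H \<in> conn_members. card (pverts H) \<le> L \<and> mso_equiv m H0 H}"
  \<comment> \<open>The contribution of the large component, which has the type of \<open>U\<close>
    unless the graph is bad.\<close>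
  define \<delta> :: nat where "\<delta> = (if mso_equiv m H0 U then 1 else 0)"
  have F: "iso_closed F" "F \<subseteq> conn_members" "\<And>H. H \<in> F \<Longrightarrow> card (pverts H) \<le> L"
  proof -
    show "iso_closed F"
      unfolding iso_closed_def F_def
      using conn_members_image mso_equiv_image mso_equiv_trans conn_membersD(4)
      by (auto simp: card_image) blast
  qed (auto simp: F_def)
  define y where "y = mean (\<lambda>G. if count_in F G + \<delta> = k then 1 else 0)"
  have "convergent y"
  proof (cases "\<delta> \<le> k")
    case True
    then have "y = mean (\<lambda>G. if count_in F G = k - \<delta> then 1 else 0)"
      unfolding y_def by (metis (no_types, opaque_lifting) add_diff_cancel_right' le_add_diff_inverse2)
    then show ?thesis using convergent_count_eq[OF F] by simp
  next
    \<comment> \<open>Here \<delta> is 1 and \<open>k\<close> is 0, so the event never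
      occurs.\<close>
    case False
    then have "y = mean (\<lambda>G. 0)" unfolding y_def by (intro arg_cong[of _ _ mean]) auto
    then show ?thesis using mean_const convergentI by metis
  qed
  define E1 where "E1 n G \<longleftrightarrow> (\<forall>v\<in>pverts G. 2 * card (comp G v) \<le> n)"
    for n and G :: "nat pair_pre_digraph"
  define E2 where "E2 G \<longleftrightarrow> (\<exists>H\<in>graph_components G. \<exists>K\<in>graph_components G.
      H \<noteq> K \<and> L < card (pverts H) \<and> L < card (pverts K))" for G :: "nat pair_pre_digraph"
  have count: "count_in A G = count_in F G + \<delta>"
    if G: "G \<in> graphs_on C n" and n: "2 * L \<le> n" and "\<not> E1 n G" "\<not> E2 G" "\<not> bad G" for n G
  proof -
    have GC: "G \<in> C" "pverts G = {1..n}" using G by (auto simp: graphs_on_def)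
    have pg: "pair_graph G" using GC(1) by (rule pair_graph_class)
    obtain z where z: "z \<in> pverts G" "n < 2 * card (comp G z)"
      using \<open>\<not> E1 n G\<close> by (auto simp: E1_def not_le)
    have "good_comp G z" using \<open>\<not> bad G\<close> z GC(2) by (auto simp: bad_def)
    define Z where "Z = induced G (comp G z)"
    have ZU: "mso_equiv m Z U"
      unfolding Z_def by (rule mso_equiv_good_comp[OF GC(1) z(1) \<open>good_comp G z\<close>])
    have Z: "Z \<in> graph_components G" using z by (auto simp: graph_components_eq[OF pg] Z_def)
    \<comment> \<open>Since \<open>2 * L\<close> is at most \<open>n\<close>, a component with more
      than half of the vertices is too large for \<open>F\<close> and is not counted twice.\<close>
    have ZL: "L < card (pverts Z)" using z(2) n by (simp add: Z_def)
    have small: "card (pverts H) \<le> L" if "H \<in> graph_components G" "H \<noteq> Z" for H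
      using that Z ZL \<open>\<not> E2 G\<close> unfolding E2_def by (meson not_le)
    have AH: "H \<in> A \<longleftrightarrow> mso_equiv m H0 H" if "H \<in> graph_components G" for H
      using component_conn_members[OF GC(1) that] conn_membersD
      by (auto simp: A_def connected_graphs_def)
    have FH: "H \<in> F \<longleftrightarrow> H \<noteq> Z \<and> mso_equiv m H0 H" if "H \<in> graph_components G" for H
      using component_conn_members[OF GC(1) that] small[OF that] ZL by (auto simp: F_def)
    have \<delta>: "\<delta> = (if mso_equiv m H0 Z then 1 else 0)"
      using ZU mso_equiv_trans mso_equiv_sym unfolding \<delta>_def by metis
    have fin: "finite {H \<in> graph_components G. H \<in> F}" using finite_graph_components[OF pg] by simp
    have "{H \<in> graph_components G. H \<in> A} =
        (if mso_equiv m H0 Z then insert Z {H \<in> graph_components G. H \<in> F}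
         else {H \<in> graph_components G. H \<in> F})"
      using AH FH Z by auto
    moreover have "Z \<notin> {H \<in> graph_components G. H \<in> F}" using FH Z by auto
    ultimately show ?thesis using fin unfolding count_in_def \<delta> by auto
  qed
  have "\<forall>\<^sub>F n in sequentially. mean (\<lambda>G. if bad G then 1 else 0) n < e / 3"
    by (rule order_tendstoD(2)[OF bad_rare]) (use e in simp)
  moreover have "\<forall>\<^sub>F n in sequentially. 4 / real n < e / 3"
    by (rule order_tendstoD(2)[OF lim_const_over_n]) (use e in simp)
  ultimately have "\<forall>\<^sub>F n in sequentially. \<bar>mean (\<lambda>G. if count_in A G = k then 1 else 0) n - y n\<bar> \<le> e"
    using eventually_ge_at_top[of "2 * L"] eventually_cnt_pos
  proof eventually_elim
    fix n assume n: "mean (\<lambda>G. if bad G then 1 else 0) n < e / 3" "4 / real n < e / 3"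
      "2 * L \<le> n" "0 < cnt n"
    have n0: "0 < n" using n(3) L0 by simp
    have "mean (\<lambda>G. if E1 n G then 1 else 0) n \<le> 4 / real n"
    proof -
      have "real (card {G \<in> graphs_on C n. E1 n G}) * real n \<le> 4 * real (cnt n)"
        using of_nat_mono[OF no_large_component_rare[OF n0], where ?'a = real]
        unfolding E1_def by (simp only: of_nat_mult of_nat_numeral)
      then show ?thesis using n(4) n0 by (simp add: mean_indicator field_simps)
    qed
    then have e1: "mean (\<lambda>G. if E1 n G then 1 else 0) n \<le> e / 3" using n(2) by linarith
    have "mean (\<lambda>G. if E2 G then 1 else 0) n \<le> 2 / real L"
    proof -
      have "real (card {G \<in> graphs_on C n. E2 G}) * real L \<le> 2 * real (cnt n)"
        using of_nat_mono[OF two_large_components_rare[OF n0, of L], where ?'a = real]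
        unfolding E2_def by (simp only: of_nat_mult of_nat_numeral)
      then show ?thesis using n(4) L0 by (simp add: mean_indicator field_simps)
    qed
    moreover have "2 / real L \<le> e / 3" using L L0 e by (simp add: field_simps)
    ultimately have e2: "mean (\<lambda>G. if E2 G then 1 else 0) n \<le> e / 3" by linarith
    have "\<bar>mean (\<lambda>G. if count_in A G = k then 1 else 0) n - y n\<bar> \<le>
        mean (\<lambda>G. \<bar>(if count_in A G = k then 1 else 0) - (if count_in F G + \<delta> = k then 1 else 0)\<bar>) n"
      unfolding y_def mean_diff[symmetric] by (rule abs_mean_le)
    also have "\<dots> \<le> mean (\<lambda>G. (if E1 n G then 1 else 0) + (if E2 G then 1 else 0) + (if bad G then 1 else 0)) n"
      unfolding mean_def
    proof (intro divide_right_mono sum_mono)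
      fix G assume "G \<in> graphs_on C n"
      then show "\<bar>(if count_in A G = k then 1 else 0) - (if count_in F G + \<delta> = k then 1 else (0::real))\<bar> \<le>
          (if E1 n G then 1 else 0) + (if E2 G then 1 else 0) + (if bad G then 1 else 0)"
        using count[of G n] n(3) by auto
    qed simp
    also have "\<dots> = mean (\<lambda>G. if E1 n G then 1 else 0) n + mean (\<lambda>G. if E2 G then 1 else 0) n +
        mean (\<lambda>G. if bad G then 1 else 0) n"
      by (simp add: mean_def sum.distrib add_divide_distrib)
    finally show "\<bar>mean (\<lambda>G. if count_in A G = k then 1 else 0) n - y n\<bar> \<le> e"
      using e1 e2 n(1) by linarith
  qed
  then show "\<exists>y. convergent y \<and>
      (\<forall>\<^sub>F n in sequentially. \<bar>mean (\<lambda>G. if count_in A G = k then 1 else 0) n - y n\<bar> \<le> e)"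
    using \<open>convergent y\<close> by blast
qed

end

theorem theorem21:
  fixes C A :: "nat pair_pre_digraph set" and m r k :: nat
  assumes "graph_class C" and "addable C" and "smooth C"
    and "union_threshold m r"
    and "A \<in> connected_graphs // connected_mso_equiv m"
    and "k \<le> r"
  shows "\<exists>p::real. (\<lambda>n. measure_pmf.prob (random_graph C n)
           {G. card {H \<in> graph_components G. H \<in> A} = k}) \<longlonglongrightarrow> p"
proof -
  obtain \<gamma> where nonempty: "\<forall>\<^sub>F n in sequentially. graphs_on C n \<noteq> {}"
    and ratio: "(\<lambda>n. real (card (graphs_on C n)) / (real n * real (card (graphs_on C (n - 1))))) \<longlonglongrightarrow> \<gamma>"
    using assms(3) by (auto simp: smooth_def)
  interpret smooth_class C \<gamma>
    using assms(1,2) nonempty ratio by unfold_locales (auto simp: addable_def)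
  obtain U u where U: "U \<in> conn_members" "u \<in> pverts U" "absorbing m U u"
    using exists_absorbing[OF conn_members_nonempty] by blast
  interpret UG: pair_graph U by (rule conn_membersD(3)[OF U(1)])
  interpret smooth_universal C U u m \<gamma>
    by unfold_locales (use U conn_membersD[OF U(1)] in blast)+
  obtain H0 where H0: "H0 \<in> connected_graphs" "A = connected_mso_equiv m `` {H0}"
    using assms(5) by (auto elim: quotientE)
  then have A: "A = {H \<in> connected_graphs. mso_equiv m H0 H}"
    by (auto simp: connected_mso_equiv_def)
  obtain p where p: "mean (\<lambda>G. if count_in A G = k then 1 else 0) \<longlonglongrightarrow> p"
    using convergent_count_mso_class[of H0 k] unfolding A convergent_def by blast
  \<comment> \<open>The uniform distribution is meaningful only on a nonempty set, so the two
    expressions are identified only for large \<open>n\<close>.\<close>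
  have "\<forall>\<^sub>F n in sequentially. measure_pmf.prob (random_graph C n)
           {G. card {H \<in> graph_components G. H \<in> A} = k} = mean (\<lambda>G. if count_in A G = k then 1 else 0) n"
    using nonempty
  proof eventually_elim
    fix n assume "graphs_on C n \<noteq> {}"
    then show "measure_pmf.prob (random_graph C n) {G. card {H \<in> graph_components G. H \<in> A} = k} =
        mean (\<lambda>G. if count_in A G = k then 1 else 0) n"
      by (simp add: random_graph_def measure_pmf_of_set mean_indicator count_in_def Int_def)
  qed
  then have "(\<lambda>n. measure_pmf.prob (random_graph C n)
      {G. card {H \<in> graph_components G. H \<in> A} = k}) \<longlonglongrightarrow> p"
    using p by (simp add: tendsto_cong)
  then show ?thesis by blast
qed

end
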